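(* Let $f:N\to N$ be a non-renormalizable piecewise affine map of an interval $N=[a,b]$. Then $f$ has the Markov property if and only if $f$ does not have a zero-dimensional absorbing set.
   Context: Intervals always have positive length. A continuous map $f:N\to N$, $N=[a,b]$, is piecewise affine if there exist points $a=a_0<a_1<\dots<a_d<a_{d+1}=b$ such that each $f|[a_i,a_{i+1}]$ is affine, with slope $Df_i$, and $Df_iDf_{i+1}<0$. The points $a_1,\dots,a_d$ are the critical points; $C_f$ is the set of critical points. $|A|$ denotes Lebesgue measure, $orb(A)=\bigcup_{i\ge 0}f^i(A)$, and $\partial U$ is the boundary of $U$. A pair $(I,n)$, with $I\subset N$ an interval and $n\ge 1$, is a renormalization of $f$ if $f^n(I)\subset I$, $\overline{I}\neq N$, and the interiors of $f^i(I)$, $i=0,\dots,n-1$, are pairwise disjoint. $f$ is non-renormalizable if it has no renormalization. A nice neighborhood of $C_f$ is an open set $U\supset C_f$, $U\subset N$, such that $orb(\partial U)\cap U=\emptyset$ and every connected component of $U$ contains exactly one critical point; $U_c$ denotes the component containing $c\in C_f$, so $U=\bigcup_{c\in C_f}U_c$. An interval $T\subset N$ is a good interval of time $n\ge 0$ for $U_c$ if $f^n:T\to U_c$ is monotone and onto; it is a good interval for $U$ if it is a good interval for some $U_c$. The mesh of $U$ is the length of its longest connected component. Nice neighborhoods $U$ used to define Markov maps are taken with mesh small enough that every interval $I\subset N$ contains, for every $c\in C_f$, a good interval for $U_c$ of time at least $1$. For such a $U$, let $D\subset N$ be the union of all good intervals for $U$ of time at least $1$; each connected component of $D$ is a good interval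 of time at least $1$. The Markov map $M:D\to U$ defined by $U$ is $M|T=f^n|T$ on each connected component $T$ of $D$ of time $n$. $f$ has the Markov property if there exists such a nice neighborhood $U$ whose Markov map $M:D\to U$ satisfies $|N\setminus D|=0$. A closed set $A\subset N$ is an absorbing set of $f$ if $|\{x\in N:\omega(x)\subset A\}|>0$, where $\omega(x)$ is the $\omega$-limit set of $x$ under $f$. *)

theory Defs
  imports "HOL-Analysis.Analysis"
begin

(* Maps of N = {a..b} are functions on all of real; only their values on N matter,
   since every map considered satisfies f ` {a..b} \<subseteq> {a..b}. *)

(* An interval (open, closed or half-open) always has positive length. *)
definition proper_interval :: "real set \<Rightarrow> bool" where
  "proper_interval I \<longleftrightarrow> is_interval I \<and> (\<exists>x\<in>I. \<exists>y\<in>I. x < y)"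

(* The points p 0 = a < p 1 < ... < p d < p (d + 1) = b cut {a..b} into the d + 1 pieces of f;
   s i is the slope on the i-th piece. The case d = 0 (no critical point) is allowed. *)
definition affine_partition ::
    "(real \<Rightarrow> real) \<Rightarrow> real \<Rightarrow> real \<Rightarrow> nat \<Rightarrow> (nat \<Rightarrow> real) \<Rightarrow> bool" where
  "affine_partition f a b d p \<longleftrightarrow>
     p 0 = a \<and> p (Suc d) = b \<and> (\<forall>i\<le>d. p i < p (Suc i)) \<and>
     (\<exists>s t. (\<forall>i\<le>d. \<forall>x\<in>{p i..p (Suc i)}. f x = s i * x + t i) \<and>
            (\<forall>i<d. s i * s (Suc i) < 0))"

definition piecewise_affine :: "(real \<Rightarrow> real) \<Rightarrow> real \<Rightarrow> real \<Rightarrow> bool" where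
  "piecewise_affine f a b \<longleftrightarrow>
     continuous_on {a..b} f \<and> f ` {a..b} \<subseteq> {a..b} \<and> (\<exists>d p. affine_partition f a b d p)"

(* Consecutive slopes have opposite signs, so the partition points are determined by f. *)
definition critical_points :: "(real \<Rightarrow> real) \<Rightarrow> real \<Rightarrow> real \<Rightarrow> real set" where
  "critical_points f a b = {c. \<exists>d p. affine_partition f a b d p \<and> c \<in> p ` {1..d}}"

definition orb :: "(real \<Rightarrow> real) \<Rightarrow> real set \<Rightarrow> real set" where
  "orb f A = (\<Union>i. (f ^^ i) ` A)"

definition renormalization ::
    "(real \<Rightarrow> real) \<Rightarrow> real \<Rightarrow> real \<Rightarrow> real set \<Rightarrow> nat \<Rightarrow> bool" where
  "renormalization f a b I n \<longleftrightarrow>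
     proper_interval I \<and> I \<subseteq> {a..b} \<and> n \<ge> 1 \<and>
     (f ^^ n) ` I \<subseteq> I \<and> closure I \<noteq> {a..b} \<and>
     (\<forall>i<n. \<forall>j<n. i \<noteq> j \<longrightarrow> interior ((f ^^ i) ` I) \<inter> interior ((f ^^ j) ` I) = {})"

definition non_renormalizable :: "(real \<Rightarrow> real) \<Rightarrow> real \<Rightarrow> real \<Rightarrow> bool" where
  "non_renormalizable f a b \<longleftrightarrow> \<not> (\<exists>I n. renormalization f a b I n)"

definition nice_nbhd :: "(real \<Rightarrow> real) \<Rightarrow> real \<Rightarrow> real \<Rightarrow> real set \<Rightarrow> bool" where
  "nice_nbhd f a b U \<longleftrightarrow>
     open U \<and> critical_points f a b \<subseteq> U \<and> U \<subseteq> {a..b} \<and>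
     orb f (frontier U) \<inter> U = {} \<and>
     (\<forall>K\<in>components U. \<exists>!c. c \<in> K \<and> c \<in> critical_points f a b)"

(* connected_component_set U c is the component U_c of U. *)
definition good_interval_at ::
    "(real \<Rightarrow> real) \<Rightarrow> real \<Rightarrow> real \<Rightarrow> real set \<Rightarrow> real \<Rightarrow> nat \<Rightarrow> real set \<Rightarrow> bool" where
  "good_interval_at f a b U c n T \<longleftrightarrow>
     proper_interval T \<and> T \<subseteq> {a..b} \<and>
     (mono_on T (f ^^ n) \<or> antimono_on T (f ^^ n)) \<and>
     (f ^^ n) ` T = connected_component_set U c"

definition good_interval ::
    "(real \<Rightarrow> real) \<Rightarrow> real \<Rightarrow> real \<Rightarrow> real set \<Rightarrow> nat \<Rightarrow> real set \<Rightarrow> bool" where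
  "good_interval f a b U n T \<longleftrightarrow>
     (\<exists>c\<in>critical_points f a b. good_interval_at f a b U c n T)"

(* The smallness of the mesh required of the nice neighborhoods that define Markov maps. *)
definition fine_nice_nbhd :: "(real \<Rightarrow> real) \<Rightarrow> real \<Rightarrow> real \<Rightarrow> real set \<Rightarrow> bool" where
  "fine_nice_nbhd f a b U \<longleftrightarrow>
     nice_nbhd f a b U \<and>
     (\<forall>I. proper_interval I \<and> I \<subseteq> {a..b} \<longrightarrow>
        (\<forall>c\<in>critical_points f a b. \<exists>n T. n \<ge> 1 \<and> T \<subseteq> I \<and> good_interval_at f a b U c n T))"

definition markov_domain :: "(real \<Rightarrow> real) \<Rightarrow> real \<Rightarrow> real \<Rightarrow> real set \<Rightarrow> real set" where
  "markov_domain f a b U = \<Union>{T. \<exists>n\<ge>1. good_interval f a b U n T}"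

(* On a component T of D the map is f^n, where n is the time of T; this time is unique because
   no positive iterate of f is monotone on an open interval containing a critical point. *)
definition markov_map :: "(real \<Rightarrow> real) \<Rightarrow> real \<Rightarrow> real \<Rightarrow> real set \<Rightarrow> real \<rightharpoonup> real" where
  "markov_map f a b U x =
     (let D = markov_domain f a b U; T = connected_component_set D x in
      if x \<in> D then Some ((f ^^ (THE n. n \<ge> 1 \<and> good_interval f a b U n T)) x) else None)"

definition markov_property :: "(real \<Rightarrow> real) \<Rightarrow> real \<Rightarrow> real \<Rightarrow> bool" where
  "markov_property f a b \<longleftrightarrow>
     (\<exists>U. fine_nice_nbhd f a b U \<and> {a..b} - dom (markov_map f a b U) \<in> null_sets lebesgue)"

definition omega_limit :: "(real \<Rightarrow> real) \<Rightarrow> real \<Rightarrow> real set" where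
  "omega_limit f x = (\<Inter>n. closure ((\<lambda>m. (f ^^ m) x) ` {n..}))"

(* The set of points is Borel for closed A, so its emeasure is its Lebesgue measure. *)
definition absorbing_set :: "(real \<Rightarrow> real) \<Rightarrow> real \<Rightarrow> real \<Rightarrow> real set \<Rightarrow> bool" where
  "absorbing_set f a b A \<longleftrightarrow>
     closed A \<and> A \<subseteq> {a..b} \<and> emeasure lebesgue {x\<in>{a..b}. omega_limit f x \<subseteq> A} > 0"

(* Topological dimension exactly 0; the empty set has dimension -1. *)
definition zero_dimensional :: "real set \<Rightarrow> bool" where
  "zero_dimensional A \<longleftrightarrow> top_of_set A dim_le 0 \<and> \<not> top_of_set A dim_le (-1)"

end

theory Submission
  imports Defs
begin

text \<open>
  Branches of iterates of a piecewise affine map have no distortion: if \<open>f ^^ n\<close> maps an interval \<open>T\<close>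
  affinely onto a component of \<open>U\<close>, then proportions inside that component are proportions inside
  \<open>T\<close>. Both implications therefore reduce to porosity. A set with a gap of definite proportion near each of its
  points, at arbitrarily small scales, is null (\<open>porous_imp_negligible\<close>).

  Suppose that almost every point lies in the domain of the Markov map of \<open>U\<close>. Iterating the Markov map puts
  almost every point into good intervals of arbitrarily long time, and these are short. A zero-dimensional closed set
  \<open>A\<close> contains no interval, so some interval \<open>J\<close> inside a component of \<open>U\<close> has positive distance to
  \<open>A\<close>. Every component of \<open>U\<close> contains an interval that is mapped into \<open>J\<close>; pulled back to the short
  good intervals, it is a gap in the set of points whose orbits avoid \<open>J\<close>. This set is null, and a point whose limit
  set lies in \<open>A\<close> is mapped into it by some iterate.

  Conversely, suppose that there is no zero-dimensional absorbing set. A wandering interval would be attracted by a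
  closed set without interior, so there is none. Together with non-renormalizability this makes \<open>f\<close> exact: every
  interval eventually covers each compact interval inside \<open>N\<close> (\<open>exactness\<close>). Periodic points are then dense,
  and some periodic orbit \<open>P\<close> is not met by the critical orbits; the components around critical points of the complement of
  \<open>(f ^^ k) -` P\<close> are a nice neighborhood \<open>U\<close> of small mesh (\<open>exists_fine_nice_nbhd\<close>).

  Let \<open>B\<close> be a good interval of long time for this \<open>U\<close>. Almost every \<open>x\<close> enters \<open>B\<close>, since the
  points that do not form a closed invariant set without interior. Let \<open>S\<close> be the first time at which \<open>x\<close>
  enters, and let \<open>T\<close> reach from \<open>x\<close> to the nearest point where \<open>f ^^ S\<close> leaves \<open>B\<close>. No
  critical point lies in two of the images of \<open>T\<close> before time \<open>S\<close>: niceness of \<open>B\<close> would turn the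
  repetition into an earlier entry of \<open>x\<close> (\<open>first_entry_hits_bounded\<close>). Hence \<open>f ^^ S\<close> folds \<open>T\<close>
  boundedly often, and its slopes on \<open>T\<close> are comparable (\<open>bounded_folding\<close>). One end of \<open>T\<close> is
  mapped to the boundary of \<open>B\<close>, then to the boundary of \<open>U\<close>, and never returns to \<open>U\<close>. So the image
  of \<open>T\<close> in \<open>U\<close> is stretched affinely until it joins a critical point to a point outside \<open>U\<close>. At that moment it
  has definite length, and it contains good intervals of definite length; pulled back to \<open>T\<close>, one of them is a gap in the
  complement of the domain of the Markov map (\<open>porosity_at_recurrent_points\<close>).
\<close>

section \<open>Porous sets\<close>

text \<open>The Vitali covering theorem covers almost all of \<open>S\<close> by disjoint balls inside an open
  superset \<open>O'\<close> of almost the same measure. The gaps of these balls are disjoint and lie in \<open>O' - S\<close>, so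
  their total length is small, and it is comparable to the measure of the balls.\<close>

lemma porous_imp_negligible:
  fixes S :: "real set"
  assumes S: "S \<in> lmeasurable" and \<kappa>: "\<kappa> > 0"
    and por: "\<And>x e. x \<in> S \<Longrightarrow> e > 0 \<Longrightarrow>
      \<exists>r u v. 0 < r \<and> r < e \<and> u \<in> ball x r \<and> v \<in> ball x r \<and> v - u \<ge> \<kappa> * r \<and> {u<..<v} \<inter> S = {}"
  shows "negligible S"
proof -
  let ?\<mu> = "measure lebesgue"
  have small: "?\<mu> S \<le> 2 * \<epsilon> / \<kappa>" if \<epsilon>: "\<epsilon> > 0" for \<epsilon>
  proof -
    obtain O' where O': "open O'" "S \<subseteq> O'" "O' - S \<in> lmeasurable" "?\<mu> (O' - S) < \<epsilon>"
      using sets_lebesgue_outer_open[OF fmeasurableD[OF S] \<epsilon>] 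
      by (metis \<epsilon> emeasure_eq_measure2 ennreal_less_iff measure_nonneg)
    define K where "K = {(x,r). x \<in> S \<and> 0 < r \<and> ball x r \<subseteq> O' \<and>
        (\<exists>u v. u \<in> ball x r \<and> v \<in> ball x r \<and> v - u \<ge> \<kappa> * r \<and> {u<..<v} \<inter> S = {})}"
    obtain C where C: "countable C" "C \<subseteq> K"
      and pw: "pairwise (\<lambda>i j. disjnt (ball (fst i) (snd i)) (ball (fst j) (snd j))) C"
      and neg: "negligible (S - (\<Union>i\<in>C. ball (fst i) (snd i)))"
    proof (rule Vitali_covering_theorem_balls[of S K fst snd])
      fix x d :: real assume x: "x \<in> S" and d: "0 < d"
      obtain k where k: "k > 0" "ball x k \<subseteq> O'" using O' x by (meson open_contains_ball subsetD)
      obtain r u v where r: "0 < r" "r < min d k" "u \<in> ball x r" "v \<in> ball x r"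
          "v - u \<ge> \<kappa> * r" "{u<..<v} \<inter> S = {}"
        using por[OF x, of "min d k"] d k by auto
      have "ball x r \<subseteq> O'" using r k subset_ball[of r k x] by auto
      then have "(x,r) \<in> K" using r x unfolding K_def by blast
      then show "\<exists>i. i \<in> K \<and> x \<in> ball (fst i) (snd i) \<and> snd i < d"
        using r by (intro exI[of _ "(x,r)"]) auto
    qed
    have "\<forall>i\<in>C. \<exists>u v. u \<in> ball (fst i) (snd i) \<and> v \<in> ball (fst i) (snd i) \<and> v - u \<ge> \<kappa> * snd i
          \<and> {u<..<v} \<inter> S = {}"
      using C(2) unfolding K_def by fastforce
    then obtain u v where uv: "\<And>i. i \<in> C \<Longrightarrow> u i \<in> ball (fst i) (snd i) \<and> v i \<in> ball (fst i) (snd i)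
         \<and> v i - u i \<ge> \<kappa> * snd i \<and> {u i<..<v i} \<inter> S = {}"
      by metis
    have pos: "snd i > 0" if "i \<in> C" for i using that C(2) unfolding K_def by fastforce
    have sub: "ball (fst i) (snd i) \<subseteq> O'" if "i \<in> C" for i using that C(2) unfolding K_def by fastforce
    have gap: "{u i<..<v i} \<subseteq> ball (fst i) (snd i)" if "i \<in> C" for i
      using uv[OF that] by (auto simp: dist_real_def)
    have bound: "?\<mu> (\<Union>i\<in>I. ball (fst i) (snd i)) \<le> 2 * \<epsilon> / \<kappa>" if I: "I \<subseteq> C" "finite I" for I
    proof -
      have "?\<mu> (\<Union>i\<in>I. ball (fst i) (snd i)) \<le> (\<Sum>i\<in>I. ?\<mu> (ball (fst i) (snd i)))"
        by (rule measure_UNION_le) (use I in auto)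
      also have "\<dots> = (\<Sum>i\<in>I. 2 * snd i)"
        by (rule sum.cong) (use I pos in \<open>auto simp: ball_eq_greaterThanLessThan less_imp_le subsetD\<close>)
      also have "\<dots> \<le> (\<Sum>i\<in>I. 2 / \<kappa> * ?\<mu> {u i<..<v i})"
      proof (rule sum_mono)
        fix i assume "i \<in> I"
        then have i: "i \<in> C" using I by auto
        have "0 < \<kappa> * snd i" using \<kappa> pos[OF i] by simp
        then have "u i < v i" using uv[OF i] by linarith
        then have "?\<mu> {u i<..<v i} = v i - u i" by simp
        then show "2 * snd i \<le> 2 / \<kappa> * ?\<mu> {u i<..<v i}"
          using uv[OF i] \<kappa> by (simp add: field_simps)
      qed
      also have "\<dots> = 2 / \<kappa> * ?\<mu> (\<Union>i\<in>I. {u i<..<v i})"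
      proof -
        have "pairwise (\<lambda>i j. disjnt {u i<..<v i} {u j<..<v j}) I"
          using pw I gap unfolding pairwise_def by (meson disjnt_subset1 disjnt_subset2 subsetD)
        then have "?\<mu> (\<Union>i\<in>I. {u i<..<v i}) = (\<Sum>i\<in>I. ?\<mu> {u i<..<v i})"
          by (intro measure_UNION') (use I in auto)
        then show ?thesis by (simp add: sum_distrib_left)
      qed
      also have "\<dots> \<le> 2 / \<kappa> * ?\<mu> (O' - S)"
      proof (intro mult_left_mono measure_mono_fmeasurable)
        show "(\<Union>i\<in>I. {u i<..<v i}) \<subseteq> O' - S" using I uv gap sub by blast
        show "(\<Union>i\<in>I. {u i<..<v i}) \<in> sets lebesgue" using I by (intro sets.finite_UN) auto
      qed (use O' \<kappa> in auto)
      also have "\<dots> \<le> 2 * \<epsilon> / \<kappa>" using O'(4) \<kappa> by (simp add: field_simps)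
      finally show ?thesis .
    qed
    let ?W = "\<Union>i\<in>C. ball (fst i) (snd i)"
    have W: "?W \<in> lmeasurable" "?\<mu> ?W \<le> 2 * \<epsilon> / \<kappa>"
      using bound \<epsilon> \<kappa> by (auto intro!: fmeasurable_UN_bound[OF C(1)] measure_UN_bound[OF C(1)])
    have "?\<mu> S \<le> ?\<mu> (?W \<union> (S - ?W))"
      by (rule measure_mono_fmeasurable) (use S W neg in \<open>auto simp: negligible_imp_measurable fmeasurable.Un\<close>)
    also have "\<dots> \<le> ?\<mu> ?W + ?\<mu> (S - ?W)"
      by (rule measure_Un_le) (use W neg in \<open>auto simp: negligible_imp_measurable fmeasurableD\<close>)
    also have "?\<mu> (S - ?W) = 0" using neg by (simp add: negligible_imp_measure0)
    finally show ?thesis using W by simp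
  qed
  have "?\<mu> S \<le> 0"
  proof (rule field_le_epsilon)
    fix e :: real assume "e > 0"
    then have "?\<mu> S \<le> 2 * (e * \<kappa> / 2) / \<kappa>" using \<kappa> by (intro small) auto
    then show "?\<mu> S \<le> 0 + e" using \<kappa> by simp
  qed
  then have "?\<mu> S = 0" by (simp add: measure_le_0_iff)
  then show ?thesis using S by (simp add: negligible_iff_measure)
qed

section \<open>Subsets of the line of dimension zero\<close>

text \<open>A subspace of a zero-dimensional space has a basis of clopen sets, and an interval is connected.\<close>

lemma zero_dimensional_imp_no_interval:
  fixes A :: "real set"
  assumes "zero_dimensional A" "u < v"
  shows "\<not> {u..v} \<subseteq> A"
proof
  assume sub: "{u..v} \<subseteq> A"
  have "top_of_set A dim_le 0" using assms by (simp add: zero_dimensional_def)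
  from dimension_le_subtopology[OF this, of "{u..v}"] sub
  have "top_of_set {u..v} dim_le 0" by (simp add: subtopology_subtopology inf_absorb2)
  then have nb: "neighbourhood_base_of (\<lambda>U. closedin (top_of_set {u..v}) U \<and> openin (top_of_set {u..v}) U)
      (top_of_set {u..v})"
    by (simp add: dimension_le_0_neighbourhood_base_of_clopen)
  have "openin (top_of_set {u..v}) {u..<v}"
    by (auto simp: openin_open intro!: exI[of _ "{..<v}"])
  moreover have "u \<in> {u..<v}" using assms by simp
  ultimately obtain U V where UV: "openin (top_of_set {u..v}) U"
      "closedin (top_of_set {u..v}) V" "openin (top_of_set {u..v}) V" "u \<in> U" "U \<subseteq> V" "V \<subseteq> {u..<v}"
    using nb unfolding neighbourhood_base_of by (metis (no_types, lifting))
  have "V = {} \<or> V = {u..v}"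
    using UV connected_clopen[of "{u..v}"] by auto
  moreover have "v \<in> {u..v}" "v \<notin> {u..<v}" using assms by auto
  ultimately show False using UV by blast
qed

text \<open>Points outside \<open>A\<close> on both sides of \<open>x\<close>, arbitrarily close to it, cut out clopen neighborhoods.\<close>

lemma zero_dimensionalI:
  fixes A :: "real set"
  assumes "A \<noteq> {}" "\<And>u v. u < v \<Longrightarrow> \<not> {u<..<v} \<subseteq> A"
  shows "zero_dimensional A"
proof -
  have "neighbourhood_base_of (\<lambda>U. closedin (top_of_set A) U \<and> openin (top_of_set A) U) (top_of_set A)"
    unfolding neighbourhood_base_of
  proof (intro allI impI)
    fix W x assume "openin (top_of_set A) W \<and> x \<in> W"
    then obtain O' where O': "open O'" "W = A \<inter> O'" "x \<in> O'" "x \<in> A" by (auto simp: openin_open)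
    then obtain e where e: "e > 0" "ball x e \<subseteq> O'" by (meson open_contains_ball)
    obtain u where u: "x - e < u" "u < x" "u \<notin> A" using assms(2)[of "x - e" x] e by force
    obtain v where v: "x < v" "v < x + e" "v \<notin> A" using assms(2)[of x "x + e"] e by force
    have eq: "A \<inter> {u<..<v} = A \<inter> {u..v}" using u v by (auto simp: less_le)
    have 1: "openin (top_of_set A) (A \<inter> {u<..<v})" by (simp add: openin_open_Int)
    have 2: "closedin (top_of_set A) (A \<inter> {u<..<v})" unfolding eq by (simp add: closedin_closed_Int)
    have "{u<..<v} \<subseteq> ball x e" using u v by (auto simp: dist_real_def)
    then have "A \<inter> {u<..<v} \<subseteq> W" using O' e by auto
    then show "\<exists>U V. openin (top_of_set A) U \<and> (closedin (top_of_set A) V \<and> openin (top_of_set A) V)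
        \<and> x \<in> U \<and> U \<subseteq> V \<and> V \<subseteq> W"
      using 1 2 u v O' by (intro exI[of _ "A \<inter> {u<..<v}"]) auto
  qed
  then have "top_of_set A dim_le 0" by (simp add: dimension_le_0_neighbourhood_base_of_clopen)
  moreover have "\<not> top_of_set A dim_le (-1)"
    using assms(1) by (auto simp: subtopology_trivial_iff)
  ultimately show ?thesis by (simp add: zero_dimensional_def)
qed

section \<open>Limit sets\<close>

text \<open>By compactness, an orbit whose limit points all lie in \<open>A\<close> converges to \<open>A\<close>. The form with
  countable quantifiers is what makes the basin of \<open>A\<close> measurable.\<close>

lemma omega_limit_subset_iff:
  fixes a b :: real
  assumes orbit: "\<And>n. (f ^^ n) x \<in> {a..b}" and A: "closed A" "A \<noteq> {}"
  shows "omega_limit f x \<subseteq> A \<longleftrightarrow>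
    (\<forall>k::nat. \<exists>n. \<forall>m\<ge>n. infdist ((f ^^ m) x) A < 1 / Suc k)"
proof
  assume sub: "omega_limit f x \<subseteq> A"
  show "\<forall>k::nat. \<exists>n. \<forall>m\<ge>n. infdist ((f ^^ m) x) A < 1 / Suc k"
  proof (rule ccontr)
    assume "\<not> ?thesis"
    then obtain k :: nat where k: "\<forall>n. \<exists>m\<ge>n. infdist ((f ^^ m) x) A \<ge> 1 / Suc k"
      by (meson not_less)
    define F where "F n = closure ((\<lambda>m. (f ^^ m) x) ` {n..}) \<inter> {y. infdist y A \<ge> 1 / Suc k}" for n
    have cl: "closed {y. infdist y A \<ge> 1 / Suc k}"
      by (intro closed_Collect_le continuous_intros)
    have incl: "closure ((\<lambda>m. (f ^^ m) x) ` {n..}) \<subseteq> {a..b}" for n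
      using orbit by (intro closure_minimal) auto
    have "\<Inter> (range F) \<noteq> {}"
    proof (rule compact_nest)
      show "compact (F n)" for n
        unfolding F_def using incl[of n] cl
        by (meson bounded_closed_interval bounded_subset closed_Int closed_closure compact_Int_closed compact_eq_bounded_closed)
      show "F n \<noteq> {}" for n
      proof -
        obtain m where "m \<ge> n" "infdist ((f ^^ m) x) A \<ge> 1 / Suc k" using k by blast
        then have "(f ^^ m) x \<in> F n" unfolding F_def by (auto intro!: closure_subset[THEN subsetD])
        then show ?thesis by auto
      qed
      show "F n \<subseteq> F m" if "m \<le> n" for m n
        unfolding F_def using that by (intro Int_mono closure_mono) auto
    qed
    then obtain y where y: "\<And>n. y \<in> F n" by auto
    then have "y \<in> omega_limit f x" "infdist y A \<ge> 1 / Suc k" unfolding omega_limit_def F_def by auto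
    then show False using sub by (auto simp: subset_iff)
  qed
next
  assume R: "\<forall>k::nat. \<exists>n. \<forall>m\<ge>n. infdist ((f ^^ m) x) A < 1 / Suc k"
  show "omega_limit f x \<subseteq> A"
  proof
    fix y assume y: "y \<in> omega_limit f x"
    have "infdist y A \<le> 0"
    proof (rule ccontr)
      assume "\<not> infdist y A \<le> 0"
      then obtain k :: nat where k: "1 / Suc k < infdist y A"
        by (metis inverse_eq_divide not_le reals_Archimedean)
      obtain n where n: "\<And>m. m \<ge> n \<Longrightarrow> infdist ((f ^^ m) x) A < 1 / Suc k" using R by blast
      have "closed {y. infdist y A \<le> 1 / Suc k}" by (intro closed_Collect_le continuous_intros)
      moreover have "(\<lambda>m. (f ^^ m) x) ` {n..} \<subseteq> {y. infdist y A \<le> 1 / Suc k}"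
        using n by (auto intro: less_imp_le)
      ultimately have "closure ((\<lambda>m. (f ^^ m) x) ` {n..}) \<subseteq> {y. infdist y A \<le> 1 / Suc k}"
        by (rule closure_minimal[rotated])
      then show False using y k unfolding omega_limit_def by fastforce
    qed
    then have "infdist y A = 0" by (simp add: infdist_nonneg order_antisym)
    then show "y \<in> A" using A by (simp add: in_closed_iff_infdist_zero)
  qed
qed

lemma omega_limit_subset_forward_invariant:
  assumes "closed A" "\<And>y. y \<in> A \<Longrightarrow> f y \<in> A" "x \<in> A"
  shows "omega_limit f x \<subseteq> A"
proof -
  have "(f ^^ m) x \<in> A" for m by (induction m) (use assms in auto)
  then have "closure ((\<lambda>m. (f ^^ m) x) ` {0..}) \<subseteq> A" using assms by (intro closure_minimal) auto
  then show ?thesis unfolding omega_limit_def by blast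
qed

lemma sets_omega_limit_subset:
  fixes a b :: real
  assumes cont: "\<And>n. continuous_on {a..b} (f ^^ n)"
    and orbit: "\<And>n x. x \<in> {a..b} \<Longrightarrow> (f ^^ n) x \<in> {a..b}" and A: "closed A" "A \<noteq> {}"
  shows "{x\<in>{a..b}. omega_limit f x \<subseteq> A} \<in> sets lebesgue"
proof -
  have "{x\<in>{a..b}. omega_limit f x \<subseteq> A} =
     (\<Inter>k::nat. \<Union>n. \<Inter>m\<in>{n..}. {x\<in>{a..b}. infdist ((f ^^ m) x) A < 1 / Suc k})"
    (is "?L = ?R")
  proof (rule set_eqI)
    fix x
    show "x \<in> ?L \<longleftrightarrow> x \<in> ?R"
    proof (cases "x \<in> {a..b}")
      case True
      then show ?thesis using omega_limit_subset_iff[OF orbit[OF True] A]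
        by (simp only: mem_Collect_eq INT_iff UN_iff atLeast_iff Ball_def Bex_def UNIV_I simp_thms)
    next
      case False
      then show ?thesis by auto
    qed
  qed
  moreover have "{x\<in>{a..b}. infdist ((f ^^ m) x) A < e} \<in> sets borel" for m and e :: real
  proof -
    have "continuous_on {a..b} (\<lambda>x. infdist ((f ^^ m) x) A)"
      by (intro continuous_intros cont)
    then have "openin (top_of_set {a..b}) {x\<in>{a..b}. infdist ((f ^^ m) x) A < e}"
      using continuous_openin_preimage_gen[of "{a..b}" _ "{..<e}"] by (auto simp: vimage_def Int_def)
    then obtain O' where "open O'" "{x\<in>{a..b}. infdist ((f ^^ m) x) A < e} = {a..b} \<inter> O'"
      by (auto simp: openin_open)
    then show ?thesis by simp
  qed
  ultimately have "{x\<in>{a..b}. omega_limit f x \<subseteq> A} \<in> sets borel"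
    by (simp del: atLeast_iff)
  then show ?thesis by (metis sets_completionI_sets sets_lborel)
qed

section \<open>Intervals and affine maps\<close>

definition inj_affine_on :: "real set \<Rightarrow> (real \<Rightarrow> real) \<Rightarrow> bool" where
  "inj_affine_on J g \<longleftrightarrow> (\<exists>m c. m \<noteq> 0 \<and> (\<forall>x\<in>J. g x = m * x + c))"

lemma affine_eq_imp_slope_eq:
  fixes m :: real
  assumes "u < v" "\<And>x. x \<in> {u..v} \<Longrightarrow> m * x + c = m' * x + c'"
  shows "m = m'"
proof -
  have "m * u + c = m' * u + c'" "m * v + c = m' * v + c'" using assms by auto
  then have "(m - m') * (v - u) = 0" by (simp add: algebra_simps)
  then show ?thesis using assms by auto
qed

lemma inj_affine_on_subset: "inj_affine_on J g \<Longrightarrow> I \<subseteq> J \<Longrightarrow> inj_affine_on I g"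
  unfolding inj_affine_on_def by blast

lemma inj_affine_on_comp:
  assumes "inj_affine_on J g" "inj_affine_on (g ` J) h"
  shows "inj_affine_on J (h \<circ> g)"
proof -
  obtain m c m' c' where "m \<noteq> 0" "m' \<noteq> 0" "\<forall>x\<in>J. g x = m * x + c" "\<forall>y\<in>g ` J. h y = m' * y + c'"
    using assms unfolding inj_affine_on_def by metis
  then show ?thesis unfolding inj_affine_on_def
    by (intro exI[of _ "m' * m"] exI[of _ "m' * c + c'"]) (auto simp: algebra_simps)
qed

lemma inj_affine_on_monotone:
  assumes "inj_affine_on J g"
  shows "mono_on J g \<or> antimono_on J g"
proof -
  obtain m c where "m \<noteq> 0" "\<forall>x\<in>J. g x = m * x + c" using assms unfolding inj_affine_on_def by metis
  then show ?thesis
    by (cases "m > 0") (auto simp: monotone_on_def mult_left_mono mult_left_mono_neg)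
qed

lemma proper_intervalI: "is_interval I \<Longrightarrow> x \<in> I \<Longrightarrow> y \<in> I \<Longrightarrow> x < y \<Longrightarrow> proper_interval I"
  unfolding proper_interval_def by blast

lemma proper_interval_atLeastAtMost [simp]: "u < v \<Longrightarrow> proper_interval {u..v::real}"
  by (rule proper_intervalI[of _ u v]) (auto simp: is_interval_cc)

lemma proper_interval_greaterThanLessThan [simp]: "u < v \<Longrightarrow> proper_interval {u<..<v::real}"
proof -
  assume "u < v"
  then have "u < (2 * u + v)/3" "(2 * u + v)/3 < (u + 2 * v)/3" "(u + 2 * v)/3 < v" by (auto simp: field_simps)
  then show ?thesis
    by (intro proper_intervalI[of _ "(2 * u + v)/3" "(u + 2 * v)/3"]) (auto simp: is_interval_oo)
qed

lemma is_interval_contains_segment: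
  fixes I :: "real set"
  shows "is_interval I \<Longrightarrow> x \<in> I \<Longrightarrow> y \<in> I \<Longrightarrow> {x..y} \<subseteq> I"
  unfolding is_interval_1 by (meson atLeastAtMost_iff subsetI)

lemma proper_interval_contains_segment:
  assumes "proper_interval I"
  obtains u v where "u < v" "{u..v} \<subseteq> I"
  using assms is_interval_contains_segment unfolding proper_interval_def by metis

lemma finite_avoiding_subinterval:
  fixes C :: "real set"
  assumes "finite C" "x < y"
  obtains u v where "x < u" "u < v" "v < y" "{u..v} \<inter> C = {}"
proof -
  have "open ({x<..<y} - C)" using assms by (simp add: finite_imp_closed open_Diff)
  moreover have "infinite ({x<..<y} - C)" using assms by (simp add: Diff_infinite_finite infinite_Ioo)
  then obtain z where z: "z \<in> {x<..<y} - C" by (metis ex_in_conv finite.emptyI)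
  ultimately obtain e where e: "e > 0" "cball z e \<subseteq> {x<..<y} - C" by (meson open_contains_cball)
  have "{z..z+e} \<subseteq> cball z e" by (auto simp: dist_real_def)
  then have *: "{z..z+e} \<subseteq> {x<..<y} - C" using e by blast
  have "z + e \<in> {z..z+e}" using e by simp
  then have "z + e \<in> {x<..<y}" using * by blast
  then have "z + e < y" by simp
  then show ?thesis using * e z by (intro that[of z "z+e"]) auto
qed

lemma affine_image_segment:
  fixes m k :: real
  assumes "m \<noteq> 0" "x \<le> y"
  shows "(\<lambda>z. m * z + k) ` {x..y} = {min (m * x + k) (m * y + k)..max (m * x + k) (m * y + k)}"
  using assms image_affinity_atLeastAtMost[of m k x y] by (auto simp: mult_left_mono mult_left_mono_neg min_def max_def)

text \<open>Pulling a segment back through an affine branch scales its length by the inverse of the slope.\<close>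

lemma affine_segment_pullback:
  fixes g :: "real \<Rightarrow> real"
  assumes V: "is_interval V" and m: "m \<noteq> 0" and g: "\<And>x. x \<in> V \<Longrightarrow> g x = m * x + k"
    and yz: "y \<in> g ` V" "z \<in> g ` V" "y \<le> z"
  obtains y' z' where "y' \<in> V" "z' \<in> V" "y' \<le> z'" "\<bar>m\<bar> * (z' - y') = z - y" "g ` {y'..z'} = {y..z}"
proof -
  obtain y1 z1 where yz1: "y1 \<in> V" "z1 \<in> V" "g y1 = y" "g z1 = z" using yz by blast
  define y' where "y' = min y1 z1"
  define z' where "z' = max y1 z1"
  have eqs: "m * y1 + k = y" "m * z1 + k = z" using yz1 g by auto
  have V': "y' \<in> V" "z' \<in> V" "y' \<le> z'" using yz1 by (auto simp: y'_def z'_def min_def max_def)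
  have "g ` {y'..z'} = (\<lambda>x. m * x + k) ` {y'..z'}"
    using is_interval_contains_segment[OF V V'(1,2)] by (intro image_cong g) auto
  also have "\<dots> = {y..z}"
    using affine_image_segment[OF m V'(3), of k] eqs yz(3)
    by (auto simp: y'_def z'_def min_def max_def split: if_splits)
  finally have img: "g ` {y'..z'} = {y..z}" .
  have "z - y = m * (z1 - y1)" using eqs by (simp add: algebra_simps)
  then have "\<bar>m\<bar> * \<bar>z1 - y1\<bar> = z - y" using yz(3) by (simp add: abs_mult[symmetric])
  moreover have "z' - y' = \<bar>z1 - y1\<bar>" by (auto simp: y'_def z'_def)
  ultimately show ?thesis using that[OF V'] img by simp
qed

section \<open>Iterates of a piecewise affine map\<close>

locale piecewise_affine_map =
  fixes f :: "real \<Rightarrow> real" and a b :: real and d :: nat and p s t :: "nat \<Rightarrow> real"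
  assumes ab: "a < b" and d_pos: "0 < d"
    and cont: "continuous_on {a..b} f" and maps: "f ` {a..b} \<subseteq> {a..b}"
    and p_0: "p 0 = a" and p_Suc_d: "p (Suc d) = b"
    and p_step: "\<And>i. i \<le> d \<Longrightarrow> p i < p (Suc i)"
    and affine: "\<And>i x. i \<le> d \<Longrightarrow> x \<in> {p i..p (Suc i)} \<Longrightarrow> f x = s i * x + t i"
    and alternating: "\<And>i. i < d \<Longrightarrow> s i * s (Suc i) < 0"
begin

abbreviation "N \<equiv> {a..b}"
abbreviation "C \<equiv> critical_points f a b"
abbreviation "good \<equiv> good_interval_at f a b"

lemma p_strict: "i < j \<Longrightarrow> j \<le> Suc d \<Longrightarrow> p i < p j"
proof (induction j)
  case (Suc j)
  show ?case
  proof (cases "i = j")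
    case True then show ?thesis using Suc p_step by simp
  next
    case False
    then have "p i < p j" using Suc by simp
    also have "\<dots> < p (Suc j)" using Suc p_step by simp
    finally show ?thesis .
  qed
qed simp

lemma piece_exists:
  assumes "x \<in> N" obtains i where "i \<le> d" "x \<in> {p i..p (Suc i)}"
proof -
  define i where "i = (LEAST i. x \<le> p (Suc i))"
  have ex: "x \<le> p (Suc d)" using assms p_Suc_d by simp
  have 1: "x \<le> p (Suc i)" unfolding i_def using ex by (rule LeastI)
  have 2: "i \<le> d" unfolding i_def using ex by (rule Least_le)
  have 3: "p i \<le> x"
  proof (cases i)
    case 0 then show ?thesis using p_0 assms by simp
  next
    case (Suc j)
    then have "\<not> x \<le> p (Suc j)" using not_less_Least[of j "\<lambda>i. x \<le> p (Suc i)"] i_def by auto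
    then show ?thesis using Suc by simp
  qed
  show ?thesis using that 1 2 3 by simp
qed

lemma slope_nonzero: "i \<le> d \<Longrightarrow> s i \<noteq> 0"
  using alternating[of i] alternating[of "i - 1"] d_pos by (cases "i < d") auto

text \<open>A partition point of any other partition has slopes of opposite signs on its two sides, so it cannot lie inside
  a piece of the given one.\<close>

lemma critical_points_eq: "C = p ` {1..d}"
proof
  have "affine_partition f a b d p"
    unfolding affine_partition_def using p_0 p_Suc_d p_step affine alternating by blast
  then show "p ` {1..d} \<subseteq> C" unfolding critical_points_def by blast
  show "C \<subseteq> p ` {1..d}"
  proof
    fix c assume "c \<in> C"
    then obtain d' p' k where P: "affine_partition f a b d' p'" and k: "k \<in> {1..d'}" and c: "c = p' k"
      unfolding critical_points_def by auto
    from P obtain s' t' where 0: "p' 0 = a" "p' (Suc d') = b"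
      and st: "\<forall>i\<le>d'. p' i < p' (Suc i)"
      and aff: "\<And>i x. i \<le> d' \<Longrightarrow> x \<in> {p' i..p' (Suc i)} \<Longrightarrow> f x = s' i * x + t' i"
      and alt: "\<forall>i<d'. s' i * s' (Suc i) < 0"
      unfolding affine_partition_def by metis
    define l where "l = k - 1"
    have kl: "k = Suc l" "l < d'" using k l_def by auto
    have mono: "p' i \<le> p' j" if "i \<le> j" "j \<le> Suc d'" for i j
      using that
    proof (induction j)
      case (Suc j)
      show ?case
      proof (cases "i = Suc j")
        case False
        then have "p' i \<le> p' j" using Suc by simp
        then show ?thesis using st Suc by (metis Suc_le_mono less_imp_le order_trans)
      qed simp
    qed simp
    have lt: "p' l < c" "c < p' (Suc k)" using st kl c by auto
    have cN: "a < c" "c < b"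
      using lt mono[of 0 l] mono[of "Suc k" "Suc d'"] 0 kl by auto
    obtain i where i: "i \<le> d" "c \<in> {p i..p (Suc i)}" using piece_exists[of c] cN by auto
    show "c \<in> p ` {1..d}"
    proof (rule ccontr)
      assume nc: "c \<notin> p ` {1..d}"
      have "p i \<noteq> c"
      proof
        assume e: "p i = c"
        then have "0 < i" using cN p_0 by (cases i) auto
        then show False using nc i(1) e by auto
      qed
      moreover have "p (Suc i) \<noteq> c"
      proof
        assume e: "p (Suc i) = c"
        then have "Suc i \<noteq> Suc d" using cN p_Suc_d by auto
        then have "Suc i \<in> {1..d}" using i(1) by simp
        then show False using nc e by (metis image_eqI)
      qed
      ultimately have ii: "p i < c" "c < p (Suc i)" using i by auto
      have "s' l = s i"
      proof (rule affine_eq_imp_slope_eq[of "max (p i) (p' l)" c _ "t' l" _ "t i"])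
        show "max (p i) (p' l) < c" using ii lt by simp
        fix x assume "x \<in> {max (p i) (p' l)..c}"
        then have "f x = s' l * x + t' l" "f x = s i * x + t i"
          using aff[of l x] affine[OF i(1), of x] kl c ii by auto
        then show "s' l * x + t' l = s i * x + t i" by simp
      qed
      moreover have "s' k = s i"
      proof (rule affine_eq_imp_slope_eq[of c "min (p (Suc i)) (p' (Suc k))" _ "t' k" _ "t i"])
        show "c < min (p (Suc i)) (p' (Suc k))" using ii lt by simp
        fix x assume "x \<in> {c..min (p (Suc i)) (p' (Suc k))}"
        then have "f x = s' k * x + t' k" "f x = s i * x + t i"
          using aff[of k x] affine[OF i(1), of x] k c ii by auto
        then show "s' k * x + t' k = s i * x + t i" by simp
      qed
      ultimately have "s i * s i < 0" using alt kl by auto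
      then show False by (simp add: mult_less_0_iff)
    qed
  qed
qed

lemma finite_C: "finite C" and C_nonempty: "C \<noteq> {}"
  using d_pos by (auto simp: critical_points_eq)

lemma C_interior: "c \<in> C \<Longrightarrow> a < c \<and> c < b"
  using p_strict[of 0] p_strict[of _ "Suc d"] p_0 p_Suc_d by (auto simp: critical_points_eq)

lemma interval_off_C_in_piece:
  assumes J: "is_interval J" "J \<subseteq> N" "J \<inter> C = {}"
  obtains i where "i \<le> d" "J \<subseteq> {p i..p (Suc i)}"
proof (cases "J = {}")
  case True then show ?thesis using that[of 0] by simp
next
  case False
  then obtain x where x: "x \<in> J" by auto
  obtain i where i: "i \<le> d" "x \<in> {p i..p (Suc i)}" using piece_exists x J by blast
  have "y \<in> {p i..p (Suc i)}" if y: "y \<in> J" for y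
  proof -
    have yN: "a \<le> y" "y \<le> b" using y J by auto
    have "\<not> y < p i"
    proof
      assume lt: "y < p i"
      then have "p i \<in> J" using is_interval_contains_segment[OF J(1) y x] i by auto
      moreover have "0 < i" using lt yN p_0 by (cases i) auto
      then have "p i \<in> C" using i critical_points_eq by auto
      ultimately show False using J by auto
    qed
    moreover have "\<not> p (Suc i) < y"
    proof
      assume lt: "p (Suc i) < y"
      then have "p (Suc i) \<in> J" using is_interval_contains_segment[OF J(1) x y] i by auto
      moreover have "i \<noteq> d" using lt yN p_Suc_d by auto
      then have "p (Suc i) \<in> C" using i unfolding critical_points_eq by (intro imageI) auto
      ultimately show False using J by auto
    qed
    ultimately show ?thesis by auto
  qed
  then show ?thesis using that[OF i(1)] by blast
qed

lemma inj_affine_on_off_C: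
  assumes "is_interval J" "J \<subseteq> N" "J \<inter> C = {}"
  shows "inj_affine_on J f"
proof -
  obtain i where "i \<le> d" "J \<subseteq> {p i..p (Suc i)}" using interval_off_C_in_piece[OF assms] .
  then show ?thesis unfolding inj_affine_on_def
    using affine slope_nonzero by (intro exI[of _ "s i"] exI[of _ "t i"]) auto
qed

lemma iterate_maps: "(f ^^ n) ` N \<subseteq> N"
  by (induction n) (use maps in auto)

lemma iterate_in_N: "x \<in> N \<Longrightarrow> (f ^^ n) x \<in> N"
  using iterate_maps by blast

lemma continuous_iterate: "continuous_on N (f ^^ n)"
proof (induction n)
  case (Suc n)
  have "continuous_on N (f \<circ> (f ^^ n))"
    using Suc cont iterate_maps by (intro continuous_on_compose) (auto intro: continuous_on_subset)
  then show ?case by simp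
qed (simp add: continuous_on_id)

lemma iterate_image_subset: "J \<subseteq> N \<Longrightarrow> (f ^^ n) ` J \<subseteq> N"
  using iterate_maps by blast

lemma is_interval_iterate_image:
  assumes "is_interval J" "J \<subseteq> N" shows "is_interval ((f ^^ n) ` J)"
  using assms continuous_on_subset[OF continuous_iterate assms(2)]
  by (simp add: is_interval_connected_1 connected_continuous_image)

lemma inj_affine_on_iterate:
  assumes J: "is_interval J" "J \<subseteq> N" and off: "\<And>j. j < n \<Longrightarrow> (f ^^ j) ` J \<inter> C = {}"
  shows "inj_affine_on J (f ^^ n)"
  using off
proof (induction n)
  case 0
  show ?case unfolding inj_affine_on_def by (intro exI[of _ 1] exI[of _ 0]) auto
next
  case (Suc n)
  have "inj_affine_on ((f ^^ n) ` J) f"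
    using Suc.prems J by (intro inj_affine_on_off_C is_interval_iterate_image iterate_image_subset) auto
  then have "inj_affine_on J (f \<circ> (f ^^ n))" using Suc by (intro inj_affine_on_comp) auto
  then show ?case by (simp only: funpow.simps)
qed

lemma proper_interval_image:
  assumes "proper_interval J" "J \<subseteq> N" shows "proper_interval (f ` J)"
proof -
  have J: "is_interval J" using assms by (simp add: proper_interval_def)
  obtain x y where xy: "x < y" "{x..y} \<subseteq> J" using proper_interval_contains_segment assms by blast
  obtain u v where uv: "x < u" "u < v" "v < y" "{u..v} \<inter> C = {}"
    using finite_avoiding_subinterval[OF finite_C xy(1)] .
  have sub: "{u..v} \<subseteq> J" using uv xy by auto
  have "inj_affine_on {u..v} f" using uv subset_trans[OF sub assms(2)]
    by (intro inj_affine_on_off_C) (auto simp: is_interval_cc)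
  then obtain m c where m: "m \<noteq> 0" "f u = m * u + c" "f v = m * v + c"
    unfolding inj_affine_on_def using uv by (metis atLeastAtMost_iff less_imp_le order_refl)
  then have "f u \<noteq> f v" using uv by auto
  moreover have "f u \<in> f ` J" "f v \<in> f ` J"
    using subsetD[OF sub, of u] subsetD[OF sub, of v] uv by auto
  moreover have "is_interval (f ` J)" using is_interval_iterate_image[OF J assms(2), of 1] by simp
  ultimately show ?thesis unfolding proper_interval_def by (metis linorder_less_linear)
qed

lemma proper_interval_iterate_image:
  assumes "proper_interval J" "J \<subseteq> N" shows "proper_interval ((f ^^ n) ` J)"
proof (induction n)
  case 0 then show ?case using assms by simp
next
  case (Suc n)
  have "proper_interval (f ` ((f ^^ n) ` J))"
    using Suc assms by (intro proper_interval_image iterate_image_subset)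
  then show ?case by (simp add: image_comp)
qed

lemma iterate_nbhd_off_C:
  assumes x: "a < x" "x < b" and off: "\<And>j. j < n \<Longrightarrow> (f ^^ j) x \<notin> C"
  obtains h where "0 < h" "{x - h..x + h} \<subseteq> N" "\<And>j. j < n \<Longrightarrow> (f ^^ j) ` {x - h..x + h} \<inter> C = {}"
proof -
  have "\<exists>h>0. {x - h..x + h} \<subseteq> N \<and> (\<forall>j<n. (f ^^ j) ` {x - h..x + h} \<inter> C = {})"
    using off
  proof (induction n)
    case 0
    show ?case using x by (intro exI[of _ "min (x - a) (b - x)"]) auto
  next
    case (Suc n)
    then obtain h where h: "0 < h" "{x - h..x + h} \<subseteq> N" "\<forall>j<n. (f ^^ j) ` {x - h..x + h} \<inter> C = {}"
      by auto
    have xh: "x \<in> {x - h..x + h}" using h by simp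
    have "continuous_on {x - h..x + h} (f ^^ n)" using h continuous_on_subset continuous_iterate by blast
    moreover have "open (- C)" using finite_C by (simp add: finite_imp_closed open_Compl)
    ultimately obtain O' where O': "open O'" "{x - h..x + h} \<inter> (f ^^ n) -` (- C) = {x - h..x + h} \<inter> O'"
      using continuous_openin_preimage_gen[of "{x - h..x + h}" "f ^^ n" "- C"] by (auto simp: openin_open)
    then have "x \<in> O'" using Suc.prems xh by auto
    then obtain e where e: "e > 0" "\<And>y. y \<in> {x - h..x + h} \<Longrightarrow> dist y x < e \<Longrightarrow> (f ^^ n) y \<notin> C"
      using O' unfolding open_dist by blast
    define h' where "h' = min h (e/2)"
    have sub: "{x - h'..x + h'} \<subseteq> {x - h..x + h}" unfolding h'_def by auto
    have new: "(f ^^ n) y \<notin> C" if y: "y \<in> {x - h'..x + h'}" for y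
    proof -
      have "dist y x < e" using y e(1) unfolding h'_def dist_real_def by auto
      then show ?thesis using e(2) sub y by blast
    qed
    have off': "(f ^^ j) ` {x - h'..x + h'} \<inter> C = {}" if "j < Suc n" for j
    proof (cases "j = n")
      case True then show ?thesis using new by blast
    next
      case False
      then have "j < n" using that by simp
      then show ?thesis using h(3) sub by blast
    qed
    have "{x - h'..x + h'} \<subseteq> N" "h' > 0" using sub h e by (blast, simp add: h'_def)
    with off' show ?case by (intro exI[of _ h'] conjI allI impI)
  qed
  then show ?thesis using that by metis
qed

section \<open>Folding at critical points\<close>

text \<open>Both one-sided expansions at \<open>x\<close> in a single formula: \<open>\<sigma> = 1\<close> is the right side and
  \<open>\<sigma> = -1\<close> the left one, and \<open>m \<sigma>\<close> is the slope there.\<close>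

lemma one_sided_slopes:
  assumes x: "a < x" "x < b"
  obtains h m where "h > 0" "a < x - h" "x + h < b" "\<And>\<sigma>. m \<sigma> \<noteq> 0" "m 1 = m (-1) \<or> m 1 * m (-1) < 0"
    "x \<in> C \<Longrightarrow> m 1 * m (-1) < 0"
    "\<And>\<sigma> \<tau>. \<bar>\<sigma>\<bar> = 1 \<Longrightarrow> 0 \<le> \<tau> \<Longrightarrow> \<tau> \<le> h \<Longrightarrow> f (x + \<sigma> * \<tau>) = f x + m \<sigma> * (\<sigma> * \<tau>)"
proof -
  define M where "M m1 m2 = (\<lambda>\<sigma>::real. if \<sigma> = 1 then m2 else m1 :: real)" for m1 m2
  have *: "f (x + \<sigma> * \<tau>) = f x + M m1 m2 \<sigma> * (\<sigma> * \<tau>)"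
    if "f (x - \<tau>) = f x - m1 * \<tau>" "f (x + \<tau>) = f x + m2 * \<tau>" "\<bar>\<sigma>\<bar> = 1" for m1 m2 \<sigma> \<tau>
    using that by (cases "\<sigma> = 1") (auto simp: M_def abs_if split: if_splits)
  show ?thesis
  proof (cases "x \<in> C")
    case True
    then obtain l where l: "l \<in> {1..d}" "x = p l" unfolding critical_points_eq by blast
    then obtain i where i: "i < d" "x = p (Suc i)" by (cases l) (auto simp: Suc_le_eq)
    define h where "h = min (min (x - p i) (p (Suc (Suc i)) - x)) (min (x - a) (b - x)) / 2"
    have lt: "p i < x" "x < p (Suc (Suc i))" using i p_step[of i] p_step[of "Suc i"] by auto
    have h: "h > 0" "h < x - p i" "h < p (Suc (Suc i)) - x" "h < x - a" "h < b - x"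
      using lt x by (auto simp: h_def)
    show ?thesis
    proof (rule that[of h "M (s i) (s (Suc i))"])
      fix \<sigma> \<tau> :: real assume \<tau>: "\<bar>\<sigma>\<bar> = 1" "0 \<le> \<tau>" "\<tau> \<le> h"
      have "f (x - \<tau>) = f x - s i * \<tau>"
        using affine[of i "x - \<tau>"] affine[of i x] \<tau> h lt i by (simp add: algebra_simps)
      moreover have "f (x + \<tau>) = f x + s (Suc i) * \<tau>"
        using affine[of "Suc i" "x + \<tau>"] affine[of "Suc i" x] \<tau> h lt i by (simp add: algebra_simps)
      ultimately show "f (x + \<sigma> * \<tau>) = f x + M (s i) (s (Suc i)) \<sigma> * (\<sigma> * \<tau>)" using \<tau>(1) by (rule *)
    qed (use h alternating[OF i(1)] in \<open>auto simp: M_def mult.commute\<close>)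
  next
    case False
    then obtain h where h: "0 < h" "{x - h..x + h} \<subseteq> N" "\<And>j. j < Suc 0 \<Longrightarrow> (f ^^ j) ` {x - h..x + h} \<inter> C = {}"
      using iterate_nbhd_off_C[OF x, of "Suc 0"] by (metis funpow_0 less_Suc0)
    have "inj_affine_on {x - h..x + h} f" using h(2) h(3)[of 0] by (intro inj_affine_on_off_C) (auto simp: is_interval_cc)
    then obtain m c where m: "m \<noteq> 0" and mc: "\<And>y. y \<in> {x - h..x + h} \<Longrightarrow> f y = m * y + c"
      unfolding inj_affine_on_def by metis
    have hN: "a \<le> x - h" "x + h \<le> b" using h by auto
    show ?thesis
    proof (rule that[of "h/2" "M m m"])
      fix \<sigma> \<tau> :: real assume \<tau>: "\<bar>\<sigma>\<bar> = 1" "0 \<le> \<tau>" "\<tau> \<le> h/2"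
      have "f (x - \<tau>) = f x - m * \<tau>" "f (x + \<tau>) = f x + m * \<tau>"
        using mc[of "x - \<tau>"] mc[of "x + \<tau>"] mc[of x] \<tau> h(1) by (auto simp: algebra_simps)
      then show "f (x + \<sigma> * \<tau>) = f x + M m m \<sigma> * (\<sigma> * \<tau>)" using \<tau>(1) by (rule *)
    qed (use h(1) hN m False in \<open>auto simp: M_def\<close>)
  qed
qed

text \<open>An orbit that meets a critical point identifies the two sides of its starting point. This happens at the
  first meeting, before which the branch is affine, and later iterates cannot undo it.\<close>

lemma fold_at:
  assumes x: "a < x" "x < b" and j: "j < n" "(f ^^ j) x \<in> C"
  obtains \<alpha> \<beta> h where "\<alpha> > 0" "\<beta> > 0" "h > 0"
    "\<And>\<tau>. 0 \<le> \<tau> \<Longrightarrow> \<tau> \<le> h \<Longrightarrow> (f ^^ n) (x - \<alpha> * \<tau>) = (f ^^ n) (x + \<beta> * \<tau>)"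
proof -
  define k where "k = (LEAST j. (f ^^ j) x \<in> C)"
  have kC: "(f ^^ k) x \<in> C" unfolding k_def using j(2) by (rule LeastI)
  have kn: "k < n" using Least_le[of "\<lambda>j. (f ^^ j) x \<in> C" j] j k_def by auto
  have "\<And>j. j < k \<Longrightarrow> (f ^^ j) x \<notin> C" unfolding k_def by (rule not_less_Least)
  then obtain h where h: "0 < h" "{x - h..x + h} \<subseteq> N" "\<And>j. j < k \<Longrightarrow> (f ^^ j) ` {x - h..x + h} \<inter> C = {}"
    using iterate_nbhd_off_C[OF x] by metis
  have "inj_affine_on {x - h..x + h} (f ^^ k)" using h by (intro inj_affine_on_iterate) (auto simp: is_interval_cc)
  then obtain \<mu> c where \<mu>: "\<mu> \<noteq> 0" and \<mu>c: "\<And>y. y \<in> {x - h..x + h} \<Longrightarrow> (f ^^ k) y = \<mu> * y + c"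
    unfolding inj_affine_on_def by metis
  define y where "y = (f ^^ k) x"
  have yC: "y \<in> C" using kC by (simp add: y_def)
  have xk: "(f ^^ k) (x + \<tau>) = y + \<mu> * \<tau>" if "\<bar>\<tau>\<bar> \<le> h" for \<tau>
  proof -
    have "x + \<tau> \<in> {x - h..x + h}" "x \<in> {x - h..x + h}" using that h(1) by auto
    then have "(f ^^ k) (x + \<tau>) = \<mu> * (x + \<tau>) + c" "(f ^^ k) x = \<mu> * x + c" by (simp_all only: \<mu>c)
    then show ?thesis by (simp add: y_def algebra_simps)
  qed
  obtain g m where g: "g > 0" and m: "\<And>\<sigma>. m \<sigma> \<noteq> 0" "m 1 * m (-1) < 0"
    and f_side: "\<And>\<sigma> \<tau>. \<bar>\<sigma>\<bar> = 1 \<Longrightarrow> 0 \<le> \<tau> \<Longrightarrow> \<tau> \<le> g \<Longrightarrow> f (y + \<sigma> * \<tau>) = f y + m \<sigma> * (\<sigma> * \<tau>)"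
    using one_sided_slopes[of y] C_interior[OF yC] yC by metis
  define \<sigma> where "\<sigma> = sgn \<mu>"
  have \<sigma>: "\<sigma> = 1 \<or> \<sigma> = -1" "\<bar>\<sigma>\<bar> = 1" "\<bar>- \<sigma>\<bar> = 1" using \<mu> by (auto simp: \<sigma>_def sgn_if)
  have \<mu>\<sigma>: "\<mu> = \<sigma> * \<bar>\<mu>\<bar>" by (simp add: \<sigma>_def sgn_mult_abs)
  have opposite: "sgn (m (- \<sigma>)) = - sgn (m \<sigma>)" using \<sigma>(1) m(2) by (auto simp: sgn_if mult_less_0_iff)
  \<comment> \<open>The two sides are parametrised so that f^(k+1) moves with speed 1 on both.\<close>
  define \<alpha> where "\<alpha> = 1 / (\<bar>\<mu>\<bar> * \<bar>m (- \<sigma>)\<bar>)"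
  define \<beta> where "\<beta> = 1 / (\<bar>\<mu>\<bar> * \<bar>m \<sigma>\<bar>)"
  have \<alpha>\<beta>: "\<alpha> > 0" "\<beta> > 0" using \<mu> m(1) by (auto simp: \<alpha>_def \<beta>_def)
  define h' where "h' = min (min (h / \<alpha>) (h / \<beta>)) (min (g * \<bar>m \<sigma>\<bar>) (g * \<bar>m (- \<sigma>)\<bar>))"
  have h': "h' > 0" using h(1) g m(1) \<alpha>\<beta> by (simp add: h'_def)
  have main: "(f ^^ Suc k) (x - \<alpha> * \<tau>) = (f ^^ Suc k) (x + \<beta> * \<tau>)" if \<tau>: "0 \<le> \<tau>" "\<tau> \<le> h'" for \<tau>
  proof -
    have b: "\<alpha> * \<tau> \<le> h" "\<beta> * \<tau> \<le> h" "\<tau> / \<bar>m \<sigma>\<bar> \<le> g" "\<tau> / \<bar>m (- \<sigma>)\<bar> \<le> g"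
      using \<tau> \<alpha>\<beta> m(1)[of \<sigma>] m(1)[of "- \<sigma>"] by (auto simp: h'_def field_simps)
    have b0: "0 \<le> \<alpha> * \<tau>" "0 \<le> \<beta> * \<tau>" using \<tau>(1) \<alpha>\<beta> by auto
    have "\<mu> * (\<beta> * \<tau>) = \<sigma> * (\<tau> / \<bar>m \<sigma>\<bar>)" "\<mu> * (\<alpha> * \<tau>) = \<sigma> * (\<tau> / \<bar>m (- \<sigma>)\<bar>)"
      using \<mu> by (subst (1) \<mu>\<sigma>, simp add: \<alpha>_def \<beta>_def)+
    then have "(f ^^ k) (x + \<beta> * \<tau>) = y + \<sigma> * (\<tau> / \<bar>m \<sigma>\<bar>)" "(f ^^ k) (x - \<alpha> * \<tau>) = y + - \<sigma> * (\<tau> / \<bar>m (- \<sigma>)\<bar>)"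
      using xk[of "\<beta> * \<tau>"] xk[of "- (\<alpha> * \<tau>)"] b b0 by auto
    moreover have "f (y + \<upsilon> * (\<tau> / \<bar>m \<upsilon>\<bar>)) = f y + sgn (m \<upsilon>) * (\<upsilon> * \<tau>)"
      if "\<bar>\<upsilon>\<bar> = 1" "\<tau> / \<bar>m \<upsilon>\<bar> \<le> g" for \<upsilon>
      using f_side[OF that(1) _ that(2)] \<tau>(1) by (simp add: real_sgn_eq)
    then have "f (y + \<sigma> * (\<tau> / \<bar>m \<sigma>\<bar>)) = f y + sgn (m \<sigma>) * (\<sigma> * \<tau>)"
      "f (y + - \<sigma> * (\<tau> / \<bar>m (- \<sigma>)\<bar>)) = f y + sgn (m (- \<sigma>)) * (- \<sigma> * \<tau>)"
      using \<sigma>(2,3) b(3,4) by blast+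
    ultimately show ?thesis using opposite by simp
  qed
  have split_n: "(f ^^ n) z = (f ^^ (n - Suc k)) ((f ^^ Suc k) z)" for z
    using kn by (metis Suc_leI comp_apply funpow_add le_add_diff_inverse2)
  show ?thesis
  proof (rule that[OF \<alpha>\<beta> h'])
    fix \<tau> assume \<tau>: "0 \<le> \<tau>" "\<tau> \<le> h'"
    show "(f ^^ n) (x - \<alpha> * \<tau>) = (f ^^ n) (x + \<beta> * \<tau>)"
      unfolding split_n using main[OF \<tau>] by (simp only:)
  qed
qed

text \<open>Iterates are not constant on any interval, since no slope vanishes; so a monotone iterate has no fold in
  the interior.\<close>

lemma monotone_iterate_off_C:
  assumes uv: "{u<..<v} \<subseteq> N" and mono: "mono_on {u<..<v} (f ^^ n) \<or> antimono_on {u<..<v} (f ^^ n)"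
    and j: "j < n"
  shows "(f ^^ j) ` {u<..<v} \<inter> C = {}"
proof (rule ccontr)
  assume "\<not> ?thesis"
  then obtain x where x: "u < x" "x < v" "(f ^^ j) x \<in> C" by auto
  have "a \<le> (u + x)/2" "(x + v)/2 \<le> b"
    using subsetD[OF uv, of "(u + x)/2"] subsetD[OF uv, of "(x + v)/2"] x by auto
  then have xab: "a < x" "x < b" using x by auto
  obtain \<alpha> \<beta> h where A: "\<alpha> > 0" "\<beta> > 0" "h > 0"
    and eq: "\<And>\<tau>. 0 \<le> \<tau> \<Longrightarrow> \<tau> \<le> h \<Longrightarrow> (f ^^ n) (x - \<alpha> * \<tau>) = (f ^^ n) (x + \<beta> * \<tau>)"
    using fold_at[OF xab j x(3)] by metis
  define \<tau> where "\<tau> = min h (min ((x - u) / (2 * \<alpha>)) ((v - x) / (2 * \<beta>)))"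
  have \<tau>: "\<tau> > 0" "\<tau> \<le> h" "\<alpha> * \<tau> < x - u" "\<beta> * \<tau> < v - x"
  proof -
    show "\<tau> > 0" "\<tau> \<le> h" using A x by (auto simp: \<tau>_def)
    have "\<tau> \<le> (x - u) / (2 * \<alpha>)" "\<tau> \<le> (v - x) / (2 * \<beta>)" by (auto simp: \<tau>_def)
    then have "\<alpha> * \<tau> \<le> (x - u)/2" "\<beta> * \<tau> \<le> (v - x)/2" using A by (auto simp: field_simps)
    then show "\<alpha> * \<tau> < x - u" "\<beta> * \<tau> < v - x" using x by auto
  qed
  define y where "y = x - \<alpha> * \<tau>"
  define z where "z = x + \<beta> * \<tau>"
  have pos: "0 < \<alpha> * \<tau>" "0 < \<beta> * \<tau>" using A \<tau> by auto
  have yz: "u < y" "y < z" "z < v" using \<tau> pos by (auto simp: y_def z_def)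
  have eqyz: "(f ^^ n) y = (f ^^ n) z" using eq[of \<tau>] \<tau> by (simp add: y_def z_def)
  have const: "(f ^^ n) w = (f ^^ n) y" if "w \<in> {y..z}" for w
    using mono
  proof
    assume "mono_on {u<..<v} (f ^^ n)"
    then have "(f ^^ n) y \<le> (f ^^ n) w" "(f ^^ n) w \<le> (f ^^ n) z"
      using that yz by (auto simp: monotone_on_def)
    then show ?thesis using eqyz by simp
  next
    assume "antimono_on {u<..<v} (f ^^ n)"
    then have "(f ^^ n) y \<ge> (f ^^ n) w" "(f ^^ n) w \<ge> (f ^^ n) z"
      using that yz by (auto simp: monotone_on_def)
    then show ?thesis using eqyz by simp
  qed
  have "{y..z} \<subseteq> {u<..<v}" using yz by auto
  then have "{y..z} \<subseteq> N" using uv by blast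
  then have "proper_interval ((f ^^ n) ` {y..z})"
    using yz by (intro proper_interval_iterate_image) auto
  then obtain w w' where "w \<in> (f ^^ n) ` {y..z}" "w' \<in> (f ^^ n) ` {y..z}" "w < w'"
    unfolding proper_interval_def by blast
  moreover have "w = (f ^^ n) y" if "w \<in> (f ^^ n) ` {y..z}" for w using that const by blast
  ultimately show False by (metis less_irrefl)
qed

end

section \<open>Uniformity over long intervals\<close>

lemma proper_interval_endpoints:
  assumes T: "proper_interval T" "T \<subseteq> {a..b}"
  obtains u v where "u < v" "{u<..<v} \<subseteq> T" "T \<subseteq> {u..v}" "{u..v} \<subseteq> {a..b::real}"
proof -
  define u where "u = Inf T"
  define v where "v = Sup T"
  obtain x y where xy: "x \<in> T" "y \<in> T" "x < y" using T unfolding proper_interval_def by blast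
  have bd: "bdd_below T" "bdd_above T" using T(2) by (auto intro: bdd_below_mono bdd_above_mono)
  have sub: "T \<subseteq> {u..v}" unfolding u_def v_def using bd by (auto intro: cInf_lower cSup_upper)
  have op: "{u<..<v} \<subseteq> T"
  proof
    fix z assume z: "z \<in> {u<..<v}"
    obtain l where "l \<in> T" "l < z" using z cInf_lessD[of T z] xy unfolding u_def by auto
    moreover obtain r where "r \<in> T" "z < r" using z less_cSupD[of T z] xy unfolding v_def by auto
    ultimately show "z \<in> T" using T(1) unfolding proper_interval_def is_interval_1
      by (meson less_imp_le)
  qed
  have "a \<le> u" "v \<le> b" unfolding u_def v_def using xy T(2)
    by (auto intro!: cInf_greatest cSup_least)
  moreover have "u < v" using subsetD[OF sub xy(1)] subsetD[OF sub xy(2)] xy(3) by auto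
  ultimately show ?thesis using that[OF _ op sub] by auto
qed

lemma monotone_or_antimonotone_comp:
  fixes g h :: "real \<Rightarrow> real"
  assumes "mono_on T g \<or> antimono_on T g" "mono_on (g ` T) h \<or> antimono_on (g ` T) h"
  shows "mono_on T (\<lambda>x. h (g x)) \<or> antimono_on T (\<lambda>x. h (g x))"
  using assms by (elim disjE) (auto simp: monotone_on_def)

text \<open>Uniform statements about all intervals of length at least \<open>r\<close> reduce to the finitely many cells of a grid
  of mesh less than \<open>r / 2\<close>.\<close>

lemma finite_grid_of_intervals:
  fixes a b r :: real
  assumes "a < b" "r > 0"
  obtains K where "finite K" "\<And>u v. (u, v) \<in> K \<Longrightarrow> u < v \<and> {u..v} \<subseteq> {a..b}"
    "\<And>x y. a \<le> x \<Longrightarrow> y \<le> b \<Longrightarrow> r \<le> y - x \<Longrightarrow> \<exists>(u,v)\<in>K. {u..v} \<subseteq> {x<..<y}"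
proof -
  obtain n :: nat where n: "2 * (b - a) / r < n" using reals_Archimedean2 by blast
  have n0: "0 < real n" using n assms by (smt (verit) divide_pos_pos)
  define h where "h = (b - a) / n"
  have h: "h > 0" "2 * h < r" using n n0 assms by (auto simp: h_def field_simps)
  have nh: "real n * h = b - a" using n0 by (simp add: h_def)
  define K where "K = (\<lambda>i. (a + real i * h, a + (real i + 1) * h)) ` {..<n}"
  show ?thesis
  proof (rule that)
    show "finite K" by (simp add: K_def)
    fix u v assume "(u, v) \<in> K"
    then obtain i where i: "i < n" "u = a + real i * h" "v = a + (real i + 1) * h" by (auto simp: K_def)
    have "(real i + 1) * h \<le> real n * h" using i h by (intro mult_right_mono) auto
    moreover have "0 \<le> real i * h" using h by simp
    moreover have "u < v" using i h by (simp add: algebra_simps)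
    ultimately show "u < v \<and> {u..v} \<subseteq> {a..b}" using i nh by auto
  next
    fix x y assume xy: "a \<le> x" "y \<le> b" "r \<le> y - x"
    define i where "i = nat (\<lfloor>(x - a) / h\<rfloor> + 1)"
    have "0 \<le> (x - a) / h" using xy h by simp
    then have i: "real i = of_int \<lfloor>(x - a) / h\<rfloor> + 1" by (simp add: i_def)
    have "real i > (x - a) / h" "real i \<le> (x - a) / h + 1" using i by linarith+
    then have 1: "a + real i * h > x" "real i * h \<le> x - a + h" using h by (auto simp: field_simps)
    have 2: "a + (real i + 1) * h < y" using 1 h xy by (simp add: algebra_simps)
    then have "(real i + 1) * h < real n * h" using xy nh by simp
    then have "i < n" using h by simp
    then show "\<exists>(u,v)\<in>K. {u..v} \<subseteq> {x<..<y}"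
      using 1 2 unfolding K_def by (intro bexI[of _ "(a + real i * h, a + (real i + 1) * h)"]) auto
  qed
qed

lemma finite_uniform_real:
  fixes Q :: "'a \<Rightarrow> real \<Rightarrow> bool"
  assumes "finite S" "\<And>x. x \<in> S \<Longrightarrow> \<exists>e>0. Q x e" "\<And>x e e'. Q x e \<Longrightarrow> 0 < e' \<Longrightarrow> e' \<le> e \<Longrightarrow> Q x e'"
  shows "\<exists>e>0. \<forall>x\<in>S. Q x e"
  using assms(1,2)
proof (induction S)
  case empty
  show ?case by (intro exI[of _ 1]) auto
next
  case (insert x S)
  then obtain e1 e2 where "e1 > 0" "\<forall>x\<in>S. Q x e1" "e2 > 0" "Q x e2" by (metis insertCI)
  then show ?case using assms(3) by (intro exI[of _ "min e1 e2"]) (metis insertE min.cobounded1 min.cobounded2 min_less_iff_conj)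
qed

lemma finite_uniform_nat:
  fixes Q :: "'a \<Rightarrow> nat \<Rightarrow> bool"
  assumes "finite S" "\<And>x. x \<in> S \<Longrightarrow> \<exists>k. Q x k" "\<And>x k k'. Q x k \<Longrightarrow> k \<le> k' \<Longrightarrow> Q x k'"
  shows "\<exists>k. \<forall>x\<in>S. Q x k"
  using assms(1,2)
proof (induction S)
  case (insert x S)
  then obtain k1 k2 where "\<forall>x\<in>S. Q x k1" "Q x k2" by (metis insertCI)
  then show ?case using assms(3) by (intro exI[of _ "max k1 k2"]) (metis insertE max.cobounded1 max.cobounded2)
qed auto

lemma uniform_on_long_intervals:
  fixes Q :: "real \<Rightarrow> real \<Rightarrow> nat \<Rightarrow> bool"
  assumes ab: "a < b" and r: "r > 0"
    and ex: "\<And>u v. u < v \<Longrightarrow> {u..v} \<subseteq> {a..b} \<Longrightarrow> \<exists>k. Q u v k"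
    and mono: "\<And>u v x y k k'. Q u v k \<Longrightarrow> {u<..<v} \<subseteq> {x<..<y} \<Longrightarrow> k \<le> k' \<Longrightarrow> Q x y k'"
  obtains k where "\<And>x y. a \<le> x \<Longrightarrow> y \<le> b \<Longrightarrow> r \<le> y - x \<Longrightarrow> Q x y k"
proof -
  obtain K where K: "finite K" "\<And>u v. (u, v) \<in> K \<Longrightarrow> u < v \<and> {u..v} \<subseteq> {a..b}"
    and sub: "\<And>x y. a \<le> x \<Longrightarrow> y \<le> b \<Longrightarrow> r \<le> y - x \<Longrightarrow> \<exists>(u,v)\<in>K. {u..v} \<subseteq> {x<..<y}"
    using finite_grid_of_intervals[OF ab r] by metis
  have "\<exists>k. \<forall>p\<in>K. Q (fst p) (snd p) k"
  proof (rule finite_uniform_nat[OF K(1)])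
    show "\<exists>k. Q (fst p) (snd p) k" if "p \<in> K" for p
      using ex[of "fst p" "snd p"] K(2)[of "fst p" "snd p"] that by simp
  qed (rule mono[OF _ order_refl])
  then obtain k where k: "\<And>p. p \<in> K \<Longrightarrow> Q (fst p) (snd p) k" by blast
  have "Q x y k" if xy: "a \<le> x" "y \<le> b" "r \<le> y - x" for x y
  proof -
    obtain p where p: "p \<in> K" "{fst p..snd p} \<subseteq> {x<..<y}" using sub[OF xy] by auto
    then have "{fst p<..<snd p} \<subseteq> {x<..<y}" by (auto simp: subset_iff less_imp_le)
    then show ?thesis using mono[OF k[OF p(1)]] by simp
  qed
  then show ?thesis by (rule that)
qed

context piecewise_affine_map
begin

section \<open>Good intervals\<close>

lemma affine_iterate_extends_to_endpoints:
  assumes "u < v" "{u..v} \<subseteq> N" "\<And>x. x \<in> {u<..<v} \<Longrightarrow> (f ^^ n) x = m * x + k" "x \<in> {u..v}"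
  shows "(f ^^ n) x = m * x + k"
proof -
  have "continuous_on {u..v} (\<lambda>x. (f ^^ n) x - (m * x + k))"
    using continuous_on_subset[OF continuous_iterate assms(2)] by (intro continuous_intros) auto
  then have "closed {x \<in> {u..v}. (f ^^ n) x - (m * x + k) = 0}"
    by (intro continuous_closed_preimage_constant) auto
  moreover have "{u<..<v} \<subseteq> {x \<in> {u..v}. (f ^^ n) x - (m * x + k) = 0}" using assms(3) by auto
  ultimately have "closure {u<..<v} \<subseteq> {x \<in> {u..v}. (f ^^ n) x - (m * x + k) = 0}"
    by (rule closure_minimal[rotated])
  then show ?thesis using assms(1,4) by auto
qed

text \<open>A good interval carries an affine branch, and it is open because the component of \<open>U\<close> onto which it is
  mapped is open.\<close>

lemma good_interval_affine:
  assumes U: "open U" and good: "good U c n T"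
  obtains u v m k where "u < v" "T = {u<..<v}" "{u..v} \<subseteq> N" "m \<noteq> 0"
    "\<And>x. x \<in> {u..v} \<Longrightarrow> (f ^^ n) x = m * x + k"
proof -
  let ?W = "connected_component_set U c"
  have T: "proper_interval T" "T \<subseteq> N" and img: "(f ^^ n) ` T = ?W"
    and mono: "mono_on T (f ^^ n) \<or> antimono_on T (f ^^ n)"
    using good unfolding good_interval_at_def by auto
  obtain u v where uv: "u < v" "{u<..<v} \<subseteq> T" "T \<subseteq> {u..v}" "{u..v} \<subseteq> N"
    using proper_interval_endpoints[OF T] .
  have "mono_on {u<..<v} (f ^^ n) \<or> antimono_on {u<..<v} (f ^^ n)"
    using mono monotone_on_subset uv(2) by blast
  moreover have sub: "{u<..<v} \<subseteq> N" using uv T by blast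
  ultimately have "inj_affine_on {u<..<v} (f ^^ n)"
    by (intro inj_affine_on_iterate monotone_iterate_off_C) (auto simp: is_interval_oo)
  then obtain m k where m: "m \<noteq> 0" and mk: "\<And>x. x \<in> {u<..<v} \<Longrightarrow> (f ^^ n) x = m * x + k"
    unfolding inj_affine_on_def by metis
  have cl: "(f ^^ n) x = m * x + k" if "x \<in> {u..v}" for x
    by (rule affine_iterate_extends_to_endpoints[OF uv(1,4) mk that])
  have "T = (\<lambda>x. m * x + k) -` ?W"
  proof (intro set_eqI iffI)
    fix x assume "x \<in> T"
    then have "(f ^^ n) x \<in> ?W" "(f ^^ n) x = m * x + k" using img cl uv(3) by blast+
    then show "x \<in> (\<lambda>x. m * x + k) -` ?W" by simp
  next
    fix x assume "x \<in> (\<lambda>x. m * x + k) -` ?W"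
    then have "m * x + k \<in> (f ^^ n) ` T" using img by auto
    then obtain y where y: "y \<in> T" "m * x + k = (f ^^ n) y" by auto
    then have "m * x + k = m * y + k" using cl[of y] uv(3) by auto
    then show "x \<in> T" using m y by simp
  qed
  moreover have "open ((\<lambda>x. m * x + k) -` ?W)"
    using U by (intro open_vimage open_connected_component continuous_intros)
  ultimately have "open T" by simp
  then have "T \<subseteq> interior {u..v}" using uv(3) by (rule interior_maximal[rotated])
  then have "T = {u<..<v}" using uv(2) by (simp add: interior_atLeastAtMost_real order_antisym)
  then show ?thesis using that[OF uv(1) _ uv(4) m cl] by blast
qed

lemma good_interval_pullback:
  assumes V: "is_interval V" "V \<subseteq> N" and m: "m \<noteq> 0" and aff: "\<And>x. x \<in> V \<Longrightarrow> (f ^^ n) x = m * x + k"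
    and good: "good U c q G" and G: "G \<subseteq> (f ^^ n) ` V"
  shows "good U c (n + q) {x \<in> V. (f ^^ n) x \<in> G}" "(f ^^ n) ` {x \<in> V. (f ^^ n) x \<in> G} = G"
proof -
  let ?T = "{x \<in> V. (f ^^ n) x \<in> G}"
  show img: "(f ^^ n) ` ?T = G" using G by auto
  have iG: "is_interval G" and pG: "proper_interval G" and mono: "mono_on G (f ^^ q) \<or> antimono_on G (f ^^ q)"
    and imG: "(f ^^ q) ` G = connected_component_set U c"
    using good unfolding good_interval_at_def proper_interval_def by auto
  have comp: "(f ^^ (n + q)) x = (f ^^ q) ((f ^^ n) x)" for x
    using funpow_add[of q n f] by (simp add: add.commute)
  have "is_interval ?T"
    unfolding is_interval_1
  proof (intro ballI allI impI)
    fix x y z assume x: "x \<in> ?T" and y: "y \<in> ?T" and xz: "x \<le> z \<and> z \<le> y"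
    have zV: "z \<in> V" using V(1) x y xz unfolding is_interval_1 by blast
    have eqs: "(f ^^ n) x = m * x + k" "(f ^^ n) y = m * y + k" "(f ^^ n) z = m * z + k"
      using aff x y zV by auto
    have "(f ^^ n) z \<in> G"
    proof (cases "m > 0")
      case True
      then have "(f ^^ n) x \<le> (f ^^ n) z" "(f ^^ n) z \<le> (f ^^ n) y" using eqs xz by auto
      then show ?thesis using iG x y unfolding is_interval_1 by blast
    next
      case False
      then have "(f ^^ n) y \<le> (f ^^ n) z" "(f ^^ n) z \<le> (f ^^ n) x"
        using eqs xz m by (auto simp: mult_left_mono_neg)
      then show ?thesis using iG x y unfolding is_interval_1 by blast
    qed
    then show "z \<in> ?T" using zV by simp
  qed
  moreover obtain y y' where yy: "y \<in> G" "y' \<in> G" "y < y'" using pG unfolding proper_interval_def by blast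
  then obtain x x' where xx: "x \<in> ?T" "x' \<in> ?T" "(f ^^ n) x = y" "(f ^^ n) x' = y'"
    using equalityD2[OF img] by blast
  ultimately have properT: "proper_interval ?T"
    using proper_intervalI[of ?T x x'] proper_intervalI[of ?T x' x] yy(3)
    by (cases x x' rule: linorder_cases) auto
  have inner: "mono_on ?T (f ^^ n) \<or> antimono_on ?T (f ^^ n)"
    using m aff by (intro inj_affine_on_monotone) (auto simp: inj_affine_on_def)
  have "mono_on ?T (f ^^ (n + q)) \<or> antimono_on ?T (f ^^ (n + q))"
    using monotone_or_antimonotone_comp[OF inner, of "f ^^ q"] mono unfolding img comp .
  moreover have "(f ^^ (n + q)) ` ?T = connected_component_set U c"
  proof -
    have "(f ^^ (n + q)) ` ?T = (f ^^ q) ` ((f ^^ n) ` ?T)" using comp by (auto simp: image_image)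
    then show ?thesis by (simp only: img imG)
  qed
  ultimately show "good U c (n + q) ?T"
    using properT V(2) unfolding good_interval_at_def by auto
qed

section \<open>Transversal crossings\<close>

text \<open>Where \<open>f ^^ n\<close> passes from one side of \<open>w\<close> to the other it cannot fold, so the orbit of a crossing
  point does not meet the critical points before time \<open>n\<close>. The sign \<open>\<sigma>\<close> covers upward and downward
  crossings.\<close>

lemma crossing_avoids_C_aux:
  assumes x12: "x1 < x2" "{x1..x2} \<subseteq> N"
    and sgn: "\<sigma> * ((f ^^ n) x1 - w) < 0" "0 < \<sigma> * ((f ^^ n) x2 - w)"
  shows "\<exists>y. x1 < y \<and> y < x2 \<and> (f ^^ n) y = w \<and> (\<forall>j<n. (f ^^ j) y \<notin> C)"
proof -
  define g where "g x = \<sigma> * ((f ^^ n) x - w)" for x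
  have contg: "continuous_on {x1..x2} g"
    unfolding g_def using continuous_on_subset[OF continuous_iterate x12(2)] by (intro continuous_intros) auto
  define X where "X = {x \<in> {x1..x2}. g x < 0}"
  \<comment> \<open>the last point that is approached from the left by points below the level\<close>
  define y where "y = Sup X"
  have x1X: "x1 \<in> X" using x12 sgn by (simp add: X_def g_def)
  have bdd: "bdd_above X" unfolding X_def by (auto intro: bdd_aboveI[of _ x2])
  have yup: "x \<le> y" if "x \<in> X" for x unfolding y_def using that bdd by (rule cSup_upper)
  have yx2: "x1 \<le> y" "y \<le> x2" using yup[OF x1X] x1X unfolding y_def by (auto intro: cSup_least simp: X_def)
  have closedle: "closed {x \<in> {x1..x2}. g x \<le> 0}"
  proof -
    have "closed ({x1..x2} \<inter> g -` {..0})" using contg by (intro continuous_closed_preimage) auto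
    then show ?thesis by (simp add: vimage_def Int_def)
  qed
  have "y \<in> closure X" unfolding y_def using x1X bdd by (intro closure_contains_Sup) auto
  moreover have "closure X \<subseteq> {x \<in> {x1..x2}. g x \<le> 0}"
    using closedle by (intro closure_minimal) (auto simp: X_def)
  ultimately have gy: "g y \<le> 0" by auto
  then have y2: "y < x2" using yx2 sgn unfolding g_def by (cases "y = x2") auto
  have right: "g z \<ge> 0" if "z \<in> {y<..x2}" for z
  proof (rule ccontr)
    assume "\<not> g z \<ge> 0"
    then have "z \<in> X" using that yx2 by (auto simp: X_def)
    then show False using yup[of z] that by auto
  qed
  have "g y \<ge> 0"
  proof -
    have "closed ({y..x2} \<inter> g -` {0..})"
      using yx2 by (intro continuous_closed_preimage continuous_on_subset[OF contg]) auto
    moreover have "{y<..<x2} \<subseteq> {y..x2} \<inter> g -` {0..}" using right by auto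
    ultimately have "closure {y<..<x2} \<subseteq> {y..x2} \<inter> g -` {0..}" by (rule closure_minimal[rotated])
    then have "{y..x2} \<subseteq> {y..x2} \<inter> g -` {0..}" using y2 by simp
    moreover have "y \<in> {y..x2}" using y2 by simp
    ultimately show ?thesis by blast
  qed
  then have g0: "g y = 0" using gy by simp
  have "\<sigma> \<noteq> 0" using sgn by auto
  then have fy: "(f ^^ n) y = w" using g0 by (simp add: g_def)
  have y1: "x1 < y" using yx2 g0 sgn unfolding g_def by (cases "y = x1") auto
  have "(f ^^ j) y \<notin> C" if j: "j < n" for j
  proof
    assume jC: "(f ^^ j) y \<in> C"
    have "a < y" "y < b" using y1 y2 x12 by auto
    then obtain \<alpha> \<beta> h where A: "\<alpha> > 0" "\<beta> > 0" "h > 0"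
      and eq: "\<And>\<tau>. 0 \<le> \<tau> \<Longrightarrow> \<tau> \<le> h \<Longrightarrow> (f ^^ n) (y - \<alpha> * \<tau>) = (f ^^ n) (y + \<beta> * \<tau>)"
      using fold_at[OF _ _ j jC] by metis
    define \<delta> where "\<delta> = min (\<alpha> * h) (\<alpha> * ((x2 - y) / \<beta>))"
    have "\<delta> > 0" using A y2 by (simp add: \<delta>_def)
    then have "y - \<delta> < Sup X" unfolding y_def by simp
    then obtain x where x: "x \<in> X" "y - \<delta> < x" using less_cSupD[of X "y - \<delta>"] x1X by auto
    have xy: "x < y" using yup[OF x(1)] x(1) g0 by (cases "x = y") (auto simp: X_def)
    define \<tau> where "\<tau> = (y - x) / \<alpha>"
    have "\<alpha> * \<tau> < \<alpha> * h" "\<alpha> * \<tau> < \<alpha> * ((x2 - y) / \<beta>)" using x(2) A by (auto simp: \<tau>_def \<delta>_def)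
    then have \<tau>: "\<tau> \<le> h" "\<tau> < (x2 - y) / \<beta>" using A by (simp_all only: mult_less_cancel_left_pos less_imp_le)
    have \<tau>0: "\<tau> > 0" using xy A by (simp add: \<tau>_def)
    have "y + \<beta> * \<tau> \<in> {y<..x2}" using \<tau> \<tau>0 A by (auto simp: field_simps)
    then have "g (y + \<beta> * \<tau>) \<ge> 0" by (rule right)
    moreover have "y - \<alpha> * \<tau> = x" using A by (simp add: \<tau>_def)
    then have "g (y + \<beta> * \<tau>) = g x" using eq[of \<tau>] \<tau> \<tau>0 by (simp add: g_def)
    ultimately show False using x(1) by (simp add: X_def)
  qed
  then show ?thesis using y1 y2 fy by blast
qed

lemma crossing_avoids_C:
  assumes "x1 \<in> {u..v}" "x2 \<in> {u..v}" "{u..v} \<subseteq> N" "(f ^^ n) x1 < w" "w < (f ^^ n) x2"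
  shows "\<exists>y. u < y \<and> y < v \<and> (f ^^ n) y = w \<and> (\<forall>j<n. (f ^^ j) y \<notin> C)"
proof (cases "x1 < x2")
  case True
  then have "{x1..x2} \<subseteq> {u..v}" using assms by auto
  then have "{x1..x2} \<subseteq> N" using assms(3) by blast
  then show ?thesis using crossing_avoids_C_aux[OF True, of 1 n w] assms by force
next
  case False
  then have lt: "x2 < x1" using assms by (cases "x1 = x2") auto
  then have "{x2..x1} \<subseteq> {u..v}" using assms by auto
  then have "{x2..x1} \<subseteq> N" using assms(3) by blast
  then show ?thesis using crossing_avoids_C_aux[OF lt, of "-1" n w] assms by force
qed

section \<open>Bounded folding\<close>

definition "smax = Max ((\<lambda>i. \<bar>s i\<bar>) ` {..d})"
definition "smin = Min ((\<lambda>i. \<bar>s i\<bar>) ` {..d})"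

lemma slope_le_smax: "i \<le> d \<Longrightarrow> \<bar>s i\<bar> \<le> smax" and smin_le_slope: "i \<le> d \<Longrightarrow> smin \<le> \<bar>s i\<bar>"
  unfolding smax_def smin_def by auto

lemma smin_pos: "0 < smin"
  unfolding smin_def using slope_nonzero by (subst Min_gr_iff) auto

lemma smin_le_smax: "smin \<le> smax"
  using slope_le_smax[of 0] smin_le_slope[of 0] by simp

text \<open>The values \<open>clamp x y 0, \<dots>, clamp x y (Suc d)\<close> cut \<open>{x..y}\<close> along the pieces of \<open>f\<close>; pieces
  outside \<open>{x..y}\<close> contribute degenerate segments.\<close>

definition clamp :: "real \<Rightarrow> real \<Rightarrow> nat \<Rightarrow> real" where "clamp x y i = max x (min y (p i))"

lemma clamp_ends: "x \<le> y \<Longrightarrow> a \<le> x \<Longrightarrow> y \<le> b \<Longrightarrow> clamp x y 0 = x \<and> clamp x y (Suc d) = y"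
  by (auto simp: clamp_def p_0 p_Suc_d)

lemma clamp_step:
  assumes "x \<le> y" "i \<le> d"
  shows "clamp x y (Suc i) = clamp x y i \<or>
    (clamp x y i < clamp x y (Suc i) \<and> {clamp x y i..clamp x y (Suc i)} \<subseteq> {p i..p (Suc i)})"
  using assms p_step[OF assms(2)] by (auto simp: clamp_def min_def max_def)

lemma clamp_in: "x \<le> y \<Longrightarrow> clamp x y i \<in> {x..y}"
  by (auto simp: clamp_def)

lemma clamp_telescope:
  assumes "x \<le> y" "a \<le> x" "y \<le> b"
  shows "(\<Sum>i<Suc d. h (clamp x y (Suc i)) - h (clamp x y i)) = h y - (h x :: real)"
  using sum_lessThan_telescope[of "\<lambda>i. h (clamp x y i)" "Suc d"] clamp_ends[OF assms] by simp

lemma f_lipschitz: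
  assumes "x \<in> N" "y \<in> N" shows "\<bar>f x - f y\<bar> \<le> smax * \<bar>x - y\<bar>"
proof -
  have main: "\<bar>f y - f x\<bar> \<le> smax * (y - x)" if xy: "x \<le> y" "a \<le> x" "y \<le> b" for x y
  proof -
    have step: "\<bar>f (clamp x y (Suc i)) - f (clamp x y i)\<bar> \<le> smax * (clamp x y (Suc i) - clamp x y i)"
      if "i < Suc d" for i
    proof -
      have i: "i \<le> d" using that by simp
      show ?thesis
      proof (cases "clamp x y (Suc i) = clamp x y i")
        case True
        then show ?thesis by simp
      next
        case False
        then have lt: "clamp x y i < clamp x y (Suc i)"
          and sub: "{clamp x y i..clamp x y (Suc i)} \<subseteq> {p i..p (Suc i)}"
          using clamp_step[OF xy(1) i] by auto
        have "f (clamp x y (Suc i)) - f (clamp x y i) = s i * (clamp x y (Suc i) - clamp x y i)"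
          using affine[OF i, of "clamp x y (Suc i)"] affine[OF i, of "clamp x y i"] sub lt
          by (auto simp: algebra_simps)
        then show ?thesis using slope_le_smax[OF i] lt by (simp add: abs_mult mult_right_mono)
      qed
    qed
    have "\<bar>f y - f x\<bar> = \<bar>\<Sum>i<Suc d. f (clamp x y (Suc i)) - f (clamp x y i)\<bar>"
      by (simp only: clamp_telescope[OF xy])
    also have "\<dots> \<le> (\<Sum>i<Suc d. \<bar>f (clamp x y (Suc i)) - f (clamp x y i)\<bar>)" by (rule sum_abs)
    also have "\<dots> \<le> (\<Sum>i<Suc d. smax * (clamp x y (Suc i) - clamp x y i))"
      by (intro sum_mono step) auto
    also have "\<dots> = smax * (y - x)"
      using clamp_telescope[OF xy, of "\<lambda>x. x"] by (simp only: sum_distrib_left[symmetric])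
    finally show ?thesis .
  qed
  show ?thesis using main[of x y] main[of y x] assms by (cases "x \<le> y") (auto simp: abs_minus_commute)
qed

lemma long_subinterval_in_piece:
  assumes xy: "x < y" "a \<le> x" "y \<le> b"
  obtains i x' y' where "i \<le> d" "x \<le> x'" "x' < y'" "y' \<le> y" "{x'..y'} \<subseteq> {p i..p (Suc i)}"
    "(y - x) / real (Suc d) \<le> y' - x'"
proof -
  have "\<exists>i<Suc d. (y - x) / real (Suc d) \<le> clamp x y (Suc i) - clamp x y i"
  proof (rule ccontr)
    assume "\<not> ?thesis"
    then have "(\<Sum>i<Suc d. clamp x y (Suc i) - clamp x y i) < (\<Sum>i<Suc d. (y - x) / real (Suc d))"
      by (intro sum_strict_mono) (auto simp: not_le)
    then show False using clamp_telescope[of x y "\<lambda>x. x"] xy by simp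
  qed
  then obtain i where i: "i \<le> d" "(y - x) / real (Suc d) \<le> clamp x y (Suc i) - clamp x y i"
    by (auto simp: less_Suc_eq_le)
  have "0 < (y - x) / real (Suc d)" using xy by simp
  then have "clamp x y (Suc i) \<noteq> clamp x y i" using i by auto
  then have "clamp x y i < clamp x y (Suc i)" "{clamp x y i..clamp x y (Suc i)} \<subseteq> {p i..p (Suc i)}"
    using clamp_step[of x y i] xy i by auto
  then show ?thesis using that[OF i(1) _ _ _ _ i(2)] clamp_in[of x y i] clamp_in[of x y "Suc i"] xy by auto
qed

definition hits :: "real \<Rightarrow> real \<Rightarrow> nat \<Rightarrow> nat" where
  "hits u v n = card {j. j < n \<and> (f ^^ j) ` {u<..<v} \<inter> C \<noteq> {}}"

lemma hits_Suc:
  "hits u v (Suc n) = (if (f ^^ n) ` {u<..<v} \<inter> C = {} then hits u v n else Suc (hits u v n))"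
proof -
  have "{j. j < Suc n \<and> (f ^^ j) ` {u<..<v} \<inter> C \<noteq> {}} =
    (if (f ^^ n) ` {u<..<v} \<inter> C = {} then {j. j < n \<and> (f ^^ j) ` {u<..<v} \<inter> C \<noteq> {}}
     else insert n {j. j < n \<and> (f ^^ j) ` {u<..<v} \<inter> C \<noteq> {}})"
    by (auto simp: less_Suc_eq)
  then show ?thesis unfolding hits_def by auto
qed

text \<open>At a time when the image of \<open>{u<..<v}\<close> misses \<open>C\<close> all slopes are multiplied by the same factor. At the other
  times, which \<open>hits\<close> counts, slopes are multiplied by factors with absolute values between \<open>smin\<close> and \<open>smax\<close>, and
  the chosen affine branch has to be cut into at most \<open>Suc d\<close> parts, the longest of which is kept. So both losses depend only on the number of hits.\<close>

lemma bounded_folding: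
  assumes uv: "u < v" "{u..v} \<subseteq> N"
  shows "\<exists>u' v' m k. u \<le> u' \<and> u' < v' \<and> v' \<le> v \<and> (v - u) / real (Suc d) ^ hits u v n \<le> v' - u' \<and> m \<noteq> 0 \<and>
    (\<forall>x\<in>{u'..v'}. (f ^^ n) x = m * x + k) \<and>
    (\<forall>x\<in>{u..v}. \<forall>y\<in>{u..v}. \<bar>(f ^^ n) x - (f ^^ n) y\<bar> \<le> \<bar>m\<bar> * (smax / smin) ^ hits u v n * \<bar>x - y\<bar>)"
proof (induction n)
  case 0
  show ?case using uv
    by (intro exI[of _ u] exI[of _ v] exI[of _ 1] exI[of _ 0]) (auto simp: hits_def)
next
  case (Suc n)
  let ?R = "smax / smin" and ?h = "hits u v n"
  obtain u' v' m k where IH: "u \<le> u'" "u' < v'" "v' \<le> v" "(v - u) / real (Suc d) ^ ?h \<le> v' - u'" "m \<noteq> 0"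
    and aff: "\<And>x. x \<in> {u'..v'} \<Longrightarrow> (f ^^ n) x = m * x + k"
    and lip: "\<And>x y. x \<in> {u..v} \<Longrightarrow> y \<in> {u..v} \<Longrightarrow> \<bar>(f ^^ n) x - (f ^^ n) y\<bar> \<le> \<bar>m\<bar> * ?R ^ ?h * \<bar>x - y\<bar>"
    using Suc.IH by metis
  have sub': "{u'..v'} \<subseteq> {u..v}" using IH by auto
  have Rpos: "0 < ?R" using smin_pos smin_le_smax by simp
  show ?case
  proof (cases "(f ^^ n) ` {u<..<v} \<inter> C = {}")
    case True
    have sub: "{u<..<v} \<subseteq> N" using uv(2) greaterThanLessThan_subseteq_atLeastAtMost_iff by (auto simp: subset_iff)
    obtain i where i: "i \<le> d" "(f ^^ n) ` {u<..<v} \<subseteq> {p i..p (Suc i)}"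
      using interval_off_C_in_piece[OF is_interval_iterate_image[OF is_interval_oo sub] iterate_image_subset[OF sub] True] .
    have "(f ^^ n) ` closure {u<..<v} \<subseteq> {p i..p (Suc i)}"
      using uv i(2) by (intro image_closure_subset continuous_on_subset[OF continuous_iterate]) auto
    then have in_piece: "(f ^^ n) x \<in> {p i..p (Suc i)}" if "x \<in> {u..v}" for x
      using that uv(1) by (metis closure_greaterThanLessThan image_subset_iff)
    have fx: "(f ^^ Suc n) x = s i * (f ^^ n) x + t i" if "x \<in> {u..v}" for x
      using affine[OF i(1) in_piece[OF that]] by simp
    have affF: "(f ^^ Suc n) x = (s i * m) * x + (s i * k + t i)" if "x \<in> {u'..v'}" for x
      using fx[of x] aff[OF that] that sub' by (auto simp: algebra_simps)
    have lipF: "\<bar>(f ^^ Suc n) x - (f ^^ Suc n) y\<bar> \<le> \<bar>s i * m\<bar> * ?R ^ ?h * \<bar>x - y\<bar>"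
      if "x \<in> {u..v}" "y \<in> {u..v}" for x y
    proof -
      have "\<bar>(f ^^ Suc n) x - (f ^^ Suc n) y\<bar> = \<bar>s i\<bar> * \<bar>(f ^^ n) x - (f ^^ n) y\<bar>"
        unfolding fx[OF that(1)] fx[OF that(2)] by (simp add: abs_mult[symmetric] algebra_simps)
      also have "\<dots> \<le> \<bar>s i\<bar> * (\<bar>m\<bar> * ?R ^ ?h * \<bar>x - y\<bar>)" by (intro mult_left_mono lip that) auto
      finally show ?thesis by (simp add: abs_mult mult.assoc)
    qed
    have nzF: "s i * m \<noteq> 0" using slope_nonzero[OF i(1)] IH by simp
    have hS: "hits u v (Suc n) = ?h" using True by (simp add: hits_Suc)
    show ?thesis unfolding hS
      by (intro exI[of _ u'] exI[of _ v'] exI[of _ "s i * m"] exI[of _ "s i * k + t i"] conjI ballI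
          IH(1-4) nzF affF lipF)
  next
    case False
    let ?y = "min (m * u' + k) (m * v' + k)" and ?z = "max (m * u' + k) (m * v' + k)"
    have img: "(f ^^ n) ` {u'..v'} = {?y..?z}"
    proof -
      have "(f ^^ n) ` {u'..v'} = (\<lambda>z. m * z + k) ` {u'..v'}" by (intro image_cong aff) auto
      then show ?thesis using affine_image_segment[of m u' v' k] IH by simp
    qed
    have len: "?z - ?y = \<bar>m\<bar> * (v' - u')"
    proof -
      have "?z - ?y = \<bar>m * (v' - u')\<bar>" by (simp add: algebra_simps)
      then show ?thesis using IH by (simp add: abs_mult)
    qed
    have "0 < \<bar>m\<bar> * (v' - u')" using IH by simp
    then have yz: "?y < ?z" using len by linarith
    have "{?y..?z} \<subseteq> N" unfolding img[symmetric] using sub' uv(2) by (intro iterate_image_subset) blast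
    then have yzN: "a \<le> ?y" "?z \<le> b" using yz by auto
    obtain i y' z' where i: "i \<le> d" "?y \<le> y'" "y' < z'" "z' \<le> ?z" "{y'..z'} \<subseteq> {p i..p (Suc i)}"
        "(?z - ?y) / real (Suc d) \<le> z' - y'"
      using long_subinterval_in_piece[OF yz yzN] .
    have "y' \<in> (f ^^ n) ` {u'..v'}" "z' \<in> (f ^^ n) ` {u'..v'}" "y' \<le> z'" using i yz unfolding img by auto
    then obtain u'' v'' where uv''0: "u'' \<in> {u'..v'}" "v'' \<in> {u'..v'}" "u'' \<le> v''"
      and len'': "\<bar>m\<bar> * (v'' - u'') = z' - y'" and img'': "(f ^^ n) ` {u''..v''} = {y'..z'}"
      using affine_segment_pullback[OF is_interval_cc IH(5) aff] by metis
    have uv'': "u' \<le> u''" "u'' < v''" "v'' \<le> v'" using uv''0 len'' i(3) by (auto simp: less_le)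
    have long: "(v - u) / real (Suc d) ^ Suc ?h \<le> v'' - u''"
    proof -
      have "\<bar>m\<bar> * ((v' - u') / real (Suc d)) \<le> \<bar>m\<bar> * (v'' - u'')" using i(6) len len'' by simp
      then have "(v' - u') / real (Suc d) \<le> v'' - u''"
        using IH(5) mult_le_cancel_left_pos[of "\<bar>m\<bar>"] by (metis zero_less_abs_iff)
      moreover have "(v - u) / real (Suc d) ^ ?h / real (Suc d) \<le> (v' - u') / real (Suc d)"
        using IH(4) by (intro divide_right_mono) auto
      moreover have "(v - u) / real (Suc d) ^ Suc ?h = (v - u) / real (Suc d) ^ ?h / real (Suc d)"
        by (simp only: power_Suc2 divide_divide_eq_left)
      ultimately show ?thesis by linarith
    qed
    have piece: "(f ^^ n) x \<in> {p i..p (Suc i)}" if "x \<in> {u''..v''}" for x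
      using img'' i(5) that by blast
    have affF: "(f ^^ Suc n) x = (s i * m) * x + (s i * k + t i)" if "x \<in> {u''..v''}" for x
    proof -
      have "x \<in> {u'..v'}" using that uv'' by auto
      then show ?thesis using affine[OF i(1) piece[OF that]] aff by (simp add: algebra_simps)
    qed
    have lipF: "\<bar>(f ^^ Suc n) x - (f ^^ Suc n) y\<bar> \<le> \<bar>s i * m\<bar> * ?R ^ Suc ?h * \<bar>x - y\<bar>"
      if xy: "x \<in> {u..v}" "y \<in> {u..v}" for x y
    proof -
      have "(f ^^ n) x \<in> N" "(f ^^ n) y \<in> N" using xy uv(2) iterate_in_N by (blast, blast)
      then have "\<bar>(f ^^ Suc n) x - (f ^^ Suc n) y\<bar> \<le> smax * \<bar>(f ^^ n) x - (f ^^ n) y\<bar>"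
        using f_lipschitz by simp
      also have "\<dots> \<le> smax * (\<bar>m\<bar> * ?R ^ ?h * \<bar>x - y\<bar>)"
        using smin_pos smin_le_smax by (intro mult_left_mono lip xy) auto
      also have "\<dots> = (smin * ?R) * (\<bar>m\<bar> * ?R ^ ?h * \<bar>x - y\<bar>)" using smin_pos by simp
      also have "\<dots> \<le> (\<bar>s i\<bar> * ?R) * (\<bar>m\<bar> * ?R ^ ?h * \<bar>x - y\<bar>)"
        using smin_le_slope[OF i(1)] Rpos by (intro mult_right_mono) auto
      finally show ?thesis by (simp add: abs_mult algebra_simps)
    qed
    have nzF: "s i * m \<noteq> 0" using slope_nonzero[OF i(1)] IH by simp
    have hS: "hits u v (Suc n) = Suc ?h" using False by (simp add: hits_Suc)
    have ends: "u \<le> u''" "v'' \<le> v" using uv'' IH(1,3) by auto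
    show ?thesis unfolding hS
      by (intro exI[of _ u''] exI[of _ v''] exI[of _ "s i * m"] exI[of _ "s i * k + t i"] conjI ballI
          ends uv''(2) long nzF affF lipF)
  qed
qed

end

section \<open>Non-renormalizable maps and their fixed points\<close>

lemma interval_dense_imp_contains_interior:
  fixes I :: "real set"
  assumes "is_interval I" "closure I = {a..b}"
  shows "{a<..<b} \<subseteq> I"
proof -
  have "interior (closure I) = interior I"
    using assms(1) by (intro convex_interior_closure) (simp add: is_interval_convex_1)
  then have "{a<..<b} = interior I" using assms(2) by (simp add: interior_atLeastAtMost_real)
  then show ?thesis using interior_subset by blast
qed

lemma is_interval_UN_common_point:
  fixes A :: "nat \<Rightarrow> real set"
  assumes "\<And>n. is_interval (A n)" "\<And>n. x \<in> A n"
  shows "is_interval (\<Union>n. A n)"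
  using assms unfolding is_interval_connected_1 by (intro connected_Union) blast+

locale nonrenormalizable_map = piecewise_affine_map +
  assumes nonren: "non_renormalizable f a b"
begin

lemma invariant_interval_dense:
  assumes "proper_interval I" "I \<subseteq> N" "f ` I \<subseteq> I"
  shows "closure I = N" "{a<..<b} \<subseteq> I"
proof -
  show "closure I = N"
  proof (rule ccontr)
    assume "closure I \<noteq> N"
    then have "renormalization f a b I 1" using assms unfolding renormalization_def by auto
    then show False using nonren unfolding non_renormalizable_def by blast
  qed
  then show "{a<..<b} \<subseteq> I"
    using assms interval_dense_imp_contains_interior unfolding proper_interval_def by blast
qed

lemma not_renormalization:
  assumes "proper_interval I" "I \<subseteq> N" "n \<ge> 1" "(f ^^ n) ` I \<subseteq> I"
    "\<And>i j. i < j \<Longrightarrow> j < n \<Longrightarrow> interior ((f ^^ i) ` I) \<inter> interior ((f ^^ j) ` I) = {}"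
  shows "closure I = N"
proof (rule ccontr)
  assume ne: "closure I \<noteq> N"
  have "interior ((f ^^ i) ` I) \<inter> interior ((f ^^ j) ` I) = {}" if "i < n" "j < n" "i \<noteq> j" for i j
    using assms(5)[of i j] assms(5)[of j i] that by (cases "i < j") auto
  then have "renormalization f a b I n" using assms ne unfolding renormalization_def by blast
  then show False using nonren unfolding non_renormalizable_def by blast
qed

text \<open>Without a fixed point inside, the graph stays on one side of the diagonal, and then the half of \<open>N\<close> on one
  side of its midpoint is invariant, a renormalization of period 1.\<close>

lemma interior_fixed_point: "\<exists>x. a < x \<and> x < b \<and> f x = x"
proof (rule ccontr)
  assume no: "\<not> ?thesis"
  define u where "u = (a + b) / 2"
  have u: "a < u" "u < b" using ab by (auto simp: u_def)
  have contg: "continuous_on {x..y} (\<lambda>z. f z - z)" if "a \<le> x" "y \<le> b" for x y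
    using that by (intro continuous_intros continuous_on_subset[OF cont]) auto
  have fN: "a \<le> f x" "f x \<le> b" if "x \<in> N" for x using maps that by (auto simp: image_subset_iff)
  consider "f u > u" | "f u < u" using no u by fastforce
  then show False
  proof cases
    case 1
    have ge: "f x \<ge> u" if x: "x \<in> {u..b}" for x
    proof (rule ccontr)
      assume lt: "\<not> f x \<ge> u"
      have "\<exists>z. u \<le> z \<and> z \<le> x \<and> f z - z = 0"
        using x lt 1 u by (intro IVT2' contg) auto
      then obtain z where z: "u \<le> z" "z \<le> x" "f z = z" by auto
      have "z \<noteq> b" using z x lt by auto
      then show False using no z u x by auto
    qed
    have "f ` {u..b} \<subseteq> {u..b}" using ge fN u by force
    then have "closure {u..b} = N" using u by (intro invariant_interval_dense) auto
    then show False using u by auto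
  next
    case 2
    have le: "f x \<le> u" if x: "x \<in> {a..u}" for x
    proof (rule ccontr)
      assume gt: "\<not> f x \<le> u"
      have "\<exists>z. x \<le> z \<and> z \<le> u \<and> f z - z = 0"
        using x gt 2 u by (intro IVT2' contg) auto
      then obtain z where z: "x \<le> z" "z \<le> u" "f z = z" by auto
      have "z \<noteq> a" using z x gt by auto
      then show False using no z u x by auto
    qed
    have "f ` {a..u} \<subseteq> {a..u}" using le fN u by force
    then have "closure {a..u} = N" using u by (intro invariant_interval_dense) auto
    then show False using u by auto
  qed
qed

definition eventually_covers :: "real set \<Rightarrow> bool" where
  "eventually_covers I \<longleftrightarrow> (\<forall>l r. a < l \<longrightarrow> r < b \<longrightarrow> (\<exists>M. \<forall>m\<ge>M. {l..r} \<subseteq> (f ^^ m) ` I))"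

lemma eventually_covers_mono: "eventually_covers V \<Longrightarrow> V \<subseteq> I \<Longrightarrow> eventually_covers I"
  unfolding eventually_covers_def by (meson image_mono subset_trans)

lemma iterate_image_image: "(f ^^ m) ` ((f ^^ n) ` I) = (f ^^ (m + n)) ` I"
  by (simp add: funpow_add image_comp)

lemma eventually_covers_iterate:
  assumes "eventually_covers ((f ^^ n) ` I)" shows "eventually_covers I"
  unfolding eventually_covers_def
proof (intro allI impI)
  fix l r assume "a < l" "r < b"
  then obtain M where M: "\<And>m. m \<ge> M \<Longrightarrow> {l..r} \<subseteq> (f ^^ (m + n)) ` I"
    using assms unfolding eventually_covers_def iterate_image_image by blast
  have "{l..r} \<subseteq> (f ^^ m) ` I" if "m \<ge> M + n" for m using M[of "m - n"] that by simp
  then show "\<exists>M. \<forall>m\<ge>M. {l..r} \<subseteq> (f ^^ m) ` I" by blast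
qed

text \<open>The images of \<open>V\<close> increase, and their union is an invariant interval; it is dense because \<open>f\<close> has no
  renormalization of period 1. By monotonicity a compact interval in the union lies in a single image.\<close>

lemma expanding_interval_eventually_covers:
  assumes V: "proper_interval V" "V \<subseteq> N" "V \<subseteq> f ` V"
  shows "eventually_covers V"
proof -
  have step: "(f ^^ m) ` V \<subseteq> (f ^^ Suc m) ` V" for m
  proof -
    have "(f ^^ m) ` V \<subseteq> (f ^^ m) ` (f ` V)" using V by blast
    then show ?thesis using iterate_image_image[of m 1 V] by simp
  qed
  have inc: "(f ^^ m) ` V \<subseteq> (f ^^ n) ` V" if "m \<le> n" for m n
    using lift_Suc_mono_le[of "\<lambda>m. (f ^^ m) ` V", OF step that] .
  define J where "J = (\<Union>m. (f ^^ m) ` V)"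
  obtain x where x: "x \<in> V" using V(1) unfolding proper_interval_def by blast
  have xm: "x \<in> (f ^^ m) ` V" for m using inc[of 0 m] x by auto
  have "is_interval J" unfolding J_def
    using V xm by (intro is_interval_UN_common_point[of _ x] is_interval_iterate_image)
      (auto simp: proper_interval_def)
  moreover have VJ: "V \<subseteq> J" unfolding J_def by (rule subset_trans[OF _ UN_upper[of 0]]) auto
  ultimately have "proper_interval J" using V(1) unfolding proper_interval_def by blast
  moreover have "J \<subseteq> N" unfolding J_def using iterate_image_subset[OF V(2)] by blast
  moreover have "f ` J \<subseteq> J"
  proof -
    have "f ` J = (\<Union>m. (f ^^ Suc m) ` V)" unfolding J_def by (simp add: image_UN image_comp)
    then show ?thesis unfolding J_def by blast
  qed
  ultimately have abJ: "{a<..<b} \<subseteq> J" by (intro invariant_interval_dense)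
  show ?thesis unfolding eventually_covers_def
  proof (intro allI impI)
    fix l r assume lr: "a < l" "r < b"
    show "\<exists>M. \<forall>m\<ge>M. {l..r} \<subseteq> (f ^^ m) ` V"
    proof (cases "l \<le> r")
      case True
      then have "l \<in> J" "r \<in> J" using abJ lr by auto
      then obtain m1 m2 where m: "l \<in> (f ^^ m1) ` V" "r \<in> (f ^^ m2) ` V" unfolding J_def by blast
      have "{l..r} \<subseteq> (f ^^ m) ` V" if "m \<ge> max m1 m2" for m
      proof (rule is_interval_contains_segment)
        show "is_interval ((f ^^ m) ` V)" using V by (intro is_interval_iterate_image) (auto simp: proper_interval_def)
        show "l \<in> (f ^^ m) ` V" "r \<in> (f ^^ m) ` V" using inc[of m1 m] inc[of m2 m] m that by auto
      qed
      then show ?thesis by blast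
    qed auto
  qed
qed

text \<open>The segment of length \<open>\<eta>\<close> that leaves \<open>q\<close> to the right for \<open>\<sigma> = 1\<close> and to the left for
  \<open>\<sigma> = -1\<close>.\<close>

definition arm :: "real \<Rightarrow> real \<Rightarrow> real \<Rightarrow> real set" where
  "arm q \<sigma> \<eta> = (\<lambda>\<tau>. q + \<sigma> * \<tau>) ` {0..\<eta>}"

definition has_arm :: "real \<Rightarrow> real \<Rightarrow> real set \<Rightarrow> bool" where
  "has_arm q \<sigma> J \<longleftrightarrow> (\<exists>\<eta>>0. arm q \<sigma> \<eta> \<subseteq> J)"

lemma arm_mono: "\<eta> \<le> \<eta>' \<Longrightarrow> arm q \<sigma> \<eta> \<subseteq> arm q \<sigma> \<eta>'"
  unfolding arm_def by (intro image_mono) auto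

lemma arm_eq:
  assumes "\<bar>\<sigma>\<bar> = 1" "0 \<le> \<eta>"
  shows "arm q \<sigma> \<eta> = (if \<sigma> = 1 then {q..q + \<eta>} else {q - \<eta>..q})"
proof (cases "\<sigma> = 1")
  case True
  then show ?thesis unfolding arm_def using image_affinity_atLeastAtMost[of 1 q 0 \<eta>] assms by (simp add: add.commute)
next
  case False
  then have "\<sigma> = -1" using assms by (auto simp: abs_if split: if_splits)
  then show ?thesis unfolding arm_def using image_affinity_atLeastAtMost[of "-1" q 0 \<eta>] assms by (simp add: add.commute)
qed

lemma arms_union: "0 \<le> \<eta> \<Longrightarrow> arm q 1 \<eta> \<union> arm q (-1) \<eta> = {q - \<eta>..q + \<eta>}"
  by (auto simp: arm_eq)

lemma has_armI:
  assumes J: "is_interval J" "q \<in> J" "z \<in> J" and \<sigma>: "\<bar>\<sigma>\<bar> = 1" "0 < \<sigma> * (z - q)"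
  shows "has_arm q \<sigma> J"
proof -
  have "arm q \<sigma> (\<sigma> * (z - q)) = (if \<sigma> = 1 then {q..z} else {z..q})"
    using \<sigma> by (subst arm_eq) (auto simp: abs_if split: if_splits)
  then have "arm q \<sigma> (\<sigma> * (z - q)) \<subseteq> J"
    using is_interval_contains_segment[OF J] is_interval_contains_segment[OF J(1,3,2)] by simp
  then show ?thesis unfolding has_arm_def using \<sigma>(2) by blast
qed

text \<open>Near the fixed point \<open>q\<close> the map sends arms to arms. If one arm is mapped along itself, its slope exceeds 1,
  for otherwise it would be invariant; so small arms on that side expand, and a fold at \<open>q\<close> sends the opposite arms there.
  If \<open>f\<close> reverses orientation at \<open>q\<close>, symmetric neighborhoods of \<open>q\<close> expand. An interval none of whose
  images contains such a neighborhood has its images alternately on the two sides of \<open>q\<close>, and the even ones form a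
  renormalization of period 2.\<close>

lemma fixed_point_interval_eventually_covers:
  assumes q: "a < q" "q < b" "f q = q" and I: "proper_interval I" "I \<subseteq> N" "q \<in> I"
  shows "eventually_covers I"
proof -
  obtain h m where h: "h > 0" "a < q - h" "q + h < b" and m: "\<And>\<sigma>. m \<sigma> \<noteq> 0" "m 1 = m (-1) \<or> m 1 * m (-1) < 0"
    and f_arm: "\<And>\<sigma> \<tau>. \<bar>\<sigma>\<bar> = 1 \<Longrightarrow> 0 \<le> \<tau> \<Longrightarrow> \<tau> \<le> h \<Longrightarrow> f (q + \<sigma> * \<tau>) = q + m \<sigma> * (\<sigma> * \<tau>)"
    using one_sided_slopes[OF q(1,2)] q(3) by metis
  have arm: "proper_interval (arm q \<sigma> \<eta>)" "arm q \<sigma> \<eta> \<subseteq> N" "closure (arm q \<sigma> \<eta>) \<noteq> N"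
    if "\<bar>\<sigma>\<bar> = 1" "0 < \<eta>" "\<eta> \<le> h" for \<sigma> \<eta>
    using that q h by (auto simp: arm_eq)
  have image_arm: "f ` arm q \<sigma> \<eta> = arm q (sgn (m \<sigma>) * \<sigma>) (\<bar>m \<sigma>\<bar> * \<eta>)" if "\<bar>\<sigma>\<bar> = 1" "\<eta> \<le> h" for \<sigma> \<eta>
  proof -
    have "f (q + \<sigma> * \<tau>) = q + sgn (m \<sigma>) * \<sigma> * (\<bar>m \<sigma>\<bar> * \<tau>)" if "\<tau> \<in> {0..\<eta>}" for \<tau>
    proof -
      have "sgn (m \<sigma>) * \<sigma> * (\<bar>m \<sigma>\<bar> * \<tau>) = (sgn (m \<sigma>) * \<bar>m \<sigma>\<bar>) * (\<sigma> * \<tau>)" by (simp only: mult_ac)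
      then show ?thesis using f_arm[of \<sigma> \<tau>] that \<open>\<bar>\<sigma>\<bar> = 1\<close> \<open>\<eta> \<le> h\<close> by (simp add: sgn_mult_abs)
    qed
    then have "f ` arm q \<sigma> \<eta> = (\<lambda>\<tau>. q + sgn (m \<sigma>) * \<sigma> * (\<bar>m \<sigma>\<bar> * \<tau>)) ` {0..\<eta>}"
      unfolding arm_def image_image by (rule image_cong[OF refl])
    also have "\<dots> = (\<lambda>\<tau>. q + sgn (m \<sigma>) * \<sigma> * \<tau>) ` ((\<lambda>\<tau>. \<bar>m \<sigma>\<bar> * \<tau>) ` {0..\<eta>})" by (simp add: image_image)
    also have "(\<lambda>\<tau>. \<bar>m \<sigma>\<bar> * \<tau>) ` {0..\<eta>} = {0..\<bar>m \<sigma>\<bar> * \<eta>}"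
      using m(1)[of \<sigma>] image_mult_atLeastAtMost[of "\<bar>m \<sigma>\<bar>" 0 \<eta>] by simp
    finally show ?thesis unfolding arm_def .
  qed
  have has_armD: "\<exists>\<eta>>0. \<eta> \<le> h \<and> arm q \<sigma> \<eta> \<subseteq> J" if J: "has_arm q \<sigma> J" for \<sigma> J
  proof -
    obtain \<eta> where \<eta>: "\<eta> > 0" "arm q \<sigma> \<eta> \<subseteq> J" using J unfolding has_arm_def by blast
    then have "arm q \<sigma> (min \<eta> h) \<subseteq> J" using arm_mono[of "min \<eta> h" \<eta>] by auto
    then show ?thesis using h(1) \<eta>(1) by (intro exI[of _ "min \<eta> h"]) auto
  qed
  have some_arm: "\<exists>\<sigma>. \<bar>\<sigma>\<bar> = 1 \<and> has_arm q \<sigma> J" if J: "proper_interval J" "q \<in> J" for J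
  proof -
    obtain z where z: "z \<in> J" "z \<noteq> q" using J(1) unfolding proper_interval_def by (metis less_irrefl)
    then have "has_arm q (sgn (z - q)) J" using J unfolding proper_interval_def
      by (intro has_armI[of J q z]) (auto simp: sgn_if)
    then show ?thesis using z(2) by (intro exI[of _ "sgn (z - q)"]) (auto simp: sgn_if)
  qed
  have pos: "eventually_covers J" if J: "has_arm q \<sigma> J" "m \<sigma> > 0" "\<bar>\<sigma>\<bar> = 1" for \<sigma> J
  proof -
    have gt1: "m \<sigma> > 1"
    proof (rule ccontr)
      assume "\<not> m \<sigma> > 1"
      then have "f ` arm q \<sigma> h \<subseteq> arm q \<sigma> h" using image_arm[OF J(3), of h] J(2) h(1)
          arm_mono[of "\<bar>m \<sigma>\<bar> * h" h q \<sigma>] by simp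
      then show False using arm[OF J(3) h(1)] invariant_interval_dense(1) by blast
    qed
    obtain \<eta> where \<eta>: "\<eta> > 0" "\<eta> \<le> h" "arm q \<sigma> \<eta> \<subseteq> J" using has_armD[OF J(1)] by blast
    have "arm q \<sigma> \<eta> \<subseteq> f ` arm q \<sigma> \<eta>"
      using image_arm[OF J(3) \<eta>(2)] gt1 \<eta>(1) arm_mono[of \<eta> "\<bar>m \<sigma>\<bar> * \<eta>" q \<sigma>] by simp
    then have "eventually_covers (arm q \<sigma> \<eta>)" using arm[OF J(3) \<eta>(1,2)]
      by (intro expanding_interval_eventually_covers)
    then show ?thesis using \<eta>(3) by (rule eventually_covers_mono)
  qed
  have neg: "has_arm q (- \<sigma>) (f ` J)" if J: "has_arm q \<sigma> J" "m \<sigma> < 0" "\<bar>\<sigma>\<bar> = 1" for \<sigma> J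
  proof -
    obtain \<eta> where \<eta>: "\<eta> > 0" "\<eta> \<le> h" "arm q \<sigma> \<eta> \<subseteq> J" using has_armD[OF J(1)] by blast
    have "arm q (- \<sigma>) (\<bar>m \<sigma>\<bar> * \<eta>) = f ` arm q \<sigma> \<eta>" using image_arm[OF J(3) \<eta>(2)] J(2) by simp
    also have "\<dots> \<subseteq> f ` J" using \<eta>(3) by (rule image_mono)
    finally have "arm q (- \<sigma>) (\<bar>m \<sigma>\<bar> * \<eta>) \<subseteq> f ` J" .
    moreover have "0 < \<bar>m \<sigma>\<bar> * \<eta>" using m(1)[of \<sigma>] \<eta>(1) by simp
    ultimately show ?thesis unfolding has_arm_def by blast
  qed
  have cov1: "eventually_covers I" if "eventually_covers (f ` I)" using eventually_covers_iterate[of 1 I] that by simp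
  obtain \<sigma>I where \<sigma>I: "\<bar>\<sigma>I\<bar> = 1" "has_arm q \<sigma>I I" using some_arm[OF I(1,3)] by blast
  consider (increasing) "m \<sigma>I > 0" | (folded) "m \<sigma>I < 0" "m (- \<sigma>I) > 0" | (reversing) "m \<sigma>I < 0" "m (- \<sigma>I) < 0"
    using m(1)[of \<sigma>I] m(1)[of "- \<sigma>I"] by linarith
  then show ?thesis
  proof cases
    case increasing
    then show ?thesis using pos \<sigma>I by blast
  next
    case folded
    then show ?thesis using pos[of "- \<sigma>I"] neg[OF \<sigma>I(2)] \<sigma>I(1) cov1 by simp
  next
    case reversing
    define \<mu> where "\<mu> = m 1"
    have "\<sigma>I = 1 \<or> \<sigma>I = -1" using \<sigma>I(1) by (auto simp: abs_if split: if_splits)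
    then have "m 1 < 0" "m (-1) < 0" using reversing by auto
    then have mm: "m 1 = \<mu>" "m (-1) = \<mu>" "\<mu> < 0" using m(2) by (auto simp: \<mu>_def mult_less_0_iff)
    have m\<mu>: "m \<sigma> = \<mu>" if "\<bar>\<sigma>\<bar> = 1" for \<sigma> using that mm by (auto simp: abs_if split: if_splits)
    have image_ball: "f ` {q - \<eta>..q + \<eta>} = {q - (- \<mu> * \<eta>)..q + (- \<mu> * \<eta>)}" if "0 \<le> \<eta>" "\<eta> \<le> h" for \<eta>
    proof -
      have "0 \<le> - \<mu> * \<eta>" using mm(3) that by (intro mult_nonneg_nonneg) auto
      then show ?thesis
        unfolding arms_union[OF that(1), symmetric] image_Un using image_arm[of 1 \<eta>] image_arm[of "-1" \<eta>] that mm arms_union[of "- \<mu> * \<eta>" q]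
        by (simp add: Un_commute)
    qed
    have exp: "\<mu> < -1"
    proof (rule ccontr)
      assume "\<not> \<mu> < -1"
      then have "- \<mu> * h \<le> h" using h(1) mult_right_mono[of "- \<mu>" 1 h] by simp
      then have "f ` {q - h..q + h} \<subseteq> {q - h..q + h}" using image_ball[of h] h(1) by auto
      then have "closure {q - h..q + h} = N" using h by (intro invariant_interval_dense(1)) auto
      then show False using h q by auto
    qed
    have both: "eventually_covers J" if J: "has_arm q 1 J" "has_arm q (-1) J" for J
    proof -
      obtain \<eta>1 \<eta>2 where \<eta>12: "\<eta>1 > 0" "\<eta>1 \<le> h" "arm q 1 \<eta>1 \<subseteq> J" "\<eta>2 > 0" "\<eta>2 \<le> h" "arm q (-1) \<eta>2 \<subseteq> J"
        using has_armD[OF J(1)] has_armD[OF J(2)] by blast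
      define \<eta> where "\<eta> = min \<eta>1 \<eta>2"
      have \<eta>: "0 < \<eta>" "\<eta> \<le> h" "\<eta> \<le> \<eta>1" "\<eta> \<le> \<eta>2" using \<eta>12 by (auto simp: \<eta>_def)
      have "\<eta> \<le> - \<mu> * \<eta>" using exp \<eta>(1) mult_right_mono[of 1 "- \<mu>" \<eta>] by simp
      then have "{q - \<eta>..q + \<eta>} \<subseteq> f ` {q - \<eta>..q + \<eta>}" using image_ball[of \<eta>] \<eta>(1,2) by auto
      then have "eventually_covers {q - \<eta>..q + \<eta>}"
        using \<eta> q h by (intro expanding_interval_eventually_covers) auto
      moreover have "{q - \<eta>..q + \<eta>} \<subseteq> J"
        unfolding arms_union[OF less_imp_le[OF \<eta>(1)], symmetric]
        using arm_mono[OF \<eta>(3), of q 1] arm_mono[OF \<eta>(4), of q "-1"] \<eta>12(3,6) by blast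
      ultimately show ?thesis by (rule eventually_covers_mono)
    qed
    have qn: "(f ^^ n) q = q" for n by (induction n) (use q in auto)
    show ?thesis
    proof (rule ccontr)
      assume nc: "\<not> eventually_covers I"
      have one: "\<not> (has_arm q \<sigma>I ((f ^^ n) ` I) \<and> has_arm q (- \<sigma>I) ((f ^^ n) ` I))" for n
        using both eventually_covers_iterate[of n I] nc \<open>\<sigma>I = 1 \<or> \<sigma>I = -1\<close> by auto
      have par: "has_arm q \<sigma>I ((f ^^ (2 * n)) ` I) \<and> has_arm q (- \<sigma>I) ((f ^^ (2 * n + 1)) ` I)" for n
      proof (induction n)
        case 0
        show ?case using \<sigma>I neg[OF \<sigma>I(2) reversing(1)] by simp
      next
        case (Suc n)
        have 1: "has_arm q \<sigma>I ((f ^^ (2 * Suc n)) ` I)"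
          using neg[of "- \<sigma>I" "(f ^^ (2 * n + 1)) ` I"] Suc reversing \<sigma>I(1) iterate_image_image[of 1 "2 * n + 1" I] by simp
        then have "has_arm q (- \<sigma>I) ((f ^^ (2 * Suc n + 1)) ` I)"
          using neg[OF 1 reversing(1) \<sigma>I(1)] iterate_image_image[of 1 "2 * Suc n" I] by simp
        then show ?case using 1 by blast
      qed
      have int: "is_interval ((f ^^ n) ` I)" for n
        using I by (intro is_interval_iterate_image) (auto simp: proper_interval_def)
      have qin: "q \<in> (f ^^ n) ` I" for n using I(3) qn[of n] by (metis image_eqI)
      have ev: "0 \<le> \<sigma>I * (z - q)" if z: "z \<in> (f ^^ (2 * n)) ` I" for n z
        using has_armI[OF int qin z, of "- \<sigma>I"] one[of "2 * n"] par[of n] \<sigma>I(1) by fastforce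
      have od: "\<sigma>I * (z - q) \<le> 0" if z: "z \<in> (f ^^ (2 * n + 1)) ` I" for n z
        using has_armI[OF int qin z, of \<sigma>I] one[of "2 * n + 1"] par[of n] \<sigma>I(1) by fastforce
      \<comment> \<open>the interval swept by the even images lies on one side of \<open>q\<close>, its image on the other\<close>
      define J where "J = (\<Union>n. (f ^^ (2 * n)) ` I)"
      have J: "is_interval J" unfolding J_def using int qin by (intro is_interval_UN_common_point)
      have IJ: "I \<subseteq> J" unfolding J_def by (rule subset_trans[OF _ UN_upper[of 0]]) auto
      then have PJ: "proper_interval J" using J I(1) unfolding proper_interval_def by blast
      have NJ: "J \<subseteq> N" unfolding J_def using iterate_image_subset[OF I(2)] by blast
      have f1: "f ` J = (\<Union>n. (f ^^ (2 * n + 1)) ` I)"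
        unfolding J_def image_UN using iterate_image_image[of 1 _ I] by simp
      have f2: "(f ^^ 2) ` J \<subseteq> J"
      proof -
        have "(f ^^ 2) ` J = (\<Union>n. (f ^^ (2 * Suc n)) ` I)"
          unfolding J_def image_UN iterate_image_image by simp
        then show ?thesis unfolding J_def by blast
      qed
      have sJ: "0 \<le> \<sigma>I * (z - q)" if "z \<in> J" for z using that ev unfolding J_def by blast
      have sfJ: "\<sigma>I * (z - q) \<le> 0" if "z \<in> f ` J" for z using that od unfolding f1 by blast
      have "z = q" if z: "z \<in> J" "z \<in> f ` J" for z
      proof -
        have "\<sigma>I * (z - q) = 0" using sJ[OF z(1)] sfJ[OF z(2)] by linarith
        then show ?thesis using \<sigma>I(1) by auto
      qed
      then have "interior J \<inter> interior (f ` J) \<subseteq> {q}" using interior_subset[of J] interior_subset[of "f ` J"] by blast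
      then have disj: "interior J \<inter> interior (f ` J) = {}"
        using finite_imp_not_open[of "interior J \<inter> interior (f ` J)"] finite_subset[of _ "{q}"] open_Int open_interior by blast
      have "interior ((f ^^ i) ` J) \<inter> interior ((f ^^ j) ` J) = {}" if "i < j" "j < 2" for i j :: nat
      proof -
        have "i = 0" "j = 1" using that by auto
        then show ?thesis using disj by simp
      qed
      then have "closure J = N" using PJ NJ f2 by (intro not_renormalization[of J 2]) auto
      moreover have "closed {z. 0 \<le> \<sigma>I * (z - q)}" by (intro closed_Collect_le continuous_intros)
      then have "closure J \<subseteq> {z. 0 \<le> \<sigma>I * (z - q)}" using sJ by (intro closure_minimal) auto
      ultimately have "0 \<le> \<sigma>I * (a - q)" "0 \<le> \<sigma>I * (b - q)" using ab by auto
      then show False using \<open>\<sigma>I = 1 \<or> \<sigma>I = -1\<close> q by auto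
    qed
  qed
qed

end

section \<open>Exactness in the absence of zero-dimensional absorbing sets\<close>

locale attractor_free_map = nonrenormalizable_map +
  assumes no_absorbing: "\<not> (\<exists>A. absorbing_set f a b A \<and> zero_dimensional A)"
begin

text \<open>The form in which the absence of zero-dimensional absorbing sets is used. The empty set needs a separate argument,
  since it is not zero-dimensional: no limit set is empty.\<close>

lemma omega_limit_in_nowhere_dense_null:
  assumes A: "closed A" "A \<subseteq> N" "\<And>u v. u < v \<Longrightarrow> \<not> {u<..<v} \<subseteq> A"
  shows "negligible {x\<in>N. omega_limit f x \<subseteq> A}"
proof (cases "A = {}")
  case True
  have "{x\<in>N. omega_limit f x \<subseteq> A} = {}"
  proof -
    have "omega_limit f x \<noteq> {}" if x: "x \<in> N" for x
      unfolding omega_limit_def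
    proof (rule compact_nest)
      fix n :: nat
      have sub: "(\<lambda>m. (f ^^ m) x) ` {n..} \<subseteq> N" using iterate_in_N[OF x] by blast
      then have "closure ((\<lambda>m. (f ^^ m) x) ` {n..}) \<subseteq> N" by (rule closure_minimal) simp
      then show "compact (closure ((\<lambda>m. (f ^^ m) x) ` {n..}))"
        by (metis compact_closure bounded_closed_interval bounded_subset sub)
      show "closure ((\<lambda>m. (f ^^ m) x) ` {n..}) \<noteq> {}" by simp
    next
      fix m n :: nat assume "m \<le> n"
      then show "closure ((\<lambda>m. (f ^^ m) x) ` {n..}) \<subseteq> closure ((\<lambda>m. (f ^^ m) x) ` {m..})"
        by (intro closure_mono image_mono) auto
    qed
    then show ?thesis using True by auto
  qed
  then show ?thesis by (simp only: negligible_empty)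
next
  case False
  have m: "{x\<in>N. omega_limit f x \<subseteq> A} \<in> sets lebesgue"
    using A(1) False iterate_in_N by (intro sets_omega_limit_subset continuous_iterate) auto
  have "zero_dimensional A" using False A by (intro zero_dimensionalI) auto
  then have "\<not> emeasure lebesgue {x\<in>N. omega_limit f x \<subseteq> A} > 0"
    using no_absorbing A unfolding absorbing_set_def by blast
  then have "{x\<in>N. omega_limit f x \<subseteq> A} \<in> null_sets lebesgue" using m by auto
  then show ?thesis by (simp add: negligible_iff_null_sets)
qed

text \<open>If the images of \<open>I\<close> were disjoint, the closed set \<open>A\<close> on which they accumulate would have empty
  interior: an open set in \<open>A\<close> meets some image in an interval, and a later image would have to meet that
  interval. But all of \<open>I\<close> would be attracted by \<open>A\<close>.\<close>

lemma no_wandering_interval: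
  assumes I: "proper_interval I" "I \<subseteq> N"
  shows "\<exists>n m. n < m \<and> (f ^^ n) ` I \<inter> (f ^^ m) ` I \<noteq> {}"
proof (rule ccontr)
  assume "\<not> ?thesis"
  then have disj: "\<And>n m. n < m \<Longrightarrow> (f ^^ n) ` I \<inter> (f ^^ m) ` I = {}" by blast
  define A where "A = (\<Inter>n. closure (\<Union>m\<in>{n..}. (f ^^ m) ` I))"
  have cl: "closed A" unfolding A_def by (intro closed_INT) auto
  have "closure (\<Union>m\<in>{0..}. (f ^^ m) ` I) \<subseteq> N"
    using iterate_image_subset[OF I(2)] by (intro closure_minimal) (blast, simp)
  then have AN: "A \<subseteq> N" unfolding A_def by blast
  have noint: "\<not> {u<..<v} \<subseteq> A" if uv: "u < v" for u v
  proof
    assume sub: "{u<..<v} \<subseteq> A"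
    then have "{u<..<v} \<subseteq> closure (\<Union>m\<in>{0..}. (f ^^ m) ` I)" unfolding A_def by blast
    then have "{u<..<v} \<inter> (\<Union>m\<in>{0..}. (f ^^ m) ` I) \<noteq> {}"
      using open_Int_closure_eq_empty[of "{u<..<v}" "\<Union>m\<in>{0..}. (f ^^ m) ` I"]
      by (metis Int_absorb2 greaterThanLessThan_empty_iff not_le open_greaterThanLessThan uv)
    then obtain m x where x: "x \<in> {u<..<v}" "x \<in> (f ^^ m) ` I" by blast
    have Im: "is_interval ((f ^^ m) ` I)" "proper_interval ((f ^^ m) ` I)"
      using proper_interval_iterate_image[OF I, of m] unfolding proper_interval_def by auto
    then obtain y where y: "y \<in> (f ^^ m) ` I" "y \<noteq> x"
      unfolding proper_interval_def by (metis less_irrefl)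
    define u' where "u' = max u (min x y)"
    define v' where "v' = min v (max x y)"
    have u'v': "u' < v'" using x(1) y(2) by (auto simp: u'_def v'_def)
    have "{min x y..max x y} \<subseteq> (f ^^ m) ` I"
      using Im(1) x(2) y(1) by (intro is_interval_contains_segment) (auto simp: min_def max_def)
    moreover have "{u'<..<v'} \<subseteq> {min x y..max x y}" by (auto simp: u'_def v'_def)
    ultimately have s1: "{u'<..<v'} \<subseteq> (f ^^ m) ` I" by blast
    have "{u'<..<v'} \<subseteq> {u<..<v}" by (auto simp: u'_def v'_def)
    then have "{u'<..<v'} \<subseteq> closure (\<Union>k\<in>{Suc m..}. (f ^^ k) ` I)" using sub unfolding A_def by blast
    then have "{u'<..<v'} \<inter> (\<Union>k\<in>{Suc m..}. (f ^^ k) ` I) \<noteq> {}"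
      using open_Int_closure_eq_empty[of "{u'<..<v'}" "\<Union>k\<in>{Suc m..}. (f ^^ k) ` I"]
      by (metis Int_absorb2 greaterThanLessThan_empty_iff not_le open_greaterThanLessThan u'v')
    then obtain k z where "k \<ge> Suc m" "z \<in> (f ^^ k) ` I" "z \<in> (f ^^ m) ` I" using s1 by blast
    then show False using disj[of m k] by auto
  qed
  have "I \<subseteq> {x\<in>N. omega_limit f x \<subseteq> A}"
  proof
    fix x assume x: "x \<in> I"
    have "closure ((\<lambda>m. (f ^^ m) x) ` {n..}) \<subseteq> closure (\<Union>m\<in>{n..}. (f ^^ m) ` I)" for n
      using x by (intro closure_mono) auto
    then have "omega_limit f x \<subseteq> A" unfolding omega_limit_def A_def by blast
    then show "x \<in> {x\<in>N. omega_limit f x \<subseteq> A}" using x I by auto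
  qed
  then have "negligible I" using omega_limit_in_nowhere_dense_null[OF cl AN noint] negligible_subset by blast
  moreover obtain u v where uv: "u < v" "{u..v} \<subseteq> I" using proper_interval_contains_segment[OF I(1)] .
  ultimately have "negligible {u..v}" using negligible_subset by blast
  then show False using uv(1) negligible_interval(1)[of u v] by (simp add: box_real)
qed

text \<open>Two images of \<open>I\<close> meet, so a component \<open>J\<close> of the union of the late images returns to itself. At its first
  return time it is a renormalization, unless it is dense in \<open>N\<close>.\<close>

lemma orbit_covers_interior:
  assumes I: "proper_interval I" "I \<subseteq> N"
  shows "{a<..<b} \<subseteq> (\<Union>n. (f ^^ n) ` I)"
proof -
  obtain n m where nm: "n < m" "(f ^^ n) ` I \<inter> (f ^^ m) ` I \<noteq> {}" using no_wandering_interval[OF I] by blast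
  define K where "K = (\<Union>i\<in>{n..}. (f ^^ i) ` I)"
  have KN: "K \<subseteq> N" unfolding K_def using iterate_image_subset[OF I(2)] by blast
  have fK: "(f ^^ i) ` K \<subseteq> K" for i
  proof -
    have "(f ^^ i) ` K = (\<Union>j\<in>{n..}. (f ^^ (i + j)) ` I)" unfolding K_def image_UN iterate_image_image ..
    moreover have "(f ^^ (i + j)) ` I \<subseteq> K" if "j \<in> {n..}" for j
      unfolding K_def using that by (intro UN_upper) auto
    ultimately show ?thesis by blast
  qed
  obtain x0 where x0: "x0 \<in> (f ^^ n) ` I" using nm by blast
  \<comment> \<open>only images from time \<open>n\<close> on: \<open>I\<close> itself need not be recurrent\<close>
  define J where "J = connected_component_set K x0"
  have JK: "J \<subseteq> K" unfolding J_def by (rule connected_component_subset)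
  have conJ: "connected J" unfolding J_def by simp
  have in_n: "(f ^^ n) ` I \<subseteq> J" unfolding J_def
    using I x0 by (intro connected_component_maximal)
      (auto simp: K_def proper_interval_def is_interval_connected_1[symmetric] intro: is_interval_iterate_image)
  have ret: "(f ^^ i) ` J \<subseteq> J" if meets: "(f ^^ i) ` J \<inter> J \<noteq> {}" for i
  proof -
    obtain y where y: "y \<in> (f ^^ i) ` J" "y \<in> J" using meets by blast
    have "connected ((f ^^ i) ` J)"
      using conJ JK KN by (intro connected_continuous_image continuous_on_subset[OF continuous_iterate]) auto
    moreover have "(f ^^ i) ` J \<subseteq> K" using fK[of i] JK by blast
    ultimately have "(f ^^ i) ` J \<subseteq> connected_component_set K y" using y by (intro connected_component_maximal)
    moreover have "connected_component_set K y = J"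
      unfolding J_def using y(2) connected_component_eq[of y K x0] unfolding J_def by simp
    ultimately show ?thesis by simp
  qed
  have "(f ^^ (m - n)) ` J \<inter> J \<noteq> {}"
  proof -
    have "(f ^^ m) ` I \<subseteq> (f ^^ (m - n)) ` J"
      using image_mono[OF in_n, of "f ^^ (m - n)"] iterate_image_image[of "m - n" n I] nm by simp
    then show ?thesis using nm in_n by blast
  qed
  then have ex: "1 \<le> m - n \<and> (f ^^ (m - n)) ` J \<inter> J \<noteq> {}" using nm by simp
  \<comment> \<open>the first return time of \<open>J\<close>; components that are met at different times before it are disjoint\<close>
  define q where "q = (LEAST i. 1 \<le> i \<and> (f ^^ i) ` J \<inter> J \<noteq> {})"
  have q: "1 \<le> q" "(f ^^ q) ` J \<inter> J \<noteq> {}" using LeastI[of "\<lambda>i. 1 \<le> i \<and> (f ^^ i) ` J \<inter> J \<noteq> {}", OF ex] unfolding q_def by auto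
  have qmin: "(f ^^ i) ` J \<inter> J = {}" if "1 \<le> i" "i < q" for i
    using not_less_Least[of i "\<lambda>i. 1 \<le> i \<and> (f ^^ i) ` J \<inter> J \<noteq> {}"] that unfolding q_def by blast
  have dis: "(f ^^ i) ` J \<inter> (f ^^ j) ` J = {}" if ij: "i < j" "j < q" for i j
  proof (rule ccontr)
    assume "(f ^^ i) ` J \<inter> (f ^^ j) ` J \<noteq> {}"
    then obtain z where z: "z \<in> (f ^^ i) ` J" "z \<in> (f ^^ j) ` J" by blast
    have "(f ^^ (q - j)) z \<in> (f ^^ (q - j + i)) ` J" "(f ^^ (q - j)) z \<in> (f ^^ (q - j + j)) ` J"
      using z by (metis imageI iterate_image_image)+
    moreover have "(f ^^ (q - j + j)) ` J \<subseteq> J" using ret[OF q(2)] ij by simp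
    ultimately have "(f ^^ (q - j + i)) ` J \<inter> J \<noteq> {}" by blast
    moreover have "1 \<le> q - j + i" "q - j + i < q" using ij by auto
    ultimately show False using qmin by blast
  qed
  have "proper_interval ((f ^^ n) ` I)" using proper_interval_iterate_image[OF I] .
  then have "proper_interval J" using in_n conJ unfolding proper_interval_def is_interval_connected_1 by blast
  moreover have JN: "J \<subseteq> N" using JK KN by blast
  moreover have "interior ((f ^^ i) ` J) \<inter> interior ((f ^^ j) ` J) = {}" if "i < j" "j < q" for i j
    using dis[OF that] interior_subset[of "(f ^^ i) ` J"] interior_subset[of "(f ^^ j) ` J"] by blast
  ultimately have "closure J = N" using q(1) ret[OF q(2)] by (intro not_renormalization[of J q])
  then have "{a<..<b} \<subseteq> J"
    using conJ by (intro interval_dense_imp_contains_interior) (auto simp: is_interval_connected_1)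
  then show ?thesis using JK unfolding K_def by blast
qed

lemma exactness:
  assumes I: "proper_interval I" "I \<subseteq> N"
  shows "eventually_covers I"
proof -
  obtain q where q: "a < q" "q < b" "f q = q" using interior_fixed_point by blast
  then obtain n where "q \<in> (f ^^ n) ` I" using orbit_covers_interior[OF I] by force
  then have "eventually_covers ((f ^^ n) ` I)"
    using q I by (intro fixed_point_interval_eventually_covers proper_interval_iterate_image iterate_image_subset)
  then show ?thesis by (rule eventually_covers_iterate)
qed

lemma uniform_exactness:
  assumes r: "r > 0" and lr: "a < l" "l' < b"
  obtains M where "\<And>x y m. a \<le> x \<Longrightarrow> y \<le> b \<Longrightarrow> r \<le> y - x \<Longrightarrow> m \<ge> M \<Longrightarrow> {l..l'} \<subseteq> (f ^^ m) ` {x<..<y}"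
proof -
  obtain M where "\<And>x y. a \<le> x \<Longrightarrow> y \<le> b \<Longrightarrow> r \<le> y - x \<Longrightarrow> \<forall>m\<ge>M. {l..l'} \<subseteq> (f ^^ m) ` {x<..<y}"
  proof (rule uniform_on_long_intervals[OF ab r])
    fix u v :: real assume uv: "u < v" "{u..v} \<subseteq> N"
    then have "{u<..<v} \<subseteq> N" by (auto simp: subset_iff)
    then have "eventually_covers {u<..<v}" using uv(1) by (intro exactness) auto
    then show "\<exists>M. \<forall>m\<ge>M. {l..l'} \<subseteq> (f ^^ m) ` {u<..<v}" using lr unfolding eventually_covers_def by blast
  qed (meson image_mono order_trans, rule that)
  then show ?thesis using that by blast
qed

section \<open>A periodic orbit off the critical orbits\<close>

text \<open>A compact interval is covered by some positive iterate of itself, and the intermediate value theorem applies.\<close>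

lemma periodic_points_dense:
  assumes uv: "u < v" "a < u" "v < b"
  shows "\<exists>x\<in>{u..v}. \<exists>m\<ge>1. (f ^^ m) x = x"
proof -
  have uvN: "{u..v} \<subseteq> N" using uv by auto
  obtain M where M: "\<And>m. m \<ge> M \<Longrightarrow> {u..v} \<subseteq> (f ^^ m) ` {u..v}"
    using exactness[OF proper_interval_atLeastAtMost[OF uv(1)] uvN] uv(2,3)
    unfolding eventually_covers_def by blast
  define m where "m = max M 1"
  have "{u..v} \<subseteq> (f ^^ m) ` {u..v}" using M[of m] by (simp add: m_def)
  moreover have "u \<in> {u..v}" "v \<in> {u..v}" using uv by auto
  ultimately have "u \<in> (f ^^ m) ` {u..v}" "v \<in> (f ^^ m) ` {u..v}" by blast+
  then obtain x y where xy: "x \<in> {u..v}" "(f ^^ m) x = u" "y \<in> {u..v}" "(f ^^ m) y = v"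
    by (blast elim: imageE)
  have contg: "continuous_on {u..v} (\<lambda>z. (f ^^ m) z - z)"
    by (intro continuous_intros continuous_on_subset[OF continuous_iterate uvN])
  have "connected ((\<lambda>z. (f ^^ m) z - z) ` {u..v})" using contg by (intro connected_continuous_image) auto
  then have "is_interval ((\<lambda>z. (f ^^ m) z - z) ` {u..v})" by (simp add: is_interval_connected_1)
  moreover have "(f ^^ m) x - x \<le> 0" "0 \<le> (f ^^ m) y - y" using xy by auto
  ultimately have "0 \<in> (\<lambda>z. (f ^^ m) z - z) ` {u..v}"
    using xy(1,3) unfolding is_interval_1 by blast
  then obtain z where "z \<in> {u..v}" "(f ^^ m) z = z" by auto
  then show ?thesis by (intro bexI[of _ z] exI[of _ m]) (auto simp: m_def)
qed

text \<open>An orbit that meets a periodic point is finite.\<close>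

lemma finite_periodic_in_orbit: "finite {x. (\<exists>n. (f ^^ n) c = x) \<and> (\<exists>m\<ge>1. (f ^^ m) x = x)}"
proof (cases "\<exists>n. \<exists>m\<ge>1. (f ^^ m) ((f ^^ n) c) = (f ^^ n) c")
  case True
  then obtain n m where nm: "m \<ge> 1" "(f ^^ m) ((f ^^ n) c) = (f ^^ n) c" by blast
  have red: "(f ^^ (i + m)) c = (f ^^ i) c" if "i \<ge> n" for i
  proof -
    have "(f ^^ (i + m)) c = (f ^^ ((i - n) + (m + n))) c" using that by (simp add: add.commute add.left_commute)
    also have "\<dots> = (f ^^ (i - n)) ((f ^^ m) ((f ^^ n) c))" by (simp only: funpow_add comp_apply)
    also have "\<dots> = (f ^^ (i - n + n)) c" by (simp only: nm(2) funpow_add comp_apply)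
    finally show ?thesis using that by simp
  qed
  have "(f ^^ i) c \<in> (\<lambda>i. (f ^^ i) c) ` {..<n + m}" for i
  proof (induction i rule: less_induct)
    case (less i)
    show ?case
    proof (cases "i < n + m")
      case False
      then have "(f ^^ i) c = (f ^^ (i - m)) c" using red[of "i - m"] by simp
      moreover have "i - m < i" using False nm(1) by simp
      ultimately show ?thesis using less by simp
    qed auto
  qed
  then have "{x. (\<exists>n. (f ^^ n) c = x) \<and> (\<exists>m\<ge>1. (f ^^ m) x = x)} \<subseteq> (\<lambda>i. (f ^^ i) c) ` {..<n + m}" by auto
  then show ?thesis by (rule finite_subset) simp
next
  case False
  then have "{x. (\<exists>n. (f ^^ n) c = x) \<and> (\<exists>m\<ge>1. (f ^^ m) x = x)} = {}" by auto
  then show ?thesis by (simp only: finite.emptyI)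
qed

text \<open>There are infinitely many periodic points, and only finitely many of them lie on the orbits of the critical points.\<close>

lemma periodic_orbit_off_critical_orbits:
  obtains P q where "finite P" "f ` P \<subseteq> P" "P \<subseteq> N" "q \<in> P" "a < q" "q < b"
    "\<And>c n. c \<in> C \<Longrightarrow> (f ^^ n) c \<notin> P"
proof -
  define B where "B = (\<Union>c\<in>C. {x. (\<exists>n. (f ^^ n) c = x) \<and> (\<exists>m\<ge>1. (f ^^ m) x = x)})"
  have "finite B" unfolding B_def using finite_C finite_periodic_in_orbit by blast
  then obtain u v where uv: "a < u" "u < v" "v < b" "{u..v} \<inter> B = {}"
    using finite_avoiding_subinterval ab by metis
  obtain q m where q: "q \<in> {u..v}" "m \<ge> 1" "(f ^^ m) q = q" using periodic_points_dense uv by blast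
  then have qB: "q \<notin> B" using uv by blast
  have period: "(f ^^ (i * m)) q = q" for i
  proof (induction i)
    case (Suc i)
    have "(f ^^ (Suc i * m)) q = (f ^^ m) ((f ^^ (i * m)) q)" by (simp add: funpow_add)
    then show ?case using Suc q by simp
  qed simp
  define P where "P = range (\<lambda>i. (f ^^ i) q)"
  have red: "(f ^^ i) q = (f ^^ (i mod m)) q" for i
  proof -
    have "(f ^^ i) q = (f ^^ (i mod m + i div m * m)) q" by simp
    also have "\<dots> = (f ^^ (i mod m)) q" by (simp only: funpow_add comp_apply period)
    finally show ?thesis .
  qed
  have "P \<subseteq> (\<lambda>i. (f ^^ i) q) ` {..<m}"
    unfolding P_def using red q(2) by (metis (no_types, lifting) image_subset_iff lessThan_iff image_eqI mod_less_divisor less_le_trans zero_less_one)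
  then have 1: "finite P" by (rule finite_subset) simp
  have 2: "f ` P \<subseteq> P" unfolding P_def by (auto intro: range_eqI[of _ _ "Suc _"])
  have qN: "q \<in> N" using q uv by auto
  have 3: "P \<subseteq> N" unfolding P_def using iterate_in_N[OF qN] by blast
  have 4: "q \<in> P" unfolding P_def by (rule range_eqI[of _ _ 0]) simp
  have 5: "(f ^^ n) c \<notin> P" if c: "c \<in> C" for c n
  proof
    assume "(f ^^ n) c \<in> P"
    then obtain i where i: "(f ^^ n) c = (f ^^ i) q" unfolding P_def by auto
    have "(f ^^ (i * m - i + n)) c = (f ^^ (i * m - i)) ((f ^^ i) q)" by (simp only: funpow_add comp_apply i)
    also have "\<dots> = (f ^^ (i * m - i + i)) q" by (simp only: funpow_add comp_apply)
    also have "i * m - i + i = i * m" using q(2) by simp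
    finally have "(f ^^ (i * m - i + n)) c = q" using period by simp
    then show False using qB c q unfolding B_def by blast
  qed
  show ?thesis using that[OF 1 2 3 4 _ _ 5] q uv by auto
qed

end

context piecewise_affine_map
begin

section \<open>Fine nice neighborhoods\<close>

lemma good_interval_at_zero:
  assumes "open U" "U \<subseteq> N" "c \<in> U"
  shows "good U c 0 (connected_component_set U c)"
proof -
  let ?W = "connected_component_set U c"
  have W: "open ?W" "c \<in> ?W" using assms by (auto simp: open_connected_component connected_component_refl)
  then obtain e where e: "e > 0" "ball c e \<subseteq> ?W" by (meson open_contains_ball)
  have "c + e/2 \<in> ball c e" using e by (simp add: dist_real_def)
  then have "proper_interval ?W"
    using e W by (intro proper_intervalI[of _ c "c + e/2"]) (auto simp: is_interval_connected_1)
  moreover have "?W \<subseteq> N" using assms(2) connected_component_subset by blast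
  ultimately show ?thesis unfolding good_interval_at_def by (auto simp: monotone_on_def)
qed

lemma good_interval_pullback_affine:
  assumes "is_interval V" "V \<subseteq> N" "inj_affine_on V (f ^^ n)"
    "good U c q G" "G \<subseteq> (f ^^ n) ` V"
  obtains T where "T \<subseteq> V" "good U c (n + q) T" "(f ^^ n) ` T = G"
proof -
  obtain m k where "m \<noteq> 0" "\<And>x. x \<in> V \<Longrightarrow> (f ^^ n) x = m * x + k"
    using assms(3) unfolding inj_affine_on_def by metis
  then show ?thesis
    using good_interval_pullback[OF assms(1,2) _ _ assms(4,5)] that[of "{x \<in> V. (f ^^ n) x \<in> G}"] by blast
qed

end

context attractor_free_map
begin

text \<open>Start at a point \<open>e\<close> of \<open>I\<close> whose orbit enters \<open>P\<close>. A one-sided neighborhood of \<open>e\<close> is mapped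
  affinely until its image meets a critical point, and then the image joins that point to a point of \<open>P\<close>. The lower bound for
  its length depends only on \<open>P\<close> and not on \<open>I\<close>.\<close>

lemma affine_branch_of_definite_size:
  assumes P: "f ` P \<subseteq> P" "q \<in> P" "a < q" "q < b" "\<And>c n. c \<in> C \<Longrightarrow> (f ^^ n) c \<notin> P"
    and \<rho>: "\<And>c x. c \<in> C \<Longrightarrow> x \<in> P \<Longrightarrow> \<rho> \<le> \<bar>c - x\<bar>"
    and I: "proper_interval I" "I \<subseteq> N"
  shows "\<exists>y z n. y < z \<and> {y..z} \<subseteq> I \<and> inj_affine_on {y..z} (f ^^ n) \<and> \<rho> \<le> \<bar>(f ^^ n) y - (f ^^ n) z\<bar>"
proof -
  obtain u v where uv: "u < v" "{u..v} \<subseteq> I" using proper_interval_contains_segment[OF I(1)] .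
  have uvN: "{u..v} \<subseteq> N" using uv I by blast
  have sub: "{u<..<v} \<subseteq> N" using uvN by (auto simp: subset_iff)
  have "q \<in> (\<Union>n. (f ^^ n) ` {u<..<v})"
    by (rule subsetD[OF orbit_covers_interior]) (use uv(1) sub P(3,4) in auto)
  then obtain n e where e: "u < e" "e < v" "(f ^^ n) e = q" by auto
  have Pn: "(f ^^ j) x \<in> P" if "x \<in> P" for j x by (induction j) (use that P(1) in auto)
  have inP: "(f ^^ k) e \<in> P" if "k \<ge> n" for k
  proof -
    have "(f ^^ k) e = (f ^^ (k - n + n)) e" using that by simp
    also have "\<dots> = (f ^^ (k - n)) q" by (simp only: funpow_add comp_apply e(3))
    finally show ?thesis using Pn[OF P(2)] by simp
  qed
  have offC: "(f ^^ j) e \<notin> C" for j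
  proof
    assume c: "(f ^^ j) e \<in> C"
    have "(f ^^ n) ((f ^^ j) e) = (f ^^ (n + j)) e" by (simp add: funpow_add)
    also have "\<dots> \<in> P" by (rule inP) simp
    finally show False using P(5)[OF c] by blast
  qed
  have eab: "a < e" "e < b" using e uvN uv(1) by auto
  obtain h where h: "0 < h" "{e - h..e + h} \<subseteq> N" "\<And>j. j < n \<Longrightarrow> (f ^^ j) ` {e - h..e + h} \<inter> C = {}"
    using iterate_nbhd_off_C[OF eab, of n] offC by metis
  \<comment> \<open>on this neighborhood no critical point is met before the orbit of \<open>e\<close> has reached \<open>P\<close>\<close>
  define w where "w = min v (e + h)"
  have w: "e < w" "w \<le> v" "w \<le> e + h" using e h by (auto simp: w_def)
  have ewN: "{e<..<w} \<subseteq> N" using w e uvN uv(1) by (auto simp: subset_iff)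
  obtain c where c: "c \<in> C" using C_nonempty by blast
  then have "c \<in> (\<Union>n. (f ^^ n) ` {e<..<w})"
    using w(1) ewN C_interior[OF c] by (intro subsetD[OF orbit_covers_interior]) auto
  then have ex: "\<exists>k. (f ^^ k) ` {e<..<w} \<inter> C \<noteq> {}" using c by blast
  define k where "k = (LEAST k. (f ^^ k) ` {e<..<w} \<inter> C \<noteq> {})"
  have kC: "(f ^^ k) ` {e<..<w} \<inter> C \<noteq> {}" unfolding k_def using ex by (rule LeastI_ex)
  have kmin: "(f ^^ j) ` {e<..<w} \<inter> C = {}" if "j < k" for j
    using not_less_Least[of j "\<lambda>k. (f ^^ k) ` {e<..<w} \<inter> C \<noteq> {}"] that unfolding k_def by blast
  have kn: "k \<ge> n"
  proof (rule ccontr)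
    assume "\<not> k \<ge> n"
    then have "(f ^^ k) ` {e - h..e + h} \<inter> C = {}" using h(3) by simp
    moreover have "{e<..<w} \<subseteq> {e - h..e + h}" using w h by auto
    ultimately show False using kC by blast
  qed
  obtain z where z: "e < z" "z < w" "(f ^^ k) z \<in> C" using kC by auto
  have "inj_affine_on {e..z} (f ^^ k)"
  proof (rule inj_affine_on_iterate)
    show "{e..z} \<subseteq> N" using z w e uvN uv(1) by auto
    fix j assume j: "j < k"
    have "{e..z} \<subseteq> insert e {e<..<w}" using z by auto
    then show "(f ^^ j) ` {e..z} \<inter> C = {}" using kmin[OF j] offC[of j] by blast
  qed (simp add: is_interval_cc)
  moreover have "\<rho> \<le> \<bar>(f ^^ k) e - (f ^^ k) z\<bar>"
    using \<rho>[OF z(3) inP[OF kn]] by (simp add: abs_minus_commute)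
  moreover have "{e..z} \<subseteq> {u..v}" using e z w by auto
  then have "{e..z} \<subseteq> I" using uv(2) by blast
  ultimately show ?thesis using z(1) by blast
qed

definition branch_onto :: "real \<Rightarrow> real \<Rightarrow> real \<Rightarrow> real \<Rightarrow> bool" where
  "branch_onto c \<epsilon> y z \<longleftrightarrow> (\<exists>m y' z'. m \<ge> 1 \<and> y' < z' \<and> {y'..z'} \<subseteq> {y<..<z} \<and>
     inj_affine_on {y'..z'} (f ^^ m) \<and> {c - \<epsilon>..c + \<epsilon>} \<subseteq> (f ^^ m) ` {y'..z'})"

lemma branch_onto_mono:
  assumes "branch_onto c \<epsilon> u v" "{u<..<v} \<subseteq> {y<..<z}" "\<epsilon>' \<le> \<epsilon>"
  shows "branch_onto c \<epsilon>' y z"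
proof -
  have "{c - \<epsilon>'..c + \<epsilon>'} \<subseteq> {c - \<epsilon>..c + \<epsilon>}" using assms(3) by auto
  then show ?thesis using assms(1,2) unfolding branch_onto_def by (meson subset_trans)
qed

text \<open>By exactness some iterate of \<open>{y..z}\<close> covers both sides of \<open>c\<close>; a crossing of the level \<open>c\<close>
  is transversal and yields the branch.\<close>

lemma affine_branch_onto_nbhd_of_critical_point:
  assumes yz: "y < z" "{y..z} \<subseteq> N" and c: "c \<in> C"
  shows "\<exists>\<epsilon>>0. branch_onto c \<epsilon> y z"
proof -
  have cab: "a < c" "c < b" using C_interior[OF c] by auto
  define l where "l = (a + c) / 2"
  define r where "r = (c + b) / 2"
  have lr: "a < l" "l < c" "c < r" "r < b" using cab by (auto simp: l_def r_def)
  obtain M where M: "\<And>m. m \<ge> M \<Longrightarrow> {l..r} \<subseteq> (f ^^ m) ` {y..z}"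
    using exactness[OF proper_interval_atLeastAtMost[OF yz(1)] yz(2)] lr unfolding eventually_covers_def by blast
  define m where "m = max M 1"
  have cov: "{l..r} \<subseteq> (f ^^ m) ` {y..z}" using M[of m] by (simp add: m_def)
  moreover have "l \<in> {l..r}" "r \<in> {l..r}" using lr by auto
  ultimately have "l \<in> (f ^^ m) ` {y..z}" "r \<in> (f ^^ m) ` {y..z}" by blast+
  then obtain x1 x2 where x: "x1 \<in> {y..z}" "(f ^^ m) x1 = l" "x2 \<in> {y..z}" "(f ^^ m) x2 = r"
    by (blast elim: imageE)
  obtain w where w: "y < w" "w < z" "(f ^^ m) w = c" "\<And>j. j < m \<Longrightarrow> (f ^^ j) w \<notin> C"
    using crossing_avoids_C[OF x(1,3) yz(2), of m c] x lr by auto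
  have wab: "a < w" "w < b" using w yz by auto
  obtain h where h: "0 < h" "{w - h..w + h} \<subseteq> N" "\<And>j. j < m \<Longrightarrow> (f ^^ j) ` {w - h..w + h} \<inter> C = {}"
    using iterate_nbhd_off_C[OF wab, of m] w(4) by metis
  define h' where "h' = min h (min (w - y) (z - w)) / 2"
  have h': "0 < h'" "h' \<le> h" "y < w - h'" "w + h' < z" using h(1) w(1,2) by (auto simp: h'_def min_def field_simps)
  have "inj_affine_on {w - h..w + h} (f ^^ m)" using h by (intro inj_affine_on_iterate) (auto simp: is_interval_cc)
  moreover have "{w - h'..w + h'} \<subseteq> {w - h..w + h}" using h' by auto
  ultimately have aff: "inj_affine_on {w - h'..w + h'} (f ^^ m)" by (rule inj_affine_on_subset)
  then obtain \<mu> k where \<mu>: "\<mu> \<noteq> 0" "\<And>x. x \<in> {w - h'..w + h'} \<Longrightarrow> (f ^^ m) x = \<mu> * x + k"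
    unfolding inj_affine_on_def by metis
  define \<epsilon> where "\<epsilon> = \<bar>\<mu>\<bar> * h'"
  have "{c - \<epsilon>..c + \<epsilon>} \<subseteq> (f ^^ m) ` {w - h'..w + h'}"
  proof
    fix t assume t: "t \<in> {c - \<epsilon>..c + \<epsilon>}"
    define x where "x = w + (t - c) / \<mu>"
    have "\<bar>(t - c) / \<mu>\<bar> \<le> h'" using t \<mu>(1) by (auto simp: \<epsilon>_def abs_divide field_simps abs_le_iff)
    then have x: "x \<in> {w - h'..w + h'}" unfolding x_def by (simp add: abs_le_iff del: abs_divide)
    have "(f ^^ m) x - (f ^^ m) w = \<mu> * (x - w)" using \<mu>(2)[OF x] \<mu>(2)[of w] h' by (simp add: algebra_simps)
    then have "(f ^^ m) x = t" using w(3) \<mu>(1) by (simp add: x_def)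
    then show "t \<in> (f ^^ m) ` {w - h'..w + h'}" using x by blast
  qed
  moreover have "\<epsilon> > 0" using \<mu> h' by (simp add: \<epsilon>_def)
  moreover have "{w - h'..w + h'} \<subseteq> {y<..<z}" using h' by auto
  moreover have "m \<ge> 1" by (simp add: m_def)
  ultimately show ?thesis using aff h'(1) unfolding branch_onto_def
    by (intro exI[of _ \<epsilon>] conjI exI[of _ m] exI[of _ "w - h'"] exI[of _ "w + h'"]) auto
qed

lemma uniform_affine_branches:
  assumes r: "r > 0" and c: "c \<in> C"
  shows "\<exists>\<epsilon>>0. \<forall>y z. a \<le> y \<longrightarrow> z \<le> b \<longrightarrow> r \<le> z - y \<longrightarrow> branch_onto c \<epsilon> y z"
proof -
  obtain k where "\<And>y z. a \<le> y \<Longrightarrow> z \<le> b \<Longrightarrow> r \<le> z - y \<Longrightarrow> branch_onto c (1 / Suc k) y z"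
  proof (rule uniform_on_long_intervals[OF ab r])
    fix u v :: real assume "u < v" "{u..v} \<subseteq> N"
    then obtain \<epsilon> where \<epsilon>: "\<epsilon> > 0" "branch_onto c \<epsilon> u v"
      using affine_branch_onto_nbhd_of_critical_point c by blast
    obtain k where "inverse (real (Suc k)) < \<epsilon>" using reals_Archimedean[OF \<epsilon>(1)] by blast
    then show "\<exists>k. branch_onto c (1 / Suc k) u v"
      using branch_onto_mono[OF \<epsilon>(2) order_refl] by (auto simp: inverse_eq_divide intro!: exI[of _ k])
  next
    fix u v x y :: real and k k' :: nat
    assume "branch_onto c (1 / Suc k) u v" "{u<..<v} \<subseteq> {x<..<y}" "k \<le> k'"
    then show "branch_onto c (1 / Suc k') x y" 
      using branch_onto_mono[of c _ u v x y "1 / Suc k'"] by (simp add: frac_le)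
  qed (rule that)
  then show ?thesis by (intro exI[of _ "1 / real (Suc k)"]) auto
qed

lemma preimage_dense_near:
  assumes P: "q \<in> P" "a < q" "q < b" and uv: "u < v" "{u..v} \<subseteq> N"
  shows "\<exists>k x. u < x \<and> x < v \<and> (f ^^ k) x \<in> P"
proof -
  have "{u<..<v} \<subseteq> N" using uv(2) by (auto simp: subset_iff)
  then have "q \<in> (\<Union>n. (f ^^ n) ` {u<..<v})"
    using uv(1) P(2,3) by (intro subsetD[OF orbit_covers_interior]) auto
  then obtain k x where "x \<in> {u<..<v}" "q = (f ^^ k) x" by blast
  then show ?thesis using P(1) by (intro exI[of _ k] exI[of _ x]) auto
qed

text \<open>The set \<open>Pk k\<close> of points that are mapped into \<open>P\<close> by \<open>f ^^ k\<close> is closed, forward invariant and free of critical points,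
  so the components around critical points of its complement form a nice neighborhood. It is fine as soon as its
  components are small in comparison with the branches of \<open>affine_branch_of_definite_size\<close>: an arbitrary interval has an affine
  branch of definite size, and inside its image there is an affine branch onto the whole component. The point
  \<open>w\<close> records that \<open>U\<close> does not exhaust the interior of \<open>N\<close>.\<close>

lemma exists_fine_nice_nbhd: "\<exists>U. fine_nice_nbhd f a b U \<and> (\<exists>w. a < w \<and> w < b \<and> w \<notin> U)"
proof -
  obtain P q where P: "finite P" "f ` P \<subseteq> P" "P \<subseteq> N" "q \<in> P" "a < q" "q < b"
    and PC: "\<And>c n. c \<in> C \<Longrightarrow> (f ^^ n) c \<notin> P"
    using periodic_orbit_off_critical_orbits by metis
  have Pn: "(f ^^ j) x \<in> P" if "x \<in> P" for j x by (induction j) (use that P(2) in auto)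
  obtain \<rho> where \<rho>: "\<rho> > 0" "\<And>c x. c \<in> C \<Longrightarrow> x \<in> P \<Longrightarrow> \<rho> \<le> \<bar>c - x\<bar>"
  proof -
    have "\<exists>\<rho>>0. \<forall>p\<in>C \<times> P. \<rho> \<le> \<bar>fst p - snd p\<bar>"
    proof (rule finite_uniform_real)
      show "\<exists>\<rho>>0. \<rho> \<le> \<bar>fst p - snd p\<bar>" if "p \<in> C \<times> P" for p
        using that PC[of "fst p" 0] by (intro exI[of _ "\<bar>fst p - snd p\<bar>"]) auto
    qed (use finite_C P in auto)
    then obtain e where e: "e > 0" "\<forall>p\<in>C \<times> P. e \<le> \<bar>fst p - snd p\<bar>" by blast
    show ?thesis
    proof (rule that[OF e(1)])
      show "e \<le> \<bar>c - x\<bar>" if "c \<in> C" "x \<in> P" for c x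
        using bspec[OF e(2), of "(c, x)"] that by simp
    qed
  qed
  obtain \<epsilon>1 where \<epsilon>1: "\<epsilon>1 > 0"
    and branches: "\<And>c y z. c \<in> C \<Longrightarrow> a \<le> y \<Longrightarrow> z \<le> b \<Longrightarrow> \<rho> \<le> z - y \<Longrightarrow> branch_onto c \<epsilon>1 y z"
  proof -
    have "\<exists>\<epsilon>>0. \<forall>c\<in>C. \<forall>y z. a \<le> y \<longrightarrow> z \<le> b \<longrightarrow> \<rho> \<le> z - y \<longrightarrow> branch_onto c \<epsilon> y z"
      using uniform_affine_branches[OF \<rho>(1)] branch_onto_mono[OF _ order_refl]
      by (intro finite_uniform_real[OF finite_C]) meson+
    then show ?thesis using that by blast
  qed
  obtain \<epsilon>2 where \<epsilon>2: "\<epsilon>2 > 0" "\<And>c c'. c \<in> C \<Longrightarrow> c' \<in> C \<Longrightarrow> c \<noteq> c' \<Longrightarrow> \<epsilon>2 \<le> \<bar>c - c'\<bar>"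
  proof -
    have "\<exists>e>0. \<forall>p\<in>C \<times> C. fst p \<noteq> snd p \<longrightarrow> e \<le> \<bar>fst p - snd p\<bar>"
    proof (rule finite_uniform_real)
      show "finite (C \<times> C)" using finite_C by simp
      show "\<exists>e>0. fst p \<noteq> snd p \<longrightarrow> e \<le> \<bar>fst p - snd p\<bar>" for p :: "real \<times> real"
        by (cases "fst p = snd p") (auto intro: exI[of _ 1] exI[of _ "\<bar>fst p - snd p\<bar>"])
      show "fst p \<noteq> snd p \<longrightarrow> e' \<le> \<bar>fst p - snd p\<bar>"
        if "fst p \<noteq> snd p \<longrightarrow> e \<le> \<bar>fst p - snd p\<bar>" "0 < e'" "e' \<le> e" for p :: "real \<times> real" and e e'
        using that by linarith
    qed
    then obtain e where e: "e > 0" "\<forall>p\<in>C \<times> C. fst p \<noteq> snd p \<longrightarrow> e \<le> \<bar>fst p - snd p\<bar>" by blast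
    show ?thesis
    proof (rule that[OF e(1)])
      show "e \<le> \<bar>c - c'\<bar>" if "c \<in> C" "c' \<in> C" "c \<noteq> c'" for c c'
        using bspec[OF e(2), of "(c, c')"] that by simp
    qed
  qed
  obtain \<epsilon>3 where \<epsilon>3: "\<epsilon>3 > 0" "\<And>c. c \<in> C \<Longrightarrow> a < c - \<epsilon>3 \<and> c + \<epsilon>3 < b"
  proof -
    have "\<exists>e>0. \<forall>c\<in>C. a < c - e \<and> c + e < b"
    proof (rule finite_uniform_real[OF finite_C])
      show "\<exists>e>0. a < c - e \<and> c + e < b" if "c \<in> C" for c
        using C_interior[OF that] by (intro exI[of _ "min (c - a) (b - c) / 2"]) (auto simp: min_def field_simps)
    qed auto
    then show ?thesis using that by blast
  qed
  \<comment> \<open>\<open>\<epsilon>1\<close> makes the components small targets, \<open>\<epsilon>2\<close> separates the critical points, \<open>\<epsilon>3\<close> keeps away from the ends of \<open>N\<close>\<close>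
  define \<epsilon> where "\<epsilon> = min \<epsilon>1 (min \<epsilon>2 \<epsilon>3)"
  have \<epsilon>: "\<epsilon> > 0" "\<epsilon> \<le> \<epsilon>1" "\<epsilon> \<le> \<epsilon>2" "\<epsilon> \<le> \<epsilon>3" using \<epsilon>1 \<epsilon>2 \<epsilon>3 by (auto simp: \<epsilon>_def)
  have cab: "a < c - \<epsilon>" "c + \<epsilon> < b" if "c \<in> C" for c using \<epsilon>3(2)[OF that] \<epsilon> by auto
  define Pk where "Pk k = {x \<in> N. (f ^^ k) x \<in> P}" for k
  have "\<exists>k. \<forall>c\<in>C. \<exists>u v. c - \<epsilon> < u \<and> u < c \<and> c < v \<and> v < c + \<epsilon> \<and> (f ^^ k) u \<in> P \<and> (f ^^ k) v \<in> P"
  proof (rule finite_uniform_nat[OF finite_C])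
    have up: "(f ^^ k') x \<in> P" if "(f ^^ k) x \<in> P" "k \<le> k'" for k k' x
    proof -
      have "(f ^^ k') x = (f ^^ (k' - k + k)) x" using that by simp
      also have "\<dots> = (f ^^ (k' - k)) ((f ^^ k) x)" by (simp only: funpow_add comp_apply)
      finally show ?thesis using Pn[OF that(1)] by simp
    qed
    show "\<exists>k u v. c - \<epsilon> < u \<and> u < c \<and> c < v \<and> v < c + \<epsilon> \<and> (f ^^ k) u \<in> P \<and> (f ^^ k) v \<in> P" if c: "c \<in> C" for c
    proof -
      obtain k1 u where u: "c - \<epsilon> < u" "u < c" "(f ^^ k1) u \<in> P"
        using preimage_dense_near[OF P(4-6), of "c - \<epsilon>" c] cab[OF c] \<epsilon>(1) C_interior[OF c] by auto
      obtain k2 v where v: "c < v" "v < c + \<epsilon>" "(f ^^ k2) v \<in> P"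
        using preimage_dense_near[OF P(4-6), of c "c + \<epsilon>"] cab[OF c] \<epsilon>(1) C_interior[OF c] by auto
      show ?thesis using u v up[of k1 u "max k1 k2"] up[of k2 v "max k1 k2"]
        by (intro exI[of _ "max k1 k2"] exI[of _ u] exI[of _ v]) auto
    qed
    show "\<exists>u v. c - \<epsilon> < u \<and> u < c \<and> c < v \<and> v < c + \<epsilon> \<and> (f ^^ k') u \<in> P \<and> (f ^^ k') v \<in> P"
      if "\<exists>u v. c - \<epsilon> < u \<and> u < c \<and> c < v \<and> v < c + \<epsilon> \<and> (f ^^ k) u \<in> P \<and> (f ^^ k) v \<in> P" "k \<le> k'" for c k k'
      using that up by blast
  qed
  then obtain k where k: "\<And>c. c \<in> C \<Longrightarrow> \<exists>u v. c - \<epsilon> < u \<and> u < c \<and> c < v \<and> v < c + \<epsilon> \<and> (f ^^ k) u \<in> P \<and> (f ^^ k) v \<in> P"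
    by blast
  have closedPk: "closed (Pk k)"
  proof -
    have "closed (N \<inter> (f ^^ k) -` P)"
      using P(1) by (intro continuous_closed_preimage continuous_iterate) (auto intro: finite_imp_closed)
    then show ?thesis unfolding Pk_def by (simp add: vimage_def Int_def)
  qed
  have PkP: "(f ^^ i) x \<in> Pk k" if "x \<in> Pk k" for i x
  proof -
    have "(f ^^ k) ((f ^^ i) x) = (f ^^ i) ((f ^^ k) x)" by (metis add.commute comp_apply funpow_add)
    then show ?thesis using that Pn iterate_in_N unfolding Pk_def by auto
  qed
  define G where "G = {a<..<b} - Pk k"
  have openG: "open G" unfolding G_def using closedPk by (intro open_Diff) auto
  define W where "W c = connected_component_set G c" for c
  have CG: "c \<in> G" if "c \<in> C" for c using PC[OF that, of k] C_interior[OF that] unfolding G_def Pk_def by auto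
  have openW: "open (W c)" for c unfolding W_def using openG by (rule open_connected_component)
  have conW: "connected (W c)" for c unfolding W_def by simp
  have WG: "W c \<subseteq> G" for c unfolding W_def by (rule connected_component_subset)
  have cW: "c \<in> W c" if "c \<in> C" for c unfolding W_def using CG[OF that] by (simp add: connected_component_refl)
  have Wsmall: "W c \<subseteq> {c - \<epsilon><..<c + \<epsilon>}" if c: "c \<in> C" for c
  proof
    fix x assume x: "x \<in> W c"
    obtain u v where uv: "c - \<epsilon> < u" "u < c" "c < v" "v < c + \<epsilon>" "(f ^^ k) u \<in> P" "(f ^^ k) v \<in> P" using k[OF c] by blast
    have iW: "is_interval (W c)" using conW by (simp add: is_interval_connected_1)
    have "u \<in> Pk k" "v \<in> Pk k" using uv cab[OF c] unfolding Pk_def by auto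
    then have "u \<notin> W c" "v \<notin> W c" using WG[of c] unfolding G_def by auto
    then have "\<not> x \<le> u" "\<not> v \<le> x" using iW x cW[OF c] uv unfolding is_interval_1 by (meson less_imp_le)+
    then show "x \<in> {c - \<epsilon><..<c + \<epsilon>}" using uv by auto
  qed
  define U where "U = (\<Union>c\<in>C. W c)"
  have openU: "open U" unfolding U_def using openW by blast
  have UG: "U \<subseteq> G" unfolding U_def using WG by blast
  have UN: "U \<subseteq> N" using UG unfolding G_def by auto
  have CU: "C \<subseteq> U" unfolding U_def using cW by blast
  have comp: "connected_component_set U x = W c" if "c \<in> C" "x \<in> W c" for c x
  proof
    have "W c \<subseteq> U" unfolding U_def using that by blast
    then show "W c \<subseteq> connected_component_set U x" using that conW by (intro connected_component_maximal) auto
    have "connected_component_set U x \<subseteq> connected_component_set G x" using UG by (rule connected_component_mono)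
    also have "\<dots> = W c" using that(2) unfolding W_def by (metis connected_component_eq)
    finally show "connected_component_set U x \<subseteq> W c" .
  qed
  have front: "frontier U \<subseteq> Pk k"
  proof
    fix x assume "x \<in> frontier U"
    then have x: "x \<in> closure U" "x \<notin> U" using openU by (auto simp: frontier_def interior_open)
    have "closed (\<Union>c\<in>C. closure (W c))" using finite_C by (intro closed_UN) auto
    moreover have "U \<subseteq> (\<Union>c\<in>C. closure (W c))" unfolding U_def using closure_subset by (intro UN_mono) auto
    ultimately have "closure U \<subseteq> (\<Union>c\<in>C. closure (W c))" by (rule closure_minimal[rotated])
    then obtain c where c: "c \<in> C" "x \<in> closure (W c)" using x by blast
    have "closure (W c) \<subseteq> {c - \<epsilon>..c + \<epsilon>}" using Wsmall[OF c(1)] by (intro closure_minimal) (auto simp: subset_iff less_imp_le)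
    then have xab: "a < x" "x < b" using c cab[OF c(1)] by auto
    show "x \<in> Pk k"
    proof (rule ccontr)
      assume "x \<notin> Pk k"
      then have xG: "x \<in> G" using xab unfolding G_def by auto
      have "open (connected_component_set G x)" using openG by (rule open_connected_component)
      moreover have "x \<in> connected_component_set G x" using xG by (simp add: connected_component_refl)
      ultimately have "connected_component_set G x \<inter> W c \<noteq> {}"
        using c(2) open_Int_closure_eq_empty by blast
      then have "connected_component_set G x = W c" unfolding W_def
        by (metis connected_component_nonoverlap)
      then have "x \<in> W c" using \<open>x \<in> connected_component_set G x\<close> by simp
      then show False using x(2) c(1) unfolding U_def by blast
    qed
  qed
  have nice: "nice_nbhd f a b U"
    unfolding nice_nbhd_def
  proof (intro conjI openU CU UN ballI)
    have "orb f (frontier U) \<subseteq> Pk k" unfolding orb_def using front PkP by blast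
    then show "orb f (frontier U) \<inter> U = {}" using UG unfolding G_def by blast
    fix K assume "K \<in> components U"
    then obtain x where x: "x \<in> U" "K = connected_component_set U x" unfolding components_def by blast
    then obtain c where c: "c \<in> C" "x \<in> W c" unfolding U_def by blast
    have K: "K = W c" using comp[OF c] x by simp
    show "\<exists>!c. c \<in> K \<and> c \<in> C"
    proof (rule ex1I[of _ c])
      show "c \<in> K \<and> c \<in> C" using K cW c by simp
      fix c' assume c': "c' \<in> K \<and> c' \<in> C"
      then have "\<bar>c - c'\<bar> < \<epsilon>" using Wsmall[OF c(1)] K by fastforce
      then show "c' = c" using \<epsilon>2(2)[OF c(1), of c'] c' \<epsilon> by (cases "c = c'") auto
    qed
  qed
  have "fine_nice_nbhd f a b U"
    unfolding fine_nice_nbhd_def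
  proof (intro conjI nice allI impI ballI)
    fix I c assume I: "proper_interval I \<and> I \<subseteq> N" and c: "c \<in> C"
    obtain y z n where yz: "y < z" "{y..z} \<subseteq> I" "inj_affine_on {y..z} (f ^^ n)" "\<rho> \<le> \<bar>(f ^^ n) y - (f ^^ n) z\<bar>"
      using affine_branch_of_definite_size[OF P(2,4-6) PC \<rho>(2)] I by blast
    define \<alpha> where "\<alpha> = min ((f ^^ n) y) ((f ^^ n) z)"
    define \<beta> where "\<beta> = max ((f ^^ n) y) ((f ^^ n) z)"
    have yzN: "{y..z} \<subseteq> N" using yz I by blast
    have "y \<in> {y..z}" "z \<in> {y..z}" using yz by auto
    then have "y \<in> N" "z \<in> N" using yzN by blast+
    then have "(f ^^ n) y \<in> N" "(f ^^ n) z \<in> N" by (blast intro: iterate_in_N)+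
    then have \<alpha>\<beta>: "a \<le> \<alpha>" "\<beta> \<le> b" "\<rho> \<le> \<beta> - \<alpha>" using yz(4) by (auto simp: \<alpha>_def \<beta>_def)
    have img: "{\<alpha>..\<beta>} \<subseteq> (f ^^ n) ` {y..z}"
    proof (rule is_interval_contains_segment)
      show "is_interval ((f ^^ n) ` {y..z})" using yzN by (intro is_interval_iterate_image) (auto simp: is_interval_cc)
      show "\<alpha> \<in> (f ^^ n) ` {y..z}" "\<beta> \<in> (f ^^ n) ` {y..z}" using yz(1) by (auto simp: \<alpha>_def \<beta>_def min_def max_def)
    qed
    obtain m y' z' where m: "m \<ge> 1" "y' < z'" "{y'..z'} \<subseteq> {\<alpha>..\<beta>}" "inj_affine_on {y'..z'} (f ^^ m)"
      "{c - \<epsilon>1..c + \<epsilon>1} \<subseteq> (f ^^ m) ` {y'..z'}"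
      using branches[OF c \<alpha>\<beta>] unfolding branch_onto_def by (meson greaterThanLessThan_subseteq_atLeastAtMost_iff order_refl order_trans)
    have yzN': "{y'..z'} \<subseteq> N" using m(3) \<alpha>\<beta> by (auto simp: subset_iff)
    have good0: "good U c 0 (connected_component_set U c)"
      using openU UN CU c by (intro good_interval_at_zero) auto
    have "{c - \<epsilon><..<c + \<epsilon>} \<subseteq> {c - \<epsilon>1..c + \<epsilon>1}" using \<epsilon> by auto
    then have "connected_component_set U c \<subseteq> (f ^^ m) ` {y'..z'}"
      using comp[OF c cW[OF c]] Wsmall[OF c] m(5) by blast
    then obtain T1 where T1: "T1 \<subseteq> {y'..z'}" "good U c (m + 0) T1"
      using good_interval_pullback_affine[OF is_interval_cc yzN' m(4) good0] by metis
    have "T1 \<subseteq> (f ^^ n) ` {y..z}" using T1(1) m(3) img by blast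
    then obtain T where T: "T \<subseteq> {y..z}" "good U c (n + (m + 0)) T"
      using good_interval_pullback_affine[OF is_interval_cc yzN yz(3) T1(2)] by metis
    show "\<exists>n T. n \<ge> 1 \<and> T \<subseteq> I \<and> good U c n T"
      using T m(1) yz(2) by (intro exI[of _ "n + (m + 0)"] exI[of _ T]) auto
  qed
  moreover have "\<exists>w. a < w \<and> w < b \<and> w \<notin> U"
  proof -
    obtain c where c: "c \<in> C" using C_nonempty by blast
    obtain u where "c - \<epsilon> < u" "u < c" "(f ^^ k) u \<in> P" using k[OF c] by blast
    then have "a < u" "u < b" "u \<in> Pk k" using cab[OF c] \<epsilon>(1) unfolding Pk_def by auto
    then show ?thesis using UG unfolding G_def by blast
  qed
  ultimately show ?thesis by blast
qed

end

context piecewise_affine_map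
begin

section \<open>Entrance into good intervals\<close>

lemma nice_nbhdD:
  assumes "nice_nbhd f a b U"
  shows "open U" "C \<subseteq> U" "U \<subseteq> N" "\<And>x i. x \<in> frontier U \<Longrightarrow> (f ^^ i) x \<notin> U"
  using assms unfolding nice_nbhd_def orb_def by blast+

lemma component_closure_boundary:
  fixes U :: "real set"
  assumes "open U" "x \<in> closure (connected_component_set U c)" "x \<notin> connected_component_set U c"
  shows "x \<in> frontier U"
proof -
  have "x \<in> frontier (connected_component_set U c)"
    using assms open_connected_component[OF assms(1), of c] by (simp add: frontier_def interior_open)
  then show ?thesis using frontier_of_connected_component_subset by blast
qed

text \<open>A good interval inherits niceness: its boundary points are mapped to the boundary of \<open>U\<close> at time \<open>n\<close>, whereas a
  point of \<open>B\<close> is in \<open>U\<close> at that time.\<close>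

lemma good_interval_boundary:
  assumes U: "nice_nbhd f a b U" and B: "good U c n B" and z: "z \<in> closure B" "z \<notin> B"
  shows "(f ^^ n) z \<in> frontier U" "(f ^^ i) z \<notin> B"
proof -
  let ?W = "connected_component_set U c"
  note nice = nice_nbhdD[OF U]
  obtain u v m k where uv: "u < v" "B = {u<..<v}" "{u..v} \<subseteq> N" "m \<noteq> 0"
    and aff: "\<And>x. x \<in> {u..v} \<Longrightarrow> (f ^^ n) x = m * x + k"
    using good_interval_affine[OF nice(1) B] by metis
  have img: "(f ^^ n) ` B = ?W" using B unfolding good_interval_at_def by blast
  have zuv: "z \<in> {u..v}" using z uv by simp
  have "(f ^^ n) ` closure B \<subseteq> closure ?W"
    using uv img closure_subset[of ?W]
    by (intro image_closure_subset continuous_on_subset[OF continuous_iterate]) auto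
  then have "(f ^^ n) z \<in> closure ?W" using z by blast
  moreover have "(f ^^ n) z \<notin> ?W"
  proof
    assume "(f ^^ n) z \<in> ?W"
    then obtain y where y: "y \<in> B" "(f ^^ n) z = (f ^^ n) y" using img by (metis imageE)
    then have "m * z + k = m * y + k" using aff[OF zuv] aff[of y] uv by auto
    then show False using uv(4) y(1) z(2) by simp
  qed
  ultimately show front: "(f ^^ n) z \<in> frontier U" using component_closure_boundary[OF nice(1)] by blast
  show "(f ^^ i) z \<notin> B"
  proof
    assume "(f ^^ i) z \<in> B"
    then have "(f ^^ n) ((f ^^ i) z) \<in> ?W" using img by blast
    moreover have "(f ^^ n) ((f ^^ i) z) = (f ^^ i) ((f ^^ n) z)" by (metis add.commute comp_apply funpow_add)
    ultimately have "(f ^^ i) ((f ^^ n) z) \<in> U" using connected_component_subset[of U c] by auto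
    then show False using nice(4)[OF front] by blast
  qed
qed

lemma fine_nice_nbhdD:
  assumes "fine_nice_nbhd f a b U"
  shows "nice_nbhd f a b U"
    "\<And>I c. proper_interval I \<Longrightarrow> I \<subseteq> N \<Longrightarrow> c \<in> C \<Longrightarrow> \<exists>n T. n \<ge> 1 \<and> T \<subseteq> I \<and> good U c n T"
  using assms unfolding fine_nice_nbhd_def by blast+

text \<open>Inside the component onto which \<open>B\<close> is mapped there is another good interval; pulling it back through \<open>B\<close>
  adds the times.\<close>

lemma good_interval_of_long_time:
  assumes U: "fine_nice_nbhd f a b U" and c: "c \<in> C"
  shows "\<exists>n B. n \<ge> k \<and> good U c n B"
proof (induction k)
  case 0
  show ?case using fine_nice_nbhdD(2)[OF U proper_interval_atLeastAtMost[OF ab] order_refl c] by blast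
next
  case (Suc k)
  then obtain n B where nB: "n \<ge> k" "good U c n B" by blast
  have op: "open U" using nice_nbhdD(1)[OF fine_nice_nbhdD(1)[OF U]] .
  have B: "proper_interval B" "B \<subseteq> N" using nB unfolding good_interval_at_def by auto
  obtain n' T where T: "n' \<ge> 1" "T \<subseteq> (f ^^ n) ` B" "good U c n' T"
    using fine_nice_nbhdD(2)[OF U proper_interval_iterate_image[OF B] iterate_image_subset[OF B(2)] c] by blast
  have "inj_affine_on B (f ^^ n)"
    using good_interval_affine[OF op nB(2)] unfolding inj_affine_on_def
    by (metis greaterThanLessThan_iff atLeastAtMost_iff less_imp_le)
  then obtain T' where "good U c (n + n') T'"
    using good_interval_pullback_affine[OF _ B(2) _ T(3,2)] B(1) unfolding proper_interval_def by metis
  moreover have "n + n' \<ge> Suc k" using nB(1) T(1) by simp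
  ultimately show ?case by blast
qed

lemma good_intervals_of_definite_length:
  assumes U: "fine_nice_nbhd f a b U" and r: "r > 0"
  obtains \<kappa> where "\<kappa> > 0" "\<And>x y. a \<le> x \<Longrightarrow> y \<le> b \<Longrightarrow> r \<le> y - x \<Longrightarrow>
    \<exists>n\<ge>1. \<exists>c\<in>C. \<exists>G\<subseteq>{x<..<y}. good U c n G \<and> (\<exists>y'\<in>G. \<exists>z'\<in>G. \<kappa> \<le> z' - y')"
proof -
  obtain c where c: "c \<in> C" using C_nonempty by blast
  obtain k where k: "\<And>x y. a \<le> x \<Longrightarrow> y \<le> b \<Longrightarrow> r \<le> y - x \<Longrightarrow>
    \<exists>n\<ge>1. \<exists>G\<subseteq>{x<..<y}. good U c n G \<and> (\<exists>y'\<in>G. \<exists>z'\<in>G. 1 / Suc k \<le> z' - y')"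
  proof (rule uniform_on_long_intervals[OF ab r])
    fix u v :: real assume uv: "u < v" "{u..v} \<subseteq> N"
    then have "proper_interval {u<..<v}" "{u<..<v} \<subseteq> N" by (auto simp: subset_iff)
    then obtain n G where nG: "n \<ge> 1" "G \<subseteq> {u<..<v}" "good U c n G"
      using fine_nice_nbhdD(2)[OF U _ _ c] by blast
    then obtain y' z' where yz: "y' \<in> G" "z' \<in> G" "y' < z'" unfolding good_interval_at_def proper_interval_def by blast
    obtain k where "inverse (real (Suc k)) < z' - y'" using reals_Archimedean[of "z' - y'"] yz(3) by auto
    then have "1 / Suc k \<le> z' - y'" by (simp add: inverse_eq_divide)
    then show "\<exists>k. \<exists>n\<ge>1. \<exists>G\<subseteq>{u<..<v}. good U c n G \<and> (\<exists>y'\<in>G. \<exists>z'\<in>G. 1 / Suc k \<le> z' - y')"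
      using nG yz(1,2) by (intro exI[of _ k] exI[of _ n] exI[of _ G] conjI) auto
  next
    fix u v x y :: real and k k' :: nat
    assume Q: "\<exists>n\<ge>1. \<exists>G\<subseteq>{u<..<v}. good U c n G \<and> (\<exists>y'\<in>G. \<exists>z'\<in>G. 1 / Suc k \<le> z' - y')"
      and sub: "{u<..<v} \<subseteq> {x<..<y}" and "k \<le> k'"
    then have "1 / real (Suc k') \<le> 1 / real (Suc k)" by (simp add: frac_le)
    then show "\<exists>n\<ge>1. \<exists>G\<subseteq>{x<..<y}. good U c n G \<and> (\<exists>y'\<in>G. \<exists>z'\<in>G. 1 / Suc k' \<le> z' - y')"
      using Q sub by (meson order_trans)
  qed (rule that)
  show ?thesis
  proof (rule that[of "1 / real (Suc k)"])
    fix x y assume "a \<le> x" "y \<le> b" "r \<le> y - x"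
    from k[OF this] c show "\<exists>n\<ge>1. \<exists>c\<in>C. \<exists>G\<subseteq>{x<..<y}. good U c n G \<and>
        (\<exists>y'\<in>G. \<exists>z'\<in>G. 1 / Suc k \<le> z' - y')"
      by meson
  qed simp
qed

lemma critical_distance_to_complement:
  assumes "nice_nbhd f a b U"
  obtains \<rho> where "\<rho> > 0" "\<And>c y. c \<in> C \<Longrightarrow> y \<notin> U \<Longrightarrow> \<rho> \<le> \<bar>c - y\<bar>"
proof -
  have "\<exists>\<rho>>0. \<forall>c\<in>C. \<forall>y. y \<notin> U \<longrightarrow> \<rho> \<le> \<bar>c - y\<bar>"
  proof (rule finite_uniform_real[OF finite_C])
    fix c assume "c \<in> C"
    then obtain e where e: "e > 0" "ball c e \<subseteq> U"
      using nice_nbhdD(1,2)[OF assms] by (meson open_contains_ball subsetD)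
    have "e \<le> \<bar>c - y\<bar>" if "y \<notin> U" for y
    proof -
      have "y \<notin> ball c e" using e(2) that by blast
      then show ?thesis by (simp add: dist_real_def)
    qed
    then show "\<exists>e>0. \<forall>y. y \<notin> U \<longrightarrow> e \<le> \<bar>c - y\<bar>" using e(1) by blast
  next
    show "\<forall>y. y \<notin> U \<longrightarrow> e' \<le> \<bar>c - y\<bar>" if "\<forall>y. y \<notin> U \<longrightarrow> e \<le> \<bar>c - y\<bar>" "0 < e'" "e' \<le> e" for c e e'
      using that by (meson order_trans)
  qed
  then show ?thesis using that by blast
qed

lemma closed_avoiding_set:
  assumes "open B" shows "closed {x \<in> N. \<forall>n. (f ^^ n) x \<notin> B}"
proof -
  have "closed (N \<inter> (\<Inter>n. N \<inter> (f ^^ n) -` (- B)))"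
    using assms by (intro closed_Int closed_INT ballI continuous_closed_preimage continuous_iterate) auto
  moreover have "{x \<in> N. \<forall>n. (f ^^ n) x \<notin> B} = N \<inter> (\<Inter>n. N \<inter> (f ^^ n) -` (- B))" by auto
  ultimately show ?thesis by simp
qed

lemma avoiding_set_invariant:
  assumes "x \<in> {x \<in> N. \<forall>n. (f ^^ n) x \<notin> B}" shows "(f ^^ k) x \<in> {x \<in> N. \<forall>n. (f ^^ n) x \<notin> B}"
proof -
  have "(f ^^ n) ((f ^^ k) x) \<notin> B" for n
  proof -
    have "(f ^^ n) ((f ^^ k) x) = (f ^^ (n + k)) x" by (simp only: funpow_add comp_apply)
    moreover have "(f ^^ (n + k)) x \<notin> B" using assms by blast
    ultimately show ?thesis by simp
  qed
  then show ?thesis using assms iterate_in_N[of x k] by blast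
qed

text \<open>Suppose that the images of \<open>T\<close> at times \<open>j < l\<close> contain the same critical point. Then the image at time
  \<open>j + (S - l)\<close> meets \<open>B\<close>. It also contains a point of the orbit of \<open>x\<close> before the first entry, so it
  contains a boundary point of \<open>B\<close>; but this point is in \<open>B\<close> at time \<open>S\<close>, against niceness.\<close>

lemma first_entry_hits_bounded:
  assumes U: "nice_nbhd f a b U" and B: "good U c n B"
    and uv: "{u<..<v} \<subseteq> N" "x = u \<or> x = v" "x \<in> N" "u < v"
    and into: "\<And>z. z \<in> insert x {u<..<v} \<Longrightarrow> (f ^^ S) z \<in> B"
    and first: "\<And>j. j < S \<Longrightarrow> (f ^^ j) x \<notin> B"
  shows "hits u v S \<le> card C"
proof -
  let ?T = "insert x {u<..<v}"
  let ?H = "{j. j < S \<and> (f ^^ j) ` {u<..<v} \<inter> C \<noteq> {}}"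
  have "?T = {u..<v} \<or> ?T = {u<..v}" using uv(2,4) by auto
  then have conT: "connected ?T" by (metis is_interval_co is_interval_connected_1 is_interval_oc)
  have TN: "?T \<subseteq> N" using uv by simp
  define ch where "ch j = (SOME c. c \<in> (f ^^ j) ` {u<..<v} \<inter> C)" for j
  have ch: "ch j \<in> (f ^^ j) ` {u<..<v} \<inter> C" if "j \<in> ?H" for j
    using that unfolding ch_def by (intro some_in_eq[THEN iffD2]) auto
  have ne: "ch j \<noteq> ch l" if jl: "j \<in> ?H" "l \<in> ?H" "j < l" for j l
  proof
    assume eq: "ch j = ch l"
    obtain y1 where y1: "y1 \<in> {u<..<v}" "ch j = (f ^^ j) y1" using ch[OF jl(1)] by blast
    obtain y2 where y2: "y2 \<in> {u<..<v}" "ch l = (f ^^ l) y2" using ch[OF jl(2)] by blast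
    have l: "l < S" using jl by simp
    define q where "q = S - l + j"
    have qS: "q < S" "l - j + q = S" using jl(3) l by (auto simp: q_def)
    have "(f ^^ q) y1 = (f ^^ (S - l)) ((f ^^ l) y2)"
      unfolding q_def funpow_add comp_apply using y1(2) y2(2) eq by simp
    also have "\<dots> = (f ^^ (S - l + l)) y2" by (simp only: funpow_add comp_apply)
    also have "\<dots> \<in> B" using into[of y2] y2(1) l by simp
    finally have "(f ^^ q) ` ?T \<inter> B \<noteq> {}" using y1(1) by blast
    moreover have "(f ^^ q) ` ?T - B \<noteq> {}" using first[OF qS(1)] by blast
    moreover have "connected ((f ^^ q) ` ?T)"
      using conT TN by (intro connected_continuous_image continuous_on_subset[OF continuous_iterate])
    ultimately have "(f ^^ q) ` ?T \<inter> frontier B \<noteq> {}" by (intro connected_Int_frontier)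
    then obtain y where y: "y \<in> ?T" "(f ^^ q) y \<in> frontier B" by blast
    have "open B" using good_interval_affine[OF nice_nbhdD(1)[OF U] B] by (metis open_greaterThanLessThan)
    then have "(f ^^ q) y \<in> closure B" "(f ^^ q) y \<notin> B" using y(2) by (auto simp: frontier_def interior_open)
    then have "(f ^^ (l - j)) ((f ^^ q) y) \<notin> B" by (rule good_interval_boundary(2)[OF U B])
    moreover have "(f ^^ (l - j)) ((f ^^ q) y) = (f ^^ S) y" using qS(2) by (metis comp_apply funpow_add)
    ultimately show False using into[OF y(1)] by simp
  qed
  have "inj_on ch ?H"
  proof (rule inj_onI)
    fix j l assume "j \<in> ?H" "l \<in> ?H" "ch j = ch l"
    then show "j = l" using ne[of j l] ne[of l j] by (cases j l rule: linorder_cases) auto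
  qed
  moreover have "ch ` ?H \<subseteq> C" using ch by blast
  ultimately show ?thesis unfolding hits_def using finite_C by (rule card_inj_on_le)
qed

end

context nonrenormalizable_map
begin

lemma iterate_surj: "(f ^^ n) ` N = N"
proof (induction n)
  case (Suc n)
  have P: "proper_interval (f ` N)" using ab maps by (intro proper_interval_image) auto
  have "closure (f ` N) = N"
    using maps by (intro invariant_interval_dense(1) P) auto
  moreover have "compact (f ` N)" using cont by (intro compact_continuous_image) auto
  ultimately have "f ` N = N" by (metis closure_closed compact_imp_closed)
  then show ?case using Suc iterate_image_image[of 1 n N] by simp
qed simp

text \<open>The point of \<open>N\<close> closest to \<open>x\<close> at which \<open>f ^^ S\<close> is outside \<open>B\<close>; there is one because
  \<open>f ^^ S\<close> is onto.\<close>

lemma exit_point: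
  assumes B: "open B" "B \<subseteq> N" and x: "x \<in> N" "(f ^^ S) x \<in> B"
  obtains e where "e \<in> N" "e \<noteq> x" "(f ^^ S) e \<notin> B"
    "\<And>z. min x e < z \<Longrightarrow> z < max x e \<Longrightarrow> (f ^^ S) z \<in> B"
proof -
  have "B \<subseteq> interior N" using B(2,1) by (rule interior_maximal)
  then have "a \<notin> B" by (auto simp: interior_atLeastAtMost_real)
  moreover have "a \<in> (f ^^ S) ` N" unfolding iterate_surj using ab by simp
  ultimately obtain y where y: "y \<in> N" "(f ^^ S) y \<notin> B" by auto
  have "closed (N \<inter> (f ^^ S) -` (- B))"
    using B(1) by (intro continuous_closed_preimage continuous_iterate) auto
  moreover have "N \<inter> (f ^^ S) -` (- B) \<noteq> {}" using y by blast
  ultimately obtain e where e: "e \<in> N \<inter> (f ^^ S) -` (- B)"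
      and nearest: "\<And>z. z \<in> N \<inter> (f ^^ S) -` (- B) \<Longrightarrow> dist x e \<le> dist x z"
    using distance_attains_inf by metis
  show ?thesis
  proof (rule that)
    show "e \<in> N" "(f ^^ S) e \<notin> B" "e \<noteq> x" using e x(2) by auto
    fix z assume z: "min x e < z" "z < max x e"
    then have "z \<in> N" "dist x z < dist x e" using x(1) e by (auto simp: dist_real_def min_def max_def split: if_splits)
    then show "(f ^^ S) z \<in> B" using nearest[of z] by auto
  qed
qed

end

context attractor_free_map
begin

section \<open>Full measure of the domain of the Markov map\<close>

text \<open>The points whose orbits miss \<open>B\<close> form a closed invariant set, which contains no interval by exactness.\<close>

lemma missing_good_interval_null:
  assumes B: "open B" "B \<noteq> {}" "B \<subseteq> N"
  shows "negligible {x \<in> N. \<forall>n. (f ^^ n) x \<notin> B}"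
proof -
  define A where "A = {x \<in> N. \<forall>n. (f ^^ n) x \<notin> B}"
  have cl: "closed A" unfolding A_def using B(1) by (rule closed_avoiding_set)
  have AN: "A \<subseteq> N" unfolding A_def by blast
  have inv: "f y \<in> A" if "y \<in> A" for y
    using avoiding_set_invariant[OF that[unfolded A_def], of 1] unfolding A_def by simp
  have noint: "\<not> {u<..<v} \<subseteq> A" if uv: "u < v" for u v
  proof
    assume sub: "{u<..<v} \<subseteq> A"
    have "B \<subseteq> interior N" using B(3,1) by (rule interior_maximal)
    then have "B \<subseteq> {a<..<b}" by (simp add: interior_atLeastAtMost_real)
    moreover obtain w where "w \<in> B" using B(2) by blast
    ultimately have w: "w \<in> B" "a < w" "w < b" by auto
    have "eventually_covers {u<..<v}" using uv sub AN by (intro exactness) auto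
    then obtain m where "{w..w} \<subseteq> (f ^^ m) ` {u<..<v}" using w unfolding eventually_covers_def by blast
    then show False using w(1) sub unfolding A_def by auto
  qed
  have "A \<subseteq> {x \<in> N. omega_limit f x \<subseteq> A}"
    using omega_limit_subset_forward_invariant[OF cl, of f] inv AN by blast
  then show ?thesis
    using omega_limit_in_nowhere_dense_null[OF cl AN noint] negligible_subset unfolding A_def by blast
qed

text \<open>The point \<open>x\<close> enters every \<open>B k\<close>. The interval between \<open>x\<close> and the exit point at the first entry time is
  short when \<open>k\<close> is large, since its image at a late time misses \<open>w\<close>. The constant \<open>\<kappa>\<close> does not depend on \<open>k\<close>, because
  the number of folds is at most the number of critical points.\<close>

lemma porosity_at_recurrent_points:
  assumes U: "fine_nice_nbhd f a b U" and w: "a < w" "w < b" "w \<notin> U"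
    and c0: "c0 \<in> C" and B: "\<And>k. good U c0 (\<nu> k) (B k)" and \<nu>: "\<And>k. \<nu> k \<ge> k"
  shows "\<exists>\<kappa>>0. \<forall>x\<in>N. (\<forall>k. \<exists>n. (f ^^ n) x \<in> B k) \<longrightarrow> (\<forall>e>0. \<exists>r y z n c G.
     0 < r \<and> r < e \<and> good U c n G \<and> n \<ge> 1 \<and> c \<in> C \<and> y \<in> G \<and> z \<in> G \<and> \<kappa> * r \<le> z - y \<and>
     \<bar>y - x\<bar> \<le> r \<and> \<bar>z - x\<bar> \<le> r)"
proof -
  note nice = fine_nice_nbhdD(1)[OF U]
  note niceD = nice_nbhdD[OF nice]
  let ?R = "smax / smin" and ?K = "real (Suc d)" and ?p = "card C"
  have R1: "1 \<le> ?R" using smin_pos smin_le_smax by simp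
  have K1: "1 \<le> ?K" by simp
  obtain \<rho> where \<rho>: "\<rho> > 0" "\<And>c y. c \<in> C \<Longrightarrow> y \<notin> U \<Longrightarrow> \<rho> \<le> \<bar>c - y\<bar>"
    using critical_distance_to_complement[OF nice] by metis
  \<comment> \<open>lower bound for the length of the affine branch when the stretched image has length at least \<open>\<rho>\<close>\<close>
  define r0 where "r0 = \<rho> / (?R ^ ?p * ?K ^ ?p)"
  have r0: "r0 > 0" using \<rho> R1 K1 by (simp add: r0_def)
  obtain \<kappa>0 where \<kappa>0: "\<kappa>0 > 0" "\<And>x y. a \<le> x \<Longrightarrow> y \<le> b \<Longrightarrow> r0 \<le> y - x \<Longrightarrow>
    \<exists>n\<ge>1. \<exists>c\<in>C. \<exists>G\<subseteq>{x<..<y}. good U c n G \<and> (\<exists>y'\<in>G. \<exists>z'\<in>G. \<kappa>0 \<le> z' - y')"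
    by (rule good_intervals_of_definite_length[OF U r0]) (rule that)
  define \<kappa> where "\<kappa> = \<kappa>0 / ((b - a) * ?K ^ ?p)"
  have \<kappa>: "\<kappa> > 0" using \<kappa>0(1) ab K1 by (simp add: \<kappa>_def)
  show ?thesis
  proof (rule exI[of _ \<kappa>], intro conjI ballI allI impI \<kappa>)
    fix x e :: real
    assume x: "x \<in> N" and visits: "\<forall>k. \<exists>n. (f ^^ n) x \<in> B k" and e: "e > 0"
    obtain M where M: "\<And>y z m. a \<le> y \<Longrightarrow> z \<le> b \<Longrightarrow> e \<le> z - y \<Longrightarrow> m \<ge> M \<Longrightarrow> {w..w} \<subseteq> (f ^^ m) ` {y<..<z}"
      using uniform_exactness[OF e w(1,2)] by blast
    define n where "n = \<nu> M"
    define B' where "B' = B M"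
    have nM: "n \<ge> M" using \<nu> by (simp add: n_def)
    have gB: "good U c0 n B'" unfolding n_def B'_def by (rule B)
    obtain ub vb \<mu> \<nu>b where uvb: "ub < vb" "B' = {ub<..<vb}" "{ub..vb} \<subseteq> N" "\<mu> \<noteq> 0"
      and affB: "\<And>y. y \<in> {ub..vb} \<Longrightarrow> (f ^^ n) y = \<mu> * y + \<nu>b"
      using good_interval_affine[OF niceD(1) gB] by metis
    have B'N: "B' \<subseteq> N" using gB unfolding good_interval_at_def by blast
    have openB: "open B'" using uvb by simp
    have fB: "(f ^^ n) ` B' \<subseteq> U" using gB connected_component_subset unfolding good_interval_at_def by metis
    define S where "S = (LEAST j. (f ^^ j) x \<in> B')"
    have "\<exists>j. (f ^^ j) x \<in> B'" using visits unfolding B'_def by (rule spec)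
    then have SB: "(f ^^ S) x \<in> B'" unfolding S_def by (rule LeastI_ex)
    have first: "(f ^^ j) x \<notin> B'" if "j < S" for j
      using that unfolding S_def by (rule not_less_Least)
    obtain y where y: "y \<in> N" "y \<noteq> x" "(f ^^ S) y \<notin> B'"
      and into: "\<And>z. min x y < z \<Longrightarrow> z < max x y \<Longrightarrow> (f ^^ S) z \<in> B'"
      using exit_point[OF openB B'N x SB] by metis
    define u where "u = min x y"
    define v where "v = max x y"
    have uv: "u < v" "{u..v} \<subseteq> N" "x = u \<or> x = v" "x \<in> {u..v}" "y \<in> {u..v}" "v - u = \<bar>y - x\<bar>"
      using x y(1,2) by (auto simp: u_def v_def)
    have opN: "{u<..<v} \<subseteq> N" using uv(2) by (auto simp: subset_iff)
    have into': "(f ^^ S) z \<in> B'" if "z \<in> {u<..<v}" for z using into that by (simp add: u_def v_def)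
    have clB: "(f ^^ S) z \<in> {ub..vb}" if z: "z \<in> {u..v}" for z
    proof -
      have "(f ^^ S) ` closure {u<..<v} \<subseteq> {ub..vb}"
        using uv into' uvb(2) by (intro image_closure_subset continuous_on_subset[OF continuous_iterate]) (auto simp: less_imp_le)
      then show ?thesis using z uv(1) by (metis closure_greaterThanLessThan image_subset_iff)
    qed
    have small: "v - u < e"
    proof (rule ccontr)
      assume "\<not> v - u < e"
      then have "{w..w} \<subseteq> (f ^^ (n + S)) ` {u<..<v}" using uv(1,2) nM by (intro M) auto
      then have "w \<in> (f ^^ n) ` ((f ^^ S) ` {u<..<v})" unfolding iterate_image_image by simp
      then show False using into' fB w(3) by blast
    qed
    have hits: "hits u v S \<le> ?p"
      using first_entry_hits_bounded[OF nice gB opN uv(3) x uv(1) _ first] into' SB by blast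
    obtain u' v' m k where uv': "u \<le> u'" "u' < v'" "v' \<le> v" "(v - u) / ?K ^ hits u v S \<le> v' - u'" "m \<noteq> 0"
      and aff: "\<And>z. z \<in> {u'..v'} \<Longrightarrow> (f ^^ S) z = m * z + k"
      and lip: "\<And>z z'. z \<in> {u..v} \<Longrightarrow> z' \<in> {u..v} \<Longrightarrow>
        \<bar>(f ^^ S) z - (f ^^ S) z'\<bar> \<le> \<bar>m\<bar> * ?R ^ hits u v S * \<bar>z - z'\<bar>"
      using bounded_folding[OF uv(1,2), of S] by metis
    have sub': "{u'..v'} \<subseteq> {u..v}" using uv' by auto
    have powK: "?K ^ hits u v S \<le> ?K ^ ?p" and powR: "?R ^ hits u v S \<le> ?R ^ ?p"
      using hits K1 R1 by (auto intro: power_increasing)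
    have long': "(v - u) / ?K ^ ?p \<le> v' - u'"
    proof -
      have "(v - u) / ?K ^ ?p \<le> (v - u) / ?K ^ hits u v S" using uv(1) powK K1 by (intro divide_left_mono) auto
      then show ?thesis using uv'(4) by linarith
    qed
    \<comment> \<open>the image in \<open>U\<close>, including the image of the exit point \<open>y\<close> on the boundary of \<open>U\<close>; it is stretched until time \<open>i\<close>\<close>
    define H where "H = (f ^^ (n + S)) ` {u..v}"
    have iH: "is_interval H" unfolding H_def using uv(2) by (intro is_interval_iterate_image) (auto simp: is_interval_cc)
    have HN: "H \<subseteq> N" unfolding H_def using uv(2) by (rule iterate_image_subset)
    have pH: "proper_interval H" unfolding H_def using uv by (intro proper_interval_iterate_image) auto
    have ex: "\<exists>i. (f ^^ i) ` H \<inter> C \<noteq> {}"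
    proof -
      obtain c where "c \<in> C" using C_nonempty by blast
      then show ?thesis using orbit_covers_interior[OF pH HN] C_interior[of c] by fastforce
    qed
    define i where "i = (LEAST i. (f ^^ i) ` H \<inter> C \<noteq> {})"
    have iC: "(f ^^ i) ` H \<inter> C \<noteq> {}" unfolding i_def using ex by (rule LeastI_ex)
    have "(f ^^ j) ` H \<inter> C = {}" if "j < i" for j
      using not_less_Least[of j "\<lambda>i. (f ^^ i) ` H \<inter> C \<noteq> {}"] that unfolding i_def by blast
    then have "inj_affine_on H (f ^^ i)" by (intro inj_affine_on_iterate iH HN)
    then obtain \<xi> l where \<xi>: "\<xi> \<noteq> 0" and aff\<xi>: "\<And>z. z \<in> H \<Longrightarrow> (f ^^ i) z = \<xi> * z + l"
      unfolding inj_affine_on_def by metis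
    let ?F = "f ^^ (i + (n + S))"
    have F: "?F z = \<xi> * (\<mu> * (f ^^ S) z + \<nu>b) + l" if z: "z \<in> {u..v}" for z
    proof -
      have "?F z = (f ^^ i) ((f ^^ (n + S)) z)" by (simp only: funpow_add comp_apply)
      also have "\<dots> = \<xi> * ((f ^^ (n + S)) z) + l" using z by (intro aff\<xi>) (simp add: H_def)
      also have "(f ^^ (n + S)) z = (f ^^ n) ((f ^^ S) z)" by (simp only: funpow_add comp_apply)
      also have "\<dots> = \<mu> * (f ^^ S) z + \<nu>b" by (rule affB[OF clB[OF z]])
      finally show ?thesis .
    qed
    define \<Lambda> where "\<Lambda> = \<xi> * \<mu> * m"
    have \<Lambda>: "\<Lambda> \<noteq> 0" using \<xi> uvb uv' by (simp add: \<Lambda>_def)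
    have F': "?F z = \<Lambda> * z + (\<xi> * (\<mu> * k + \<nu>b) + l)" if "z \<in> {u'..v'}" for z
    proof -
      have "z \<in> {u..v}" using that sub' by blast
      then show ?thesis using F[of z] aff[OF that] by (simp add: \<Lambda>_def algebra_simps)
    qed
    have FN: "?F z \<in> N" if "z \<in> {u..v}" for z using that uv(2) iterate_in_N by blast
    have yU: "?F y \<notin> U"
    proof -
      have "(f ^^ S) y \<in> closure B'" using clB[OF uv(5)] uvb by simp
      then have "(f ^^ n) ((f ^^ S) y) \<in> frontier U" using y(3) by (rule good_interval_boundary(1)[OF nice gB])
      then have "(f ^^ i) ((f ^^ n) ((f ^^ S) y)) \<notin> U" by (rule niceD(4))
      then show ?thesis by (simp add: funpow_add)
    qed
    \<comment> \<open>the stretched image joins a critical point to the image of \<open>y\<close>, which is not in \<open>U\<close>\<close>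
    have \<rho>le: "\<rho> \<le> \<bar>\<Lambda>\<bar> * ?R ^ ?p * (v - u)"
    proof -
      obtain c z where cz: "c \<in> C" "z \<in> {u..v}" "c = ?F z"
        using iC unfolding H_def iterate_image_image by blast
      have "\<rho> \<le> \<bar>?F z - ?F y\<bar>" using \<rho>(2)[OF cz(1) yU] cz(3) by simp
      also have "\<dots> = \<bar>\<xi> * \<mu> * ((f ^^ S) z - (f ^^ S) y)\<bar>"
        unfolding F[OF cz(2)] F[OF uv(5)] by (simp add: algebra_simps)
      also have "\<dots> = \<bar>\<xi> * \<mu>\<bar> * \<bar>(f ^^ S) z - (f ^^ S) y\<bar>" by (rule abs_mult)
      also have "\<dots> \<le> \<bar>\<xi> * \<mu>\<bar> * (\<bar>m\<bar> * ?R ^ hits u v S * \<bar>z - y\<bar>)"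
        using cz(2) uv(5) by (intro mult_left_mono lip) auto
      also have "\<dots> \<le> \<bar>\<xi> * \<mu>\<bar> * (\<bar>m\<bar> * ?R ^ ?p * (v - u))"
        using cz(2) uv(5) powR R1 by (intro mult_left_mono mult_mono) auto
      also have "\<dots> = \<bar>\<Lambda>\<bar> * ?R ^ ?p * (v - u)" by (simp add: \<Lambda>_def abs_mult)
      finally show ?thesis .
    qed
    have ends: "u' \<in> {u'..v'}" "v' \<in> {u'..v'}" using uv' by auto
    then have ends': "u' \<in> {u..v}" "v' \<in> {u..v}" using sub' by blast+
    define \<alpha> where "\<alpha> = min (?F u') (?F v')"
    define \<beta> where "\<beta> = max (?F u') (?F v')"
    have \<alpha>\<beta>: "a \<le> \<alpha>" "\<beta> \<le> b" using FN[OF ends'(1)] FN[OF ends'(2)] by (auto simp: \<alpha>_def \<beta>_def)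
    have len: "\<beta> - \<alpha> = \<bar>\<Lambda>\<bar> * (v' - u')"
    proof -
      have "\<beta> - \<alpha> = \<bar>?F v' - ?F u'\<bar>" by (auto simp: \<alpha>_def \<beta>_def)
      also have "?F v' - ?F u' = \<Lambda> * (v' - u')" unfolding F'[OF ends(1)] F'[OF ends(2)] by (simp add: algebra_simps)
      finally show ?thesis using uv'(2) by (simp add: abs_mult)
    qed
    have "r0 \<le> \<beta> - \<alpha>"
    proof -
      have "\<rho> / ?R ^ ?p \<le> \<bar>\<Lambda>\<bar> * (v - u)"
        using \<rho>le R1 by (subst pos_divide_le_eq) (auto simp: mult_ac)
      then have "\<rho> / ?R ^ ?p / ?K ^ ?p \<le> \<bar>\<Lambda>\<bar> * (v - u) / ?K ^ ?p" using K1 by (intro divide_right_mono) auto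
      also have "\<dots> = \<bar>\<Lambda>\<bar> * ((v - u) / ?K ^ ?p)" by simp
      also have "\<dots> \<le> \<bar>\<Lambda>\<bar> * (v' - u')" using long' by (intro mult_left_mono) auto
      finally show ?thesis unfolding len r0_def by (simp only: divide_divide_eq_left)
    qed
    then obtain q c G y' z' where G: "q \<ge> 1" "c \<in> C" "G \<subseteq> {\<alpha><..<\<beta>}" "good U c q G"
      and yz': "y' \<in> G" "z' \<in> G" "\<kappa>0 \<le> z' - y'"
      using \<kappa>0(2)[OF \<alpha>\<beta>] by blast
    have uvN': "{u'..v'} \<subseteq> N" using sub' uv(2) by blast
    have iF: "is_interval (?F ` {u'..v'})" using uvN' by (intro is_interval_iterate_image) (auto simp: is_interval_cc)
    have "{\<alpha>..\<beta>} \<subseteq> ?F ` {u'..v'}"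
      using ends by (intro is_interval_contains_segment[OF iF]) (auto simp only: \<alpha>_def \<beta>_def min_def max_def split: if_splits)
    then have GF: "G \<subseteq> ?F ` {u'..v'}" using G(3) by (auto simp: subset_iff)
    have affF: "inj_affine_on {u'..v'} ?F" unfolding inj_affine_on_def using \<Lambda> F' by blast
    obtain G' where G': "G' \<subseteq> {u'..v'}" "good U c (i + (n + S) + q) G'" "?F ` G' = G"
      using good_interval_pullback_affine[OF is_interval_cc uvN' affF G(4) GF] by metis
    have "is_interval G'" using G'(2) unfolding good_interval_at_def proper_interval_def by blast
    moreover have "y' \<in> ?F ` G'" "z' \<in> ?F ` G'" "y' \<le> z'" using yz' \<kappa>0(1) G'(3) by auto
    ultimately obtain \<eta> \<zeta> where \<eta>\<zeta>: "\<eta> \<in> G'" "\<zeta> \<in> G'" and "\<bar>\<Lambda>\<bar> * (\<zeta> - \<eta>) = z' - y'"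
      using affine_segment_pullback[OF _ \<Lambda> F'[OF subsetD[OF G'(1)]]] by metis
    then have dist: "\<kappa>0 \<le> \<bar>\<Lambda>\<bar> * (\<zeta> - \<eta>)" using yz'(3) by simp
    have upper: "\<bar>\<Lambda>\<bar> * (v - u) \<le> (b - a) * ?K ^ ?p"
    proof -
      have "\<bar>\<Lambda>\<bar> * ((v - u) / ?K ^ ?p) \<le> \<bar>\<Lambda>\<bar> * (v' - u')" using long' by (intro mult_left_mono) auto
      also have "\<dots> \<le> b - a" using len \<alpha>\<beta> by linarith
      finally have "\<bar>\<Lambda>\<bar> * (v - u) / ?K ^ ?p \<le> b - a" by simp
      then show ?thesis using K1 by (subst (asm) pos_divide_le_eq) auto
    qed
    have "\<kappa> * (v - u) \<le> \<zeta> - \<eta>"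
    proof -
      have "0 < \<bar>\<Lambda>\<bar> * (\<zeta> - \<eta>)" using dist \<kappa>0(1) by linarith
      then have pos: "0 < \<zeta> - \<eta>" using \<Lambda> by (simp add: zero_less_mult_iff)
      have "\<kappa>0 * (v - u) \<le> (\<bar>\<Lambda>\<bar> * (\<zeta> - \<eta>)) * (v - u)" using dist uv(1) by (intro mult_right_mono) auto
      also have "\<dots> = (\<bar>\<Lambda>\<bar> * (v - u)) * (\<zeta> - \<eta>)" by simp
      also have "\<dots> \<le> ((b - a) * ?K ^ ?p) * (\<zeta> - \<eta>)" using upper pos by (intro mult_right_mono) auto
      finally have le: "\<kappa>0 * (v - u) \<le> (\<zeta> - \<eta>) * ((b - a) * ?K ^ ?p)" by (simp only: mult.commute)
      have "0 < (b - a) * ?K ^ ?p" using ab K1 by simp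
      then have "\<kappa>0 * (v - u) / ((b - a) * ?K ^ ?p) \<le> \<zeta> - \<eta>" using le by (simp only: pos_divide_le_eq)
      then show ?thesis unfolding \<kappa>_def by (simp only: times_divide_eq_left)
    qed
    moreover have "\<bar>z - x\<bar> \<le> v - u" if "z \<in> G'" for z
    proof -
      have "z \<in> {u..v}" using that G'(1) sub' by blast
      then show ?thesis using uv(4) by auto
    qed
    ultimately show "\<exists>r y z n c G. 0 < r \<and> r < e \<and> good U c n G \<and> n \<ge> 1 \<and> c \<in> C \<and>
        y \<in> G \<and> z \<in> G \<and> \<kappa> * r \<le> z - y \<and> \<bar>y - x\<bar> \<le> r \<and> \<bar>z - x\<bar> \<le> r"
      using small uv(1) G'(2) G(1,2) \<eta>\<zeta>
      by (intro exI[of _ "v - u"] exI[of _ \<eta>] exI[of _ \<zeta>] exI[of _ "i + (n + S) + q"] exI[of _ c] exI[of _ G']) auto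
  qed
qed

text \<open>Porosity is available only at points that enter all the intervals \<open>B k\<close>; the exceptional set \<open>Z\<close> is null.\<close>

lemma markov_domain_full_measure:
  assumes U: "fine_nice_nbhd f a b U" and w: "a < w" "w < b" "w \<notin> U"
  shows "negligible (N - markov_domain f a b U)"
proof -
  have opU: "open U" using nice_nbhdD(1)[OF fine_nice_nbhdD(1)[OF U]] .
  obtain c0 where c0: "c0 \<in> C" using C_nonempty by blast
  obtain \<nu> B where B: "\<And>k. \<nu> k \<ge> k" "\<And>k. good U c0 (\<nu> k) (B k)"
    using good_interval_of_long_time[OF U c0] by metis
  have good_open: "open T" if "good U c n T" for c n T
    using good_interval_affine[OF opU that] by (metis open_greaterThanLessThan)
  let ?D = "markov_domain f a b U"
  have D: "T \<subseteq> ?D" if "good U c n T" "n \<ge> 1" "c \<in> C" for c n T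
    using that unfolding markov_domain_def good_interval_def by blast
  have opD: "open ?D" unfolding markov_domain_def good_interval_def using good_open by (intro open_Union) blast
  define Z where "Z = (\<Union>k. {x \<in> N. \<forall>n. (f ^^ n) x \<notin> B k})"
  have "negligible {x \<in> N. \<forall>n. (f ^^ n) x \<notin> B k}" for k
    using B(2)[of k] good_open[OF B(2)] unfolding good_interval_at_def proper_interval_def
    by (intro missing_good_interval_null) auto
  then have Z: "negligible Z" unfolding Z_def by (intro negligible_countable_Union) auto
  define S where "S = (N - ?D) - Z"
  have "N - ?D \<in> lmeasurable"
    using opD by (intro lmeasurable_compact compact_diff) auto
  then have S: "S \<in> lmeasurable" unfolding S_def
    using Z by (rule fmeasurable.Diff[OF _ negligible_imp_measurable])
  obtain \<kappa> where \<kappa>: "\<kappa> > 0" and por: "\<forall>x\<in>N. (\<forall>k. \<exists>n. (f ^^ n) x \<in> B k) \<longrightarrow> (\<forall>e>0. \<exists>r y z n c G.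
     0 < r \<and> r < e \<and> good U c n G \<and> n \<ge> 1 \<and> c \<in> C \<and> y \<in> G \<and> z \<in> G \<and> \<kappa> * r \<le> z - y \<and>
     \<bar>y - x\<bar> \<le> r \<and> \<bar>z - x\<bar> \<le> r)"
    using porosity_at_recurrent_points[OF U w c0 B(2,1)] by (elim exE conjE)
  have "negligible S"
  proof (rule porous_imp_negligible[OF S, of "\<kappa>/2"])
    fix x e :: real assume x: "x \<in> S" and e: "e > 0"
    have "x \<in> N" "\<forall>k. \<exists>n. (f ^^ n) x \<in> B k" using x unfolding S_def Z_def by auto
    moreover have "e / 2 > 0" using e by simp
    ultimately obtain r y z n c G where r: "0 < r" "r < e / 2" "good U c n G" "n \<ge> 1" "c \<in> C"
        "y \<in> G" "z \<in> G" "\<kappa> * r \<le> z - y" "\<bar>y - x\<bar> \<le> r" "\<bar>z - x\<bar> \<le> r"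
      using por by blast
    have "is_interval G" using r(3) unfolding good_interval_at_def proper_interval_def by blast
    then have "{y..z} \<subseteq> G" using r(6,7) by (rule is_interval_contains_segment)
    then have "{y<..<z} \<subseteq> ?D" using D[OF r(3-5)] by (auto simp: subset_iff less_imp_le)
    then have "{y<..<z} \<inter> S = {}" unfolding S_def by blast
    then show "\<exists>r u v. 0 < r \<and> r < e \<and> u \<in> ball x r \<and> v \<in> ball x r \<and> \<kappa> / 2 * r \<le> v - u \<and> {u<..<v} \<inter> S = {}"
      using r by (intro exI[of _ "2 * r"] exI[of _ y] exI[of _ z]) (auto simp: dist_real_def)
  qed (use \<kappa> in auto)
  then have "negligible (S \<union> Z)" using Z by (rule negligible_Un)
  then show ?thesis by (rule negligible_subset) (auto simp: S_def)
qed

end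

context piecewise_affine_map
begin

section \<open>Absorbing sets of maps with the Markov property\<close>

lemma negligible_iterate_preimage:
  assumes Z: "negligible Z" shows "negligible {x \<in> N. (f ^^ n) x \<in> Z}"
proof (induction n)
  case 0
  show ?case using Z by (rule negligible_subset) auto
next
  case (Suc n)
  let ?Z = "{x \<in> N. (f ^^ n) x \<in> Z}"
  have "negligible ((\<lambda>y. (y - t i) / s i) ` ?Z)" for i
    by (rule negligible_differentiable_image_negligible[OF _ Suc])
      (auto intro!: derivative_intros simp: divide_inverse)
  then have "negligible (\<Union>i\<in>{..d}. (\<lambda>y. (y - t i) / s i) ` ?Z)" by (intro negligible_Union) auto
  moreover have "{x \<in> N. (f ^^ Suc n) x \<in> Z} \<subseteq> (\<Union>i\<in>{..d}. (\<lambda>y. (y - t i) / s i) ` ?Z)"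
  proof
    fix x assume x: "x \<in> {x \<in> N. (f ^^ Suc n) x \<in> Z}"
    obtain i where i: "i \<le> d" "x \<in> {p i..p (Suc i)}" using piece_exists[of x] x by blast
    have "f x \<in> ?Z" using x iterate_in_N[of x 1] by (simp add: funpow_swap1)
    moreover have "x = (f x - t i) / s i" using affine[OF i] slope_nonzero[OF i(1)] by simp
    ultimately show "x \<in> (\<Union>i\<in>{..d}. (\<lambda>y. (y - t i) / s i) ` ?Z)" using i(1) by blast
  qed
  ultimately show ?case by (rule negligible_subset)
qed

text \<open>A boundary point of the component inside \<open>T\<close> would be mapped into \<open>U\<close> by \<open>f ^^ n\<close>.\<close>

lemma good_interval_in_component:
  assumes U: "nice_nbhd f a b U" and T: "good U c' n T" and x: "x \<in> T" "x \<in> connected_component_set U c"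
  shows "T \<subseteq> connected_component_set U c"
proof (rule ccontr)
  let ?W = "connected_component_set U c"
  assume "\<not> T \<subseteq> ?W"
  moreover have "connected T" using T unfolding good_interval_at_def proper_interval_def by (simp add: is_interval_connected_1)
  ultimately have "T \<inter> frontier ?W \<noteq> {}" using x by (intro connected_Int_frontier) auto
  then obtain z where z: "z \<in> T" "z \<in> frontier ?W" by blast
  then have "z \<in> frontier U" using frontier_of_connected_component_subset by blast
  then have "(f ^^ n) z \<notin> U" by (rule nice_nbhdD(4)[OF U])
  moreover have "(f ^^ n) z \<in> connected_component_set U c'" using T z(1) unfolding good_interval_at_def by blast
  ultimately show False using connected_component_subset[of U c'] by auto
qed

text \<open>Induction on \<open>k\<close> is iteration of the Markov map: preimages of null sets are null, and a good interval through
  the image of \<open>x\<close> lies in the component onto which the good interval through \<open>x\<close> is mapped, so it can be pulled back.\<close>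

lemma good_intervals_of_long_times_full_measure:
  assumes U: "nice_nbhd f a b U" and full: "negligible (N - markov_domain f a b U)"
  shows "negligible {x \<in> N. \<not> (\<exists>n\<ge>k. \<exists>c\<in>C. \<exists>T. good U c n T \<and> x \<in> T)}"
proof (induction k)
  case 0
  have "{x \<in> N. \<not> (\<exists>n\<ge>0. \<exists>c\<in>C. \<exists>T. good U c n T \<and> x \<in> T)} \<subseteq> N - markov_domain f a b U"
    unfolding markov_domain_def good_interval_def by blast
  then show ?case using full negligible_subset by blast
next
  case (Suc k)
  let ?Z = "{x \<in> N. \<not> (\<exists>n\<ge>k. \<exists>c\<in>C. \<exists>T. good U c n T \<and> x \<in> T)}"
  let ?Y = "(N - markov_domain f a b U) \<union> (\<Union>n. {x \<in> N. (f ^^ n) x \<in> ?Z})"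
  have "negligible {x \<in> N. (f ^^ n) x \<in> ?Z}" for n using Suc by (rule negligible_iterate_preimage)
  then have "negligible (\<Union>n. {x \<in> N. (f ^^ n) x \<in> ?Z})" by (intro negligible_countable_Union) auto
  with full have "negligible ?Y" by (rule negligible_Un)
  moreover have "{x \<in> N. \<not> (\<exists>n\<ge>Suc k. \<exists>c\<in>C. \<exists>T. good U c n T \<and> x \<in> T)} \<subseteq> ?Y"
  proof
    fix x assume x: "x \<in> {x \<in> N. \<not> (\<exists>n\<ge>Suc k. \<exists>c\<in>C. \<exists>T. good U c n T \<and> x \<in> T)}"
    show "x \<in> ?Y"
    proof (rule ccontr)
      assume nY: "x \<notin> ?Y"
      then have "x \<in> markov_domain f a b U" using x by blast
      then obtain n c T where T: "n \<ge> 1" "c \<in> C" "good U c n T" "x \<in> T"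
        unfolding markov_domain_def good_interval_def by blast
      have "(f ^^ n) x \<notin> ?Z" using nY x by blast
      moreover have "(f ^^ n) x \<in> N" using x by (blast intro: iterate_in_N)
      ultimately obtain n' c' T' where T': "n' \<ge> k" "c' \<in> C" "good U c' n' T'" "(f ^^ n) x \<in> T'"
        by blast
      have TN: "is_interval T" "T \<subseteq> N" and img: "(f ^^ n) ` T = connected_component_set U c"
        using T(3) unfolding good_interval_at_def proper_interval_def by auto
      have "(f ^^ n) x \<in> connected_component_set U c" using img T(4) by blast
      then have sub: "T' \<subseteq> (f ^^ n) ` T" unfolding img using good_interval_in_component[OF U T'(3,4)] by blast
      obtain u v m l where uv: "T = {u<..<v}" "m \<noteq> 0" "\<And>x. x \<in> {u..v} \<Longrightarrow> (f ^^ n) x = m * x + l"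
        using good_interval_affine[OF nice_nbhdD(1)[OF U] T(3)] by metis
      have "(f ^^ n) y = m * y + l" if "y \<in> T" for y using that uv(3)[of y] uv(1) by auto
      then have "good U c' (n + n') {y \<in> T. (f ^^ n) y \<in> T'}"
        using good_interval_pullback(1)[OF TN uv(2) _ T'(3) sub] by blast
      moreover have "x \<in> {y \<in> T. (f ^^ n) y \<in> T'}" using T(4) T'(4) by simp
      moreover have "n + n' \<ge> Suc k" using T(1) T'(1) by simp
      ultimately show False using x T'(2) by blast
    qed
  qed
  ultimately show ?case by (rule negligible_subset)
qed

text \<open>An interval of length \<open>e\<close> contains a good interval whose time is bounded in terms of \<open>e\<close>, so it meets a critical
  point within bounded time, and no later iterate is monotone on it.\<close>

lemma long_good_intervals_are_short:
  assumes U: "fine_nice_nbhd f a b U" and e: "e > 0"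
  obtains M where "\<And>n c T x y. n \<ge> M \<Longrightarrow> good U c n T \<Longrightarrow> x \<in> T \<Longrightarrow> y \<in> T \<Longrightarrow> y - x < e"
proof -
  note nice = nice_nbhdD[OF fine_nice_nbhdD(1)[OF U]]
  obtain c0 where c0: "c0 \<in> C" using C_nonempty by blast
  obtain M where M: "\<And>x y. a \<le> x \<Longrightarrow> y \<le> b \<Longrightarrow> e \<le> y - x \<Longrightarrow> \<exists>m<M. (f ^^ m) ` {x<..<y} \<inter> C \<noteq> {}"
  proof (rule uniform_on_long_intervals[OF ab e])
    fix u v :: real assume "u < v" "{u..v} \<subseteq> N"
    then have "proper_interval {u<..<v}" "{u<..<v} \<subseteq> N" by (auto simp: subset_iff)
    then obtain m T where T: "T \<subseteq> {u<..<v}" "good U c0 m T"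
      using fine_nice_nbhdD(2)[OF U _ _ c0] by blast
    have "c0 \<in> connected_component_set U c0" using nice(2) c0 by (auto intro: connected_component_refl)
    then have "c0 \<in> (f ^^ m) ` T" using T(2) unfolding good_interval_at_def by blast
    then have "(f ^^ m) ` {u<..<v} \<inter> C \<noteq> {}" using T(1) c0 by blast
    then show "\<exists>M. \<exists>m<M. (f ^^ m) ` {u<..<v} \<inter> C \<noteq> {}" by blast
  next
    fix u v x y :: real and k k' :: nat
    assume "\<exists>m<k. (f ^^ m) ` {u<..<v} \<inter> C \<noteq> {}" "{u<..<v} \<subseteq> {x<..<y}" "k \<le> k'"
    then show "\<exists>m<k'. (f ^^ m) ` {x<..<y} \<inter> C \<noteq> {}" by (meson disjoint_iff image_mono less_le_trans subsetD)
  qed (rule that)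
  have "y - x < e" if n: "n \<ge> M" and T: "good U c n T" and xy: "x \<in> T" "y \<in> T" for n c T x y
  proof (rule ccontr)
    assume long: "\<not> y - x < e"
    have TN: "T \<subseteq> N" "is_interval T" and mono: "mono_on T (f ^^ n) \<or> antimono_on T (f ^^ n)"
      using T unfolding good_interval_at_def proper_interval_def by auto
    have "x \<in> N" "y \<in> N" using xy TN by blast+
    then obtain m where m: "m < M" "(f ^^ m) ` {x<..<y} \<inter> C \<noteq> {}" using M[of x y] long by auto
    have xyT: "{x<..<y} \<subseteq> T" using is_interval_contains_segment[OF TN(2) xy] by (auto simp: subset_iff less_imp_le)
    have "(f ^^ m) ` {x<..<y} \<inter> C = {}"
    proof (rule monotone_iterate_off_C)
      show "{x<..<y} \<subseteq> N" using xyT TN by blast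
      show "mono_on {x<..<y} (f ^^ n) \<or> antimono_on {x<..<y} (f ^^ n)" using mono xyT monotone_on_subset by blast
      show "m < n" using m n by simp
    qed
    then show False using m(2) by blast
  qed
  then show ?thesis by (rule that)
qed

text \<open>Each component of \<open>U\<close> contains a segment whose points are mapped into the target interval by an iterate. Its
  preimages in the good intervals around a point are gaps of definite proportion.\<close>

lemma avoiding_orbits_null:
  assumes U: "fine_nice_nbhd f a b U" and full: "negligible (N - markov_domain f a b U)"
    and c0: "c0 \<in> C" and J: "j1 < j2" "{j1<..<j2} \<subseteq> connected_component_set U c0"
  shows "negligible {x \<in> N. \<forall>n. (f ^^ n) x \<notin> {j1<..<j2}}"
proof -
  note nn = fine_nice_nbhdD(1)[OF U]
  note nice = nice_nbhdD[OF nn]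
  define F where "F = {x \<in> N. \<forall>n. (f ^^ n) x \<notin> {j1<..<j2}}"
  have Finv: "(f ^^ n) x \<in> F" if "x \<in> F" for x n
    using that unfolding F_def by (rule avoiding_set_invariant)
  have "\<exists>\<kappa>>0. \<forall>c\<in>C. \<exists>y z. y \<in> connected_component_set U c \<and> z \<in> connected_component_set U c \<and> \<kappa> \<le> z - y \<and> {y..z} \<inter> F = {}"
  proof (rule finite_uniform_real[OF finite_C])
    fix c assume c: "c \<in> C"
    let ?W = "connected_component_set U c"
    have "proper_interval ?W" "?W \<subseteq> N"
      using good_interval_at_zero[OF nice(1,3), of c] nice(2) c unfolding good_interval_at_def by auto
    then obtain n T where T: "T \<subseteq> ?W" "good U c0 n T"
      using fine_nice_nbhdD(2)[OF U _ _ c0] by blast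
    obtain u v m l where uv: "T = {u<..<v}" "m \<noteq> 0" "\<And>x. x \<in> {u..v} \<Longrightarrow> (f ^^ n) x = m * x + l"
      using good_interval_affine[OF nice(1) T(2)] by metis
    \<comment> \<open>a closed segment, so that its endpoints have preimages in \<open>T\<close>\<close>
    define i1 where "i1 = (2 * j1 + j2) / 3"
    define i2 where "i2 = (j1 + 2 * j2) / 3"
    have i: "j1 < i1" "i1 < i2" "i2 < j2" using J(1) by (auto simp: i1_def i2_def field_simps)
    have "{j1<..<j2} \<subseteq> (f ^^ n) ` T" using J(2) T(2) unfolding good_interval_at_def by simp
    moreover have "i1 \<in> {j1<..<j2}" "i2 \<in> {j1<..<j2}" using i by auto
    ultimately have "i1 \<in> (f ^^ n) ` T" "i2 \<in> (f ^^ n) ` T" "i1 \<le> i2" using i by (blast, blast, simp)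
    moreover have "is_interval T" "\<And>x. x \<in> T \<Longrightarrow> (f ^^ n) x = m * x + l"
      using uv(1,3) by (auto simp: is_interval_oo)
    ultimately obtain y' z' where yz: "y' \<in> T" "z' \<in> T" "y' \<le> z'" "\<bar>m\<bar> * (z' - y') = i2 - i1"
        "(f ^^ n) ` {y'..z'} = {i1..i2}"
      using affine_segment_pullback[OF _ uv(2)] by metis
    have "y' < z'" using yz(3,4) i(2) by (cases "y' = z'") auto
    have "{i1..i2} \<subseteq> {j1<..<j2}" using i by auto
    then have "{y'..z'} \<inter> F = {}" using yz(5) unfolding F_def by blast
    moreover have "y' \<in> ?W" "z' \<in> ?W" using T(1) yz by blast+
    ultimately show "\<exists>\<kappa>>0. \<exists>y z. y \<in> ?W \<and> z \<in> ?W \<and> \<kappa> \<le> z - y \<and> {y..z} \<inter> F = {}"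
      using \<open>y' < z'\<close> by (intro exI[of _ "z' - y'"] conjI exI[of _ y'] exI[of _ z']) auto
  next
    show "\<exists>y z. y \<in> connected_component_set U c \<and> z \<in> connected_component_set U c \<and> e' \<le> z - y \<and> {y..z} \<inter> F = {}"
      if "\<exists>y z. y \<in> connected_component_set U c \<and> z \<in> connected_component_set U c \<and> e \<le> z - y \<and> {y..z} \<inter> F = {}"
        "0 < e'" "e' \<le> e" for c e e'
      using that(1,3) by (meson order_trans)
  qed
  then obtain \<kappa>0 where \<kappa>0: "\<kappa>0 > 0" and gaps: "\<forall>c\<in>C. \<exists>y z. y \<in> connected_component_set U c \<and>
      z \<in> connected_component_set U c \<and> \<kappa>0 \<le> z - y \<and> {y..z} \<inter> F = {}"
    by blast
  define Z where "Z = (\<Union>k. {x \<in> N. \<not> (\<exists>n\<ge>k. \<exists>c\<in>C. \<exists>T. good U c n T \<and> x \<in> T)})"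
  have Z: "negligible Z" unfolding Z_def
    using good_intervals_of_long_times_full_measure[OF nn full] by (intro negligible_countable_Union) auto
  define S where "S = F - Z"
  have "closed F" unfolding F_def by (rule closed_avoiding_set) simp
  moreover have "F \<subseteq> N" unfolding F_def by blast
  ultimately have "compact F" using bounded_subset[OF bounded_closed_interval] by (auto simp: compact_eq_bounded_closed)
  then have S: "S \<in> lmeasurable" unfolding S_def
    using Z by (intro fmeasurable.Diff[OF lmeasurable_compact negligible_imp_measurable])
  define \<kappa> where "\<kappa> = \<kappa>0 / (2 * (b - a))"
  have \<kappa>: "\<kappa> > 0" using \<kappa>0 ab by (simp add: \<kappa>_def)
  have "negligible S"
  proof (rule porous_imp_negligible[OF S \<kappa>])
    fix x e :: real assume x: "x \<in> S" and e: "e > 0"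
    have "e / 4 > 0" using e by simp
    then obtain M where M: "\<And>n c T x y. n \<ge> M \<Longrightarrow> good U c n T \<Longrightarrow> x \<in> T \<Longrightarrow> y \<in> T \<Longrightarrow> y - x < e / 4"
      using long_good_intervals_are_short[OF U] by blast
    have "x \<in> N" "x \<notin> Z" using x unfolding S_def F_def by auto
    then obtain n c T where T: "n \<ge> M" "c \<in> C" "good U c n T" "x \<in> T"
      unfolding Z_def by blast
    let ?W = "connected_component_set U c"
    obtain u v m l where uv: "u < v" "T = {u<..<v}" "m \<noteq> 0" "{u..v} \<subseteq> N"
      and affc: "\<And>x. x \<in> {u..v} \<Longrightarrow> (f ^^ n) x = m * x + l"
      using good_interval_affine[OF nice(1) T(3)] by metis
    have small: "v - u \<le> e / 4"
    proof (rule ccontr)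
      assume "\<not> v - u \<le> e / 4"
      define h where "h = (v - u - e / 4) / 2"
      have h: "0 < h" "2 * h < v - u" using \<open>\<not> v - u \<le> e / 4\<close> e by (auto simp: h_def)
      have "u + h \<in> T" "v - h \<in> T" using h unfolding uv(2) by auto
      then have "(v - h) - (u + h) < e / 4" by (rule M[OF T(1,3)])
      then show False by (simp add: h_def field_simps)
    qed
    have len: "\<bar>m\<bar> * (v - u) \<le> b - a"
    proof -
      have "u \<in> {u..v}" "v \<in> {u..v}" using uv(1) by auto
      then have "(f ^^ n) u \<in> N" "(f ^^ n) v \<in> N" using uv(4) iterate_in_N by blast+
      then have "\<bar>(f ^^ n) v - (f ^^ n) u\<bar> \<le> b - a" by auto
      moreover have "(f ^^ n) v - (f ^^ n) u = m * (v - u)" using affc[of u] affc[of v] uv(1) by (simp add: algebra_simps)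
      ultimately show ?thesis using uv(1) by (simp add: abs_mult)
    qed
    obtain y z where yz: "y \<in> ?W" "z \<in> ?W" "\<kappa>0 \<le> z - y" "{y..z} \<inter> F = {}" using gaps T(2) by blast
    have "(f ^^ n) ` T = ?W" using T(3) unfolding good_interval_at_def by blast
    then have "y \<in> (f ^^ n) ` T" "z \<in> (f ^^ n) ` T" "y \<le> z" using yz(1-3) \<kappa>0 by auto
    moreover have "is_interval T" "\<And>x. x \<in> T \<Longrightarrow> (f ^^ n) x = m * x + l"
      using uv(2) affc by (auto simp: is_interval_oo)
    ultimately obtain y' z' where yzT: "y' \<in> T" "z' \<in> T" and dist: "\<bar>m\<bar> * (z' - y') = z - y"
        and img: "(f ^^ n) ` {y'..z'} = {y..z}"
      using affine_segment_pullback[OF _ uv(3)] by metis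
    have "x \<notin> F" if "x \<in> {y'..z'}" for x using that img yz(4) Finv by blast
    then have "{y'<..<z'} \<inter> S = {}" unfolding S_def by (auto simp: less_imp_le)
    moreover have "\<kappa> * (2 * (v - u)) \<le> z' - y'"
    proof -
      have 1: "\<kappa>0 \<le> \<bar>m\<bar> * (z' - y')" using dist yz(3) by simp
      then have "0 < \<bar>m\<bar> * (z' - y')" using \<kappa>0 by linarith
      then have pos: "0 < z' - y'" using uv(3) by (simp add: zero_less_mult_iff)
      have "\<kappa>0 * (v - u) \<le> \<bar>m\<bar> * (z' - y') * (v - u)" using 1 uv(1) by (intro mult_right_mono) auto
      also have "\<dots> = \<bar>m\<bar> * (v - u) * (z' - y')" by simp
      also have "\<dots> \<le> (b - a) * (z' - y')" using len pos by (intro mult_right_mono) auto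
      finally have "\<kappa>0 * (v - u) / (b - a) \<le> z' - y'" using ab by (simp add: pos_divide_le_eq mult.commute)
      moreover have "\<kappa> * (2 * (v - u)) = \<kappa>0 * (v - u) / (b - a)" using ab by (simp add: \<kappa>_def field_simps)
      ultimately show ?thesis by simp
    qed
    moreover have "0 < 2 * (v - u)" "2 * (v - u) < e" using small uv(1) e by auto
    moreover have "w \<in> ball x (2 * (v - u))" if "w \<in> T" for w
      using that T(4) unfolding uv(2) by (auto simp: dist_real_def)
    ultimately show "\<exists>r u v. 0 < r \<and> r < e \<and> u \<in> ball x r \<and> v \<in> ball x r \<and> \<kappa> * r \<le> v - u \<and> {u<..<v} \<inter> S = {}"
      using yzT by (intro exI[of _ "2 * (v - u)"] exI[of _ y'] exI[of _ z']) auto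
  qed
  then have "negligible (S \<union> Z)" using Z by (rule negligible_Un)
  then have "negligible F" by (rule negligible_subset) (auto simp: S_def)
  then show ?thesis unfolding F_def .
qed

text \<open>An orbit that converges to \<open>A\<close> stays away from an interval around a point \<open>q\<close> outside \<open>A\<close> from some
  time on.\<close>

lemma full_markov_domain_imp_no_zero_dimensional_absorbing_set:
  assumes U: "fine_nice_nbhd f a b U" and full: "negligible (N - markov_domain f a b U)"
    and A: "absorbing_set f a b A" "zero_dimensional A"
  shows False
proof -
  note nice = nice_nbhdD[OF fine_nice_nbhdD(1)[OF U]]
  have cl: "closed A" and pos: "emeasure lebesgue {x\<in>N. omega_limit f x \<subseteq> A} > 0"
    using A(1) unfolding absorbing_set_def by auto
  have ne: "A \<noteq> {}" using A(2) unfolding zero_dimensional_def by auto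
  obtain c0 where c0: "c0 \<in> C" using C_nonempty by blast
  let ?W = "connected_component_set U c0"
  have "open ?W" using nice(1) by (rule open_connected_component)
  have "proper_interval ?W"
    using good_interval_at_zero[OF nice(1,3), of c0] nice(2) c0 unfolding good_interval_at_def by auto
  then obtain u v where uv: "u < v" "{u..v} \<subseteq> ?W" by (rule proper_interval_contains_segment)
  have "\<not> {u..v} \<subseteq> A" using zero_dimensional_imp_no_interval[OF A(2) uv(1)] .
  then obtain q where q: "q \<in> ?W" "q \<notin> A" using uv(2) by blast
  then have dq: "infdist q A > 0" using cl ne by (metis in_closed_iff_infdist_zero infdist_nonneg less_eq_real_def)
  obtain e where e: "e > 0" "ball q e \<subseteq> ?W" using \<open>open ?W\<close> q(1) by (meson open_contains_ball)
  define h where "h = min e (infdist q A / 2)"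
  have h: "h > 0" "h \<le> e" "h \<le> infdist q A / 2" using e dq by (auto simp: h_def)
  define F where "F = {x \<in> N. \<forall>n. (f ^^ n) x \<notin> {q - h<..<q + h}}"
  have "{q - h<..<q + h} \<subseteq> ball q e" using h by (auto simp: dist_real_def)
  then have "{q - h<..<q + h} \<subseteq> ?W" using e(2) by blast
  then have "negligible F" unfolding F_def
    using h(1) by (intro avoiding_orbits_null[OF U full c0]) auto
  then have "negligible {x \<in> N. (f ^^ k) x \<in> F}" for k by (rule negligible_iterate_preimage)
  then have "negligible (\<Union>k. {x \<in> N. (f ^^ k) x \<in> F})" by (intro negligible_countable_Union) auto
  moreover have "{x\<in>N. omega_limit f x \<subseteq> A} \<subseteq> (\<Union>k. {x \<in> N. (f ^^ k) x \<in> F})"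
  proof
    fix x assume x: "x \<in> {x\<in>N. omega_limit f x \<subseteq> A}"
    then have xN: "x \<in> N" and sub: "omega_limit f x \<subseteq> A" by auto
    obtain k :: nat where k: "1 / Suc k < infdist q A / 2"
      using dq by (metis half_gt_zero inverse_eq_divide reals_Archimedean)
    obtain n where n: "\<And>m. m \<ge> n \<Longrightarrow> infdist ((f ^^ m) x) A < 1 / Suc k"
      using omega_limit_subset_iff[OF iterate_in_N[OF xN] cl ne] sub by blast
    have "(f ^^ m) ((f ^^ n) x) \<notin> {q - h<..<q + h}" for m
    proof
      assume in_J: "(f ^^ m) ((f ^^ n) x) \<in> {q - h<..<q + h}"
      have eq: "(f ^^ m) ((f ^^ n) x) = (f ^^ (m + n)) x" by (simp only: funpow_add comp_apply)
      have "infdist q A \<le> infdist ((f ^^ (m + n)) x) A + dist q ((f ^^ (m + n)) x)" by (rule infdist_triangle)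
      moreover have "dist q ((f ^^ (m + n)) x) < h" using in_J unfolding eq by (auto simp: dist_real_def)
      ultimately show False using n[of "m + n"] k h by simp
    qed
    then have "(f ^^ n) x \<in> F" unfolding F_def using iterate_in_N[OF xN] by blast
    then show "x \<in> (\<Union>k. {x \<in> N. (f ^^ k) x \<in> F})" using xN by blast
  qed
  ultimately have "negligible {x\<in>N. omega_limit f x \<subseteq> A}" by (rule negligible_subset)
  then show False using pos by (simp add: negligible_iff_null_sets null_setsD1)
qed

end

section \<open>The equivalence\<close>

text \<open>This excludes maps without critical points. Such a map has slope at most 1 in absolute value, so a small neighborhood
  of a fixed point in its domain is invariant.\<close>

lemma affine_self_map_renormalizable:
  assumes ab: "a < b" and maps: "f ` {a..b} \<subseteq> {a..b}" and aff: "\<And>x. x \<in> {a..b} \<Longrightarrow> f x = m * x + (c :: real)"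
  shows "\<not> non_renormalizable f a b"
proof -
  have "a \<in> {a..b}" "b \<in> {a..b}" using ab by auto
  then have ends: "m * a + c \<in> {a..b}" "m * b + c \<in> {a..b}"
    using maps aff[of a] aff[of b] by (metis image_subset_iff)+
  then have "\<bar>(m * b + c) - (m * a + c)\<bar> \<le> b - a" by auto
  then have "\<bar>m * (b - a)\<bar> \<le> b - a" by (simp add: algebra_simps)
  then have m: "\<bar>m\<bar> \<le> 1" using ab by (simp add: abs_mult)
  have "\<exists>q\<ge>a. q \<le> b \<and> m * q + c - q = 0"
    using ends ab by (intro IVT2') (auto intro!: continuous_intros)
  then obtain q where q: "a \<le> q" "q \<le> b" "m * q + c = q" by auto
  define h where "h = (b - a) / 4"
  have h: "h > 0" "2 * h < b - a" using ab by (auto simp: h_def)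
  define I where "I = {max a (q - h)..min b (q + h)}"
  have "max a (q - h) < min b (q + h)" using q h by (auto simp: max_def min_def)
  then have pI: "proper_interval I" unfolding I_def by simp
  have IN: "I \<subseteq> {a..b}" unfolding I_def by auto
  have inv: "f ` I \<subseteq> I"
  proof
    fix y assume "y \<in> f ` I"
    then obtain x where x: "x \<in> I" "y = f x" by blast
    have xN: "x \<in> {a..b}" using x IN by blast
    have "f x - q = m * (x - q)" using aff[OF xN] q(3) by (simp add: algebra_simps)
    then have "\<bar>f x - q\<bar> \<le> 1 * \<bar>x - q\<bar>" using m by (simp only: abs_mult mult_right_mono abs_ge_zero)
    also have "\<dots> \<le> h" using x(1) unfolding I_def by auto
    finally have "\<bar>f x - q\<bar> \<le> h" .
    moreover have "f x \<in> {a..b}" using maps xN by blast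
    ultimately show "y \<in> I" using x(2) unfolding I_def by auto
  qed
  have "closure I \<noteq> {a..b}"
  proof
    assume "closure I = {a..b}"
    then have "I = {a..b}" unfolding I_def by simp
    then have "a \<in> I" "b \<in> I" using ab by auto
    then show False using h unfolding I_def by auto
  qed
  then have "renormalization f a b I 1" unfolding renormalization_def using pI IN inv by auto
  then show ?thesis unfolding non_renormalizable_def by blast
qed

lemma piecewise_affine_mapE:
  assumes "a < b" "piecewise_affine f a b" "non_renormalizable f a b"
  obtains d p s t where "piecewise_affine_map f a b d p s t"
proof -
  obtain d p where P: "affine_partition f a b d p" and cont: "continuous_on {a..b} f" and maps: "f ` {a..b} \<subseteq> {a..b}"
    using assms(2) unfolding piecewise_affine_def by blast
  then obtain s t where 0: "p 0 = a" "p (Suc d) = b" and st: "\<forall>i\<le>d. p i < p (Suc i)"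
    and aff: "\<forall>i\<le>d. \<forall>x\<in>{p i..p (Suc i)}. f x = s i * x + t i" and alt: "\<forall>i<d. s i * s (Suc i) < 0"
    unfolding affine_partition_def by blast
  have "d \<noteq> 0"
  proof
    assume "d = 0"
    then have "\<And>x. x \<in> {a..b} \<Longrightarrow> f x = s 0 * x + t 0" using aff 0 by auto
    then show False using affine_self_map_renormalizable[OF assms(1) maps] assms(3) by blast
  qed
  then have "piecewise_affine_map f a b d p s t"
    using assms(1) cont maps 0 st aff alt by unfold_locales auto
  then show ?thesis by (rule that)
qed

lemma markov_property_iff:
  "markov_property f a b \<longleftrightarrow> (\<exists>U. fine_nice_nbhd f a b U \<and> negligible ({a..b} - markov_domain f a b U))"
proof -
  have "dom (markov_map f a b U) = markov_domain f a b U" for U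
    by (auto simp: markov_map_def Let_def dom_def)
  then show ?thesis unfolding markov_property_def by (simp add: negligible_iff_null_sets)
qed

theorem theoremA:
  fixes f :: "real \<Rightarrow> real" and a b :: real
  assumes "a < b"
    and "piecewise_affine f a b"
    and "non_renormalizable f a b"
  shows "markov_property f a b \<longleftrightarrow> \<not> (\<exists>A. absorbing_set f a b A \<and> zero_dimensional A)"
proof -
  obtain d p s t where "piecewise_affine_map f a b d p s t" using piecewise_affine_mapE[OF assms] .
  then interpret nonrenormalizable_map f a b d p s t
    using assms(3) by (simp add: nonrenormalizable_map_def nonrenormalizable_map_axioms_def)
  show ?thesis
  proof
    assume "markov_property f a b"
    then show "\<not> (\<exists>A. absorbing_set f a b A \<and> zero_dimensional A)"
      unfolding markov_property_iff using full_markov_domain_imp_no_zero_dimensional_absorbing_set by blast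
  next
    assume "\<not> (\<exists>A. absorbing_set f a b A \<and> zero_dimensional A)"
    then interpret attractor_free_map f a b d p s t by unfold_locales
    obtain U w where "fine_nice_nbhd f a b U" "a < w" "w < b" "w \<notin> U" using exists_fine_nice_nbhd by blast
    then show "markov_property f a b"
      unfolding markov_property_iff using markov_domain_full_measure by blast
  qed
qed

end
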